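(* Let $R$ be a skew-invertible Hecke symmetry and let $\mathbf{d}=\mathrm{Tr}_R(\mathfrak{D}D)=\sum_{i,j,k=1}^N C_i^j\,d_j^{\,k}\,\partial_k^{\,i}$ be the de Rham operator associated with the (modified) reflection equation algebra $\mathcal{M}(R)$. Then $\mathbf{d}^2=0$.
   Context: The ground field is $\mathbb{C}$. $V$ is a vector space of dimension $N<\infty$. A Hecke symmetry is an invertible operator $R\in\mathrm{End}(V^{\otimes2})$ (identified with its matrix) satisfying the braid relation $R_{12}R_{23}R_{12}=R_{23}R_{12}R_{23}$ and the Hecke condition $(R-qI)(R+q^{-1}I)=0$, where $q\in\mathbb{C}\setminus\{0\}$ and $q+q^{-1}\ne0$. Here $R_{12}=R\otimes\mathrm{id}_V$ and $R_{23}=\mathrm{id}_V\otimes R$. $R$ is skew-invertible if there is $\Psi\in\mathrm{End}(V^{\otimes2})$ with $\mathrm{Tr}_{(2)}R_{12}\Psi_{23}=\mathrm{Tr}_{(2)}\Psi_{12}R_{23}=P_{13}$, where $P$ is the flip and $\mathrm{Tr}_{(2)}$ is the partial trace over the second factor. Put $C_1=\mathrm{Tr}_{(2)}\Psi_{12}$. The $R$-trace of an $N\times N$ matrix $X$ is $\mathrm{Tr}_R X=\mathrm{Tr}(CX)$, and $\mathrm{Tr}_{R(12)}Z=\mathrm{Tr}_{(1)}\mathrm{Tr}_{(2)}(C_1C_2Z)$ with $C_2=I\otimes C$. For an $N\times N$ matrix $A$ with entries in an algebra write $A_1=A\otimes I$ and $A_{\overline2}=R_{12}A_1R_{12}^{-1}$.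 Let $M=\|m_i^j\|$, $D=\|\partial_i^{\,j}\|$, $\mathfrak{D}=\|d_i^{\,j}\|$ be $N\times N$ matrices of generators, and let $h\in\mathbb{C}$ be a parameter. (1) $\mathcal{M}(R)$ is the unital algebra generated by the $m_i^j$ with relations $R_{12}M_1R_{12}M_1-M_1R_{12}M_1R_{12}=h(R_{12}M_1-M_1R_{12})$. (2) $\mathcal{D}(R)$ is the unital algebra generated by the $\partial_i^{\,j}$ with relations $R_{12}^{-1}D_1R_{12}^{-1}D_1-D_1R_{12}^{-1}D_1R_{12}^{-1}=0$. (3) The $\partial_i^{\,j}$ (quantum partial derivatives) act on $\mathcal{M}(R)$ as follows. In the product $\partial_i^{\,j}a$, $a\in\mathcal{M}(R)$, move the derivatives to the right of the $m$'s by means of the permutation relations $D_1R_{12}M_1R_{12}-R_{12}M_1R_{12}^{-1}D_1=R_{12}+hD_1R_{12}$, and then apply the counit $\varepsilon(1)=1$, $\varepsilon(\partial_i^{\,j})=0$ to the right factors in $\mathcal{D}(R)$. This makes $\mathcal{M}(R)$ a $\mathcal{D}(R)$-module. (4) $\mathsf{Dif}$ is the unital algebra generated by the $d_i^{\,j}$ with relations $R_{12}\mathfrak{D}_1R_{12}\mathfrak{D}_1=-\mathfrak{D}_1R_{12}\mathfrak{D}_1R_{12}^{-1}$. The operator $\mathbf{d}$ acts on $\mathsf{Dif}\otimes\mathcal{M}(R)$ by placing the sum between the two factors and applying the derivatives to the right factor: $\mathbf{d}(\omega\otimes a)=\sum_{i,j,k}C_i^j\,\omega\,d_j^{\,k}\otimes\partial_k^{\,i}(a)$.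 Consequently, its square is by definition $\mathbf{d}^2=\mathrm{Tr}_{R(12)}\bigl(\mathfrak{D}_1\,\mathfrak{D}_{\overline2}\,D_{\overline2}\,D_1\bigr)$, with the derivatives applied to the right factor. *)

theory Defs
  imports "HOL-Analysis.Analysis" "HOL-Algebra.QuotRing" "HOL-Algebra.Module"
    "HOL-Library.Poly_Mapping"
begin

section \<open>Free algebras, presented algebras and tensor products\<close>

text \<open>
  With concatenation as addition on words, the convolution product of
  \<^typ>\<open>'x list \<Rightarrow>\<^sub>0 complex\<close> makes this type the free unital associative
  complex algebra on the set of generators \<^typ>\<open>'x\<close>.
\<close>

instantiation list :: (type) monoid_add
begin

definition zero_list :: "'a list" where "zero_list = []"

definition plus_list :: "'a list \<Rightarrow> 'a list \<Rightarrow> 'a list" where "plus_list xs ys = xs @ ys"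

instance by standard (simp_all add: zero_list_def plus_list_def)

end

type_synonym 'x free_alg = "'x list \<Rightarrow>\<^sub>0 complex"

definition gen :: "'x \<Rightarrow> 'x free_alg" where
  "gen x = Poly_Mapping.single [x] 1"

definition scalar :: "complex \<Rightarrow> 'x free_alg" where
  "scalar c = Poly_Mapping.single [] c"

definition free_ring :: "'x free_alg ring" where
  "free_ring = \<lparr>carrier = UNIV, monoid.mult = (*), one = 1, zero = 0, add = (+)\<rparr>"

definition rel_ideal :: "'x free_alg set \<Rightarrow> 'x free_alg set" where
  "rel_ideal S = Idl\<^bsub>free_ring\<^esub> S"

definition cls :: "'x free_alg set \<Rightarrow> 'x free_alg \<Rightarrow> 'x free_alg set" where
  "cls S p = rel_ideal S +>\<^bsub>free_ring\<^esub> p"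

text \<open>The algebra with generators \<^typ>\<open>'x\<close> and relations \<open>s = 0\<close> for \<open>s \<in> S\<close>.\<close>

definition presented_algebra :: "'x free_alg set \<Rightarrow> (complex, 'x free_alg set) module" where
  "presented_algebra S = (let Q = free_ring Quot rel_ideal S in
     \<lparr>carrier = carrier Q, monoid.mult = monoid.mult Q, one = one Q, zero = zero Q, add = add Q,
      smult = (\<lambda>c X. cls S (scalar c) \<otimes>\<^bsub>Q\<^esub> X)\<rparr>)"

text \<open>
  The tensor product over \<open>\<complex>\<close> of \<open>A\<close> and \<open>B\<close>: formal complex linear combinations of
  pairs from \<open>carrier A \<times> carrier B\<close>, modulo the linear span of the bilinearity relations.
\<close>

definition bilinear_relators ::
  "(complex, 'a, 'r) module_scheme \<Rightarrow> (complex, 'b, 's) module_scheme \<Rightarrow> ('a \<times> 'b \<Rightarrow>\<^sub>0 complex) set" where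
  "bilinear_relators A B =
     {Poly_Mapping.single (x \<oplus>\<^bsub>A\<^esub> x', y) 1 - Poly_Mapping.single (x, y) 1 - Poly_Mapping.single (x', y) 1
        | x x' y. x \<in> carrier A \<and> x' \<in> carrier A \<and> y \<in> carrier B}
   \<union> {Poly_Mapping.single (x, y \<oplus>\<^bsub>B\<^esub> y') 1 - Poly_Mapping.single (x, y) 1 - Poly_Mapping.single (x, y') 1
        | x y y'. x \<in> carrier A \<and> y \<in> carrier B \<and> y' \<in> carrier B}
   \<union> {Poly_Mapping.single (c \<odot>\<^bsub>A\<^esub> x, y) 1 - Poly_Mapping.single (x, y) c
        | c x y. x \<in> carrier A \<and> y \<in> carrier B}
   \<union> {Poly_Mapping.single (x, c \<odot>\<^bsub>B\<^esub> y) 1 - Poly_Mapping.single (x, y) c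
        | c x y. x \<in> carrier A \<and> y \<in> carrier B}"

definition tensor_null ::
  "(complex, 'a, 'r) module_scheme \<Rightarrow> (complex, 'b, 's) module_scheme \<Rightarrow> ('a \<times> 'b \<Rightarrow>\<^sub>0 complex) set" where
  "tensor_null A B =
     Modules.module.span (\<lambda>c. Poly_Mapping.map ((*) c)) (bilinear_relators A B)"

definition tensor_class ::
  "(complex, 'a, 'r) module_scheme \<Rightarrow> (complex, 'b, 's) module_scheme \<Rightarrow>
   ('a \<times> 'b \<Rightarrow>\<^sub>0 complex) \<Rightarrow> ('a \<times> 'b \<Rightarrow>\<^sub>0 complex) set" where
  "tensor_class A B x = {y. y - x \<in> tensor_null A B}"

definition tensor_product ::
  "(complex, 'a, 'r) module_scheme \<Rightarrow> (complex, 'b, 's) module_scheme \<Rightarrow>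
   ('a \<times> 'b \<Rightarrow>\<^sub>0 complex) set set" where
  "tensor_product A B =
     tensor_class A B ` {x. Poly_Mapping.keys x \<subseteq> carrier A \<times> carrier B}"


section \<open>Skew-invertible Hecke symmetries\<close>

text \<open>
  \<open>V = \<complex>\<^sup>N\<close> with \<open>N = CARD('n)\<close>. In a matrix \<open>A\<^sub>i\<^sup>j\<close> the lower index \<open>i\<close> numbers the rows
  and the upper index \<open>j\<close> the columns.
\<close>

definition on1 :: "'a::zero^'n::finite^'n \<Rightarrow> 'a^('n \<times> 'n)^('n \<times> 'n)" where
  "on1 A = (\<chi> r c. case (r, c) of ((i, j), (i', j')) \<Rightarrow> if j = j' then A $ i $ i' else 0)"

definition leg12 :: "'a::zero^('n::finite \<times> 'n)^('n \<times> 'n) \<Rightarrow> 'a^('n \<times> 'n \<times> 'n)^('n \<times> 'n \<times> 'n)" where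
  "leg12 A = (\<chi> r c. case (r, c) of ((i, j, k), (i', j', k')) \<Rightarrow>
     if k = k' then A $ (i, j) $ (i', j') else 0)"

definition leg23 :: "'a::zero^('n::finite \<times> 'n)^('n \<times> 'n) \<Rightarrow> 'a^('n \<times> 'n \<times> 'n)^('n \<times> 'n \<times> 'n)" where
  "leg23 A = (\<chi> r c. case (r, c) of ((i, j, k), (i', j', k')) \<Rightarrow>
     if i = i' then A $ (j, k) $ (j', k') else 0)"

definition flip_matrix :: "complex^('n::finite \<times> 'n)^('n \<times> 'n)" where
  "flip_matrix = (\<chi> r c. if r = prod.swap c then 1 else 0)"

text \<open>Partial traces over the second factor of \<open>V \<otimes> V \<otimes> V\<close> and of \<open>V \<otimes> V\<close>.\<close>

definition ptrace2_3 ::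
  "complex^('n \<times> 'n \<times> 'n)^('n \<times> 'n \<times> 'n) \<Rightarrow> complex^('n::finite \<times> 'n)^('n \<times> 'n)" where
  "ptrace2_3 X = (\<chi> r c. case (r, c) of ((i, k), (i', k')) \<Rightarrow> \<Sum>j\<in>UNIV. X $ (i, j, k) $ (i', j, k'))"

definition ptrace2_2 :: "complex^('n \<times> 'n)^('n \<times> 'n) \<Rightarrow> complex^('n::finite)^'n" where
  "ptrace2_2 X = (\<chi> i i'. \<Sum>j\<in>UNIV. X $ (i, j) $ (i', j))"

definition hecke_symmetry :: "complex \<Rightarrow> complex^('n::finite \<times> 'n)^('n \<times> 'n) \<Rightarrow> bool" where
  "hecke_symmetry q R \<longleftrightarrow>
     q \<noteq> 0 \<and> q + inverse q \<noteq> 0 \<and> invertible R \<and>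
     leg12 R ** leg23 R ** leg12 R = leg23 R ** leg12 R ** leg23 R \<and>
     (R - mat q) ** (R + mat (inverse q)) = 0"

definition is_skew_inverse ::
  "complex^('n::finite \<times> 'n)^('n \<times> 'n) \<Rightarrow> complex^('n \<times> 'n)^('n \<times> 'n) \<Rightarrow> bool" where
  "is_skew_inverse R \<Psi> \<longleftrightarrow>
     ptrace2_3 (leg12 R ** leg23 \<Psi>) = flip_matrix \<and> ptrace2_3 (leg12 \<Psi> ** leg23 R) = flip_matrix"

definition skew_invertible :: "complex^('n::finite \<times> 'n)^('n \<times> 'n) \<Rightarrow> bool" where
  "skew_invertible R \<longleftrightarrow> (\<exists>\<Psi>. is_skew_inverse R \<Psi>)"

text \<open>The operator \<open>\<Psi>\<close> is unique when it exists, being a two-sided inverse of \<open>R\<close> up to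
  reshuffling of the four indices.\<close>

definition skew_inverse ::
  "complex^('n::finite \<times> 'n)^('n \<times> 'n) \<Rightarrow> complex^('n \<times> 'n)^('n \<times> 'n)" where
  "skew_inverse R = (THE \<Psi>. is_skew_inverse R \<Psi>)"

definition C_matrix :: "complex^('n::finite \<times> 'n)^('n \<times> 'n) \<Rightarrow> complex^'n^'n" where
  "C_matrix R = ptrace2_2 (skew_inverse R)"


section \<open>The algebras \<open>\<M>(R)\<close>, \<open>\<D>(R)\<close> and \<open>Dif\<close>\<close>

text \<open>
  A matrix equation \<open>X = Y\<close> over a free algebra is imposed by taking the entries of \<open>X - Y\<close>
  as relators; complex matrices enter such equations through \<open>scalar\<close>.
\<close>

definition entries :: "'a^'n^'m \<Rightarrow> 'a set" where
  "entries X = {X $ i $ j | i j. True}"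

definition emb :: "complex^'n^'m \<Rightarrow> 'x free_alg^'n^'m" where
  "emb A = map_matrix scalar A"

definition m_relators ::
  "complex^('n::finite \<times> 'n)^('n \<times> 'n) \<Rightarrow> complex \<Rightarrow> 'x free_alg^'n^'n \<Rightarrow> 'x free_alg set" where
  "m_relators R h M = entries
     ((emb R ** on1 M ** emb R ** on1 M - on1 M ** emb R ** on1 M ** emb R)
      - mat (scalar h) ** (emb R ** on1 M - on1 M ** emb R))"

definition d_relators ::
  "complex^('n::finite \<times> 'n)^('n \<times> 'n) \<Rightarrow> 'x free_alg^'n^'n \<Rightarrow> 'x free_alg set" where
  "d_relators R D = (let R' = matrix_inv R in entries
     (emb R' ** on1 D ** emb R' ** on1 D - on1 D ** emb R' ** on1 D ** emb R'))"

definition perm_relators ::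
  "complex^('n::finite \<times> 'n)^('n \<times> 'n) \<Rightarrow> complex \<Rightarrow>
   'x free_alg^'n^'n \<Rightarrow> 'x free_alg^'n^'n \<Rightarrow> 'x free_alg set" where
  "perm_relators R h M D = entries
     ((on1 D ** emb R ** on1 M ** emb R - emb R ** on1 M ** emb (matrix_inv R) ** on1 D)
      - (emb R + mat (scalar h) ** on1 D ** emb R))"

definition dif_relators ::
  "complex^('n::finite \<times> 'n)^('n \<times> 'n) \<Rightarrow> 'x free_alg^'n^'n \<Rightarrow> 'x free_alg set" where
  "dif_relators R \<DD> = entries
     (emb R ** on1 \<DD> ** emb R ** on1 \<DD>
      - (- (on1 \<DD> ** emb R ** on1 \<DD> ** emb (matrix_inv R))))"

definition M_rels ::
  "complex^('n::finite \<times> 'n)^('n \<times> 'n) \<Rightarrow> complex \<Rightarrow> ('n \<times> 'n) free_alg set" where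
  "M_rels R h = m_relators R h (\<chi> i j. gen (i, j))"

definition Dif_rels :: "complex^('n::finite \<times> 'n)^('n \<times> 'n) \<Rightarrow> ('n \<times> 'n) free_alg set" where
  "Dif_rels R = dif_relators R (\<chi> i j. gen (i, j))"

definition M_alg ::
  "complex^('n::finite \<times> 'n)^('n \<times> 'n) \<Rightarrow> complex \<Rightarrow> (complex, ('n \<times> 'n) free_alg set) module" where
  "M_alg R h = presented_algebra (M_rels R h)"

definition Dif_alg ::
  "complex^('n::finite \<times> 'n)^('n \<times> 'n) \<Rightarrow> (complex, ('n \<times> 'n) free_alg set) module" where
  "Dif_alg R = presented_algebra (Dif_rels R)"


section \<open>Quantum partial derivatives\<close>

text \<open>
  Products of elements of \<open>\<M>(R)\<close> and \<open>\<D>(R)\<close> are taken in the algebra generated by the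
  \<open>m\<^sub>i\<^sup>j\<close> (tagged \<open>Inl\<close>) and the \<open>\<partial>\<^sub>i\<^sup>j\<close> (tagged \<open>Inr\<close>), subject to the relations of \<open>\<M>(R)\<close>
  and of \<open>\<D>(R)\<close> and to the permutation relations.
\<close>

type_synonym 'n mixed_gen = "('n \<times> 'n) + ('n \<times> 'n)"

definition mixed_rels ::
  "complex^('n::finite \<times> 'n)^('n \<times> 'n) \<Rightarrow> complex \<Rightarrow> 'n mixed_gen free_alg set" where
  "mixed_rels R h =
     (let M = (\<chi> i j. gen (Inl (i, j))); D = (\<chi> i j. gen (Inr (i, j)))
      in m_relators R h M \<union> d_relators R D \<union> perm_relators R h M D)"

definition incl_M :: "('n \<times> 'n) free_alg \<Rightarrow> 'n mixed_gen free_alg" where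
  "incl_M a = (\<Sum>w\<in>Poly_Mapping.keys a.
     Poly_Mapping.single (map Inl w) (Poly_Mapping.lookup a w))"

text \<open>All derivatives stand to the right of all \<open>m\<close>'s.\<close>

definition normal_ordered :: "'n mixed_gen free_alg \<Rightarrow> bool" where
  "normal_ordered p \<longleftrightarrow> Poly_Mapping.keys p \<subseteq> {map Inl u @ map Inr v | u v. True}"

text \<open>
  On \<open>\<Sum> c\<^bsub>u,v\<^esub> u v\<close>, with \<open>u\<close> a word in the \<open>m\<close>'s and \<open>v\<close> a word in the \<open>\<partial>\<close>'s, the counit
  applied to the right factors gives \<open>\<Sum> c\<^bsub>u,v\<^esub> \<epsilon>(v) u\<close>; as \<open>\<epsilon>(\<partial>\<^sub>i\<^sup>j) = 0\<close>, only the words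
  with empty \<open>v\<close> survive.
\<close>

definition counit_right :: "'n mixed_gen free_alg \<Rightarrow> ('n \<times> 'n) free_alg" where
  "counit_right p = Poly_Mapping.map_key (map Inl) p"

definition qderiv ::
  "complex^('n::finite \<times> 'n)^('n \<times> 'n) \<Rightarrow> complex \<Rightarrow> 'n \<Rightarrow> 'n \<Rightarrow>
   ('n \<times> 'n) free_alg set \<Rightarrow> ('n \<times> 'n) free_alg set" where
  "qderiv R h i j A = (THE B. \<exists>a\<in>A. \<exists>p. normal_ordered p \<and>
      gen (Inr (i, j)) * incl_M a - p \<in> rel_ideal (mixed_rels R h) \<and>
      B = cls (M_rels R h) (counit_right p))"


section \<open>The de Rham operator on \<open>Dif \<otimes> \<M>(R)\<close>\<close>

text \<open>On formal combinations of pairs \<open>(\<omega>, a)\<close>, as a linear map.\<close>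

definition deRham_formal ::
  "complex^('n::finite \<times> 'n)^('n \<times> 'n) \<Rightarrow> complex \<Rightarrow>
   (('n \<times> 'n) free_alg set \<times> ('n \<times> 'n) free_alg set \<Rightarrow>\<^sub>0 complex) \<Rightarrow>
   (('n \<times> 'n) free_alg set \<times> ('n \<times> 'n) free_alg set \<Rightarrow>\<^sub>0 complex)" where
  "deRham_formal R h x = (\<Sum>(\<omega>, a)\<in>Poly_Mapping.keys x. \<Sum>i\<in>UNIV. \<Sum>j\<in>UNIV. \<Sum>k\<in>UNIV.
     Poly_Mapping.single (\<omega> \<otimes>\<^bsub>Dif_alg R\<^esub> cls (Dif_rels R) (gen (j, k)), qderiv R h k i a)
       (Poly_Mapping.lookup x (\<omega>, a) * C_matrix R $ i $ j))"

text \<open>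
  The induced operator on classes. As \<open>deRham_formal\<close> preserves \<open>tensor_null\<close>, all members of
  the union agree.
\<close>

definition deRham ::
  "complex^('n::finite \<times> 'n)^('n \<times> 'n) \<Rightarrow> complex \<Rightarrow>
   (('n \<times> 'n) free_alg set \<times> ('n \<times> 'n) free_alg set \<Rightarrow>\<^sub>0 complex) set \<Rightarrow>
   (('n \<times> 'n) free_alg set \<times> ('n \<times> 'n) free_alg set \<Rightarrow>\<^sub>0 complex) set" where
  "deRham R h X = (\<Union>x\<in>X. tensor_class (Dif_alg R) (M_alg R h) (deRham_formal R h x))"

end

theory Submission
  imports Defs
begin

text \<open>
  On the free algebra in the \<open>m\<^sub>i\<^sup>j\<close> the permutation relations, solved with the skew inverse of
  \<open>R\<close>, define the derivatives by recursion on words. Moving the \<open>\<D>(R)\<close>-relators, respectively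
  a derivative, past the \<open>m\<^sub>i\<^sup>j\<close> with the help of the braid and Hecke relations shows that the former
  act by zero and that derivatives preserve the ideal of \<open>\<M>(R)\<close>. So the mixed algebra acts
  modulo that ideal, and the action evaluates normally ordered elements at \<open>1\<close> through the counit;
  this identifies the quantum partial derivatives.

  By \<open>Tr\<^sub>(\<^sub>2\<^sub>)(C\<^sub>2 R X\<^sub>1 R\<^sup>-\<^sup>1) = Tr(CX)\<close>, the square of the de Rham operator is
  \<open>Tr(C\<^sub>1 C\<^sub>2 W V)\<close> with \<open>W\<close> the product of the differentials and \<open>V\<close> that of the derivatives.
  The relations give \<open>W = - R W R\<close> and \<open>R V = V R\<close>, and \<open>R\<close> commutes with \<open>C\<^sub>1 C\<^sub>2\<close>, so
  \<open>t(Y) = Tr(C\<^sub>1 C\<^sub>2 W Y V)\<close> satisfies \<open>t(R Y R) = - t(Y)\<close>. With \<open>R\<^sup>2 = 1 + (q - q\<^sup>-\<^sup>1) R\<close> this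
  is a linear system for \<open>t(1)\<close> and \<open>t(R)\<close> of determinant \<open>(q + q\<^sup>-\<^sup>1)\<^sup>2 \<noteq> 0\<close>.
\<close>

section \<open>Linear extension and scalars\<close>

text \<open>A quantum partial derivative is specified only through some normally ordered
  representative, so it is not clear that its value is well defined. No basis theorem is used for
  this; a model is built instead. It lives on the free algebra because a recursion on words on
  \<open>\<M>(R)\<close> would presuppose compatibility with the relations. In it the derivative and
  permutation relators act by zero exactly, but the relators of \<open>\<M>(R)\<close> act by
  multiplication with themselves, so values are compared modulo their ideal.

  Inverting \<open>R\<close> as an operator does not solve the permutation relations: the unknown
  values are contracted with the two indices of the first leg of \<open>R\<close>. The operator
  \<Psi> inverts exactly such contractions; one half of its definition gives existence of the
  solution, the other its uniqueness.

  Vanishing in the tensor product is tested by linear functionals. The square thus becomes a complex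
  number, a trace pairing of one matrix of differentials with one matrix of operators. Complex
  matrices move cyclically through this pairing although the entries of the two matrices lie in
  different noncommutative rings.\<close>

lemma poly_mapping_additive_induct:
  fixes p :: "'k \<Rightarrow>\<^sub>0 'c::comm_monoid_add"
  assumes "\<And>k c. P (Poly_Mapping.single k c)" and "\<And>p q. P p \<Longrightarrow> P q \<Longrightarrow> P (p + q)"
  shows "P p"
proof -
  have P0: "P 0" using assms(1)[of undefined 0] by simp
  have "P (\<Sum>k\<in>A. Poly_Mapping.single k (Poly_Mapping.lookup p k))" if "finite A" for A
    using that by induct (auto intro: assms P0)
  moreover have "p = (\<Sum>k\<in>Poly_Mapping.keys p. Poly_Mapping.single k (Poly_Mapping.lookup p k))"
  proof (rule poly_mapping_eqI)
    fix k
    show "Poly_Mapping.lookup p k =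
      Poly_Mapping.lookup (\<Sum>k\<in>Poly_Mapping.keys p. Poly_Mapping.single k (Poly_Mapping.lookup p k)) k"
      by (simp add: lookup_sum lookup_single when_def in_keys_iff)
  qed
  ultimately show ?thesis by (metis finite_keys)
qed

text \<open>The coefficient is handed to \<open>g\<close>, so the target needs no scalar action;
  additivity of each \<open>g k\<close> then makes the extension additive.\<close>

definition extend :: "('k \<Rightarrow> complex \<Rightarrow> 'b::comm_monoid_add) \<Rightarrow> ('k \<Rightarrow>\<^sub>0 complex) \<Rightarrow> 'b" where
  "extend g p = (\<Sum>k\<in>Poly_Mapping.keys p. g k (Poly_Mapping.lookup p k))"

lemma extend_superset:
  assumes "finite A" "Poly_Mapping.keys p \<subseteq> A" "\<And>k. g k 0 = 0"
  shows "extend g p = (\<Sum>k\<in>A. g k (Poly_Mapping.lookup p k))"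
  unfolding extend_def
  by (rule sum.mono_neutral_left) (use assms in \<open>auto simp: in_keys_iff\<close>)

lemma extend_single: "g k 0 = 0 \<Longrightarrow> extend g (Poly_Mapping.single k c) = g k c"
  by (simp add: extend_def)

lemma extend_add:
  assumes "\<And>k. g k 0 = 0" "\<And>k c d. g k (c + d) = g k c + g k d"
  shows "extend g (p + q) = extend g p + extend g q"
proof -
  let ?A = "Poly_Mapping.keys p \<union> Poly_Mapping.keys q"
  have "extend g (p + q) = (\<Sum>k\<in>?A. g k (Poly_Mapping.lookup (p + q) k))"
    by (rule extend_superset) (use assms(1) keys_add[of p q] in auto)
  moreover have "extend g p = (\<Sum>k\<in>?A. g k (Poly_Mapping.lookup p k))"
    by (rule extend_superset) (use assms(1) in auto)
  moreover have "extend g q = (\<Sum>k\<in>?A. g k (Poly_Mapping.lookup q k))"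
    by (rule extend_superset) (use assms(1) in auto)
  ultimately show ?thesis by (simp add: lookup_add assms(2) sum.distrib)
qed

locale ring_morphism =
  fixes f :: "'a::ring_1 \<Rightarrow> 'b::ring_1"
  assumes add: "f (x + y) = f x + f y" and mult: "f (x * y) = f x * f y" and one: "f 1 = 1"
begin

lemma zero: "f 0 = 0"
  using add[of 0 0] by simp

lemma uminus: "f (- x) = - f x"
  using add[of x "- x"] by (simp add: zero add_eq_0_iff)

lemma diff: "f (x - y) = f x - f y"
  using add[of x "- y"] by (simp add: uminus)

lemma sum: "f (sum g A) = (\<Sum>x\<in>A. f (g x))"
  by (induct A rule: infinite_finite_induct) (simp_all add: zero add)

end

lemma ring_morphism_scalar: "ring_morphism (scalar :: complex \<Rightarrow> 'x free_alg)"
  by unfold_locales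
    (simp_all add: scalar_def single_add mult_single plus_list_def zero_list_def
      flip: single_one)

lemma scalar_single: "scalar c * Poly_Mapping.single w d = Poly_Mapping.single w (c * d)"
  by (simp add: scalar_def mult_single plus_list_def)

lemma scalar_commute: "scalar c * p = p * scalar c" for p :: "'x free_alg"
  by (induct p rule: poly_mapping_additive_induct)
    (simp_all add: scalar_def mult_single plus_list_def distrib_left distrib_right mult.commute)

lemma gen_single: "gen x * Poly_Mapping.single w c = Poly_Mapping.single (x # w) c"
  by (simp add: gen_def mult_single plus_list_def)

definition word_eval :: "(complex \<Rightarrow> 'a::ring_1) \<Rightarrow> ('x \<Rightarrow> 'a) \<Rightarrow> 'x free_alg \<Rightarrow> 'a" where
  "word_eval s g = extend (\<lambda>w c. s c * prod_list (map g w))"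

lemma word_eval_single:
  assumes "ring_morphism s"
  shows "word_eval s g (Poly_Mapping.single w c) = s c * prod_list (map g w)"
  by (simp add: word_eval_def extend_single ring_morphism.zero[OF assms])

lemma word_eval_scalar: "ring_morphism s \<Longrightarrow> word_eval s g (scalar c) = s c"
  by (simp add: scalar_def word_eval_single)

lemma word_eval_gen: "ring_morphism s \<Longrightarrow> word_eval s g (gen x) = g x"
  by (simp add: gen_def word_eval_single ring_morphism.one)

lemma word_eval_add:
  assumes "ring_morphism s"
  shows "word_eval s g (p + q) = word_eval s g p + word_eval s g q"
  unfolding word_eval_def
  by (rule extend_add)
    (simp_all add: ring_morphism.zero[OF assms] ring_morphism.add[OF assms] distrib_right)

text \<open>Universal property of the free algebra. The hypothesis \<open>comm\<close> lets the
  coefficients of the second factor pass the word of the first.\<close>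

lemma ring_morphism_word_eval:
  assumes s: "ring_morphism s" and comm: "\<And>c x. s c * g x = g x * s c"
  shows "ring_morphism (word_eval s g)"
proof
  interpret ring_morphism s by (rule s)
  have c: "s c * prod_list (map g w) = prod_list (map g w) * s c" for c w
    by (induct w) (simp, metis (no_types) comm list.simps(9) mult.assoc prod_list.Cons)
  show "word_eval s g 1 = 1"
    by (simp add: word_eval_single s one zero_list_def flip: single_one)
  show "word_eval s g (p + q) = word_eval s g p + word_eval s g q" for p q
    by (rule word_eval_add[OF s])
  show "word_eval s g (p * q) = word_eval s g p * word_eval s g q" for p q
  proof (induct p rule: poly_mapping_additive_induct)
    case (1 v a)
    show ?case
    proof (induct q rule: poly_mapping_additive_induct)
      case (1 w b)
      have "prod_list (map g v) * s b = s b * prod_list (map g v)" by (simp add: c)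
      then show ?case
        by (simp add: word_eval_single s mult_single plus_list_def mult)
          (metis mult.assoc)
    qed (simp add: distrib_left word_eval_add s)
  qed (simp add: distrib_right word_eval_add s)
qed


section \<open>Additive endomorphisms and matrices over rings\<close>

text \<open>The sort \<open>zero_neq_one\<close> makes the group nontrivial, so that the zero map
  differs from the identity, as \<open>ring_1\<close> demands. The same type serves for operators on
  a free algebra and, through \<open>matrix_endo\<close>, for square matrices.\<close>

typedef (overloaded) 'b endo = "{f :: 'b::{ab_group_add,zero_neq_one} \<Rightarrow> 'b. \<forall>x y. f (x + y) = f x + f y}"
  morphisms app Endo
  by (rule exI[of _ id]) simp

setup_lifting type_definition_endo

lemma app_add: "app f (x + y) = app f x + app f y"
  using app[of f] by simp

lemma app_0 [simp]: "app f 0 = 0"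
  using app_add[of f 0 0] by simp

lemma app_uminus: "app f (- x) = - app f x"
  using app_add[of f x "- x"] by (simp add: add_eq_0_iff)

lemma app_diff: "app f (x - y) = app f x - app f y"
  using app_add[of f x "- y"] by (simp add: app_uminus)

instantiation endo :: ("{ab_group_add,zero_neq_one}") ring_1
begin
lift_definition zero_endo :: "'a endo" is "\<lambda>_. 0" by simp
lift_definition one_endo :: "'a endo" is "\<lambda>x. x" by simp
lift_definition plus_endo :: "'a endo \<Rightarrow> 'a endo \<Rightarrow> 'a endo" is "\<lambda>f g x. f x + g x" by simp
lift_definition minus_endo :: "'a endo \<Rightarrow> 'a endo \<Rightarrow> 'a endo" is "\<lambda>f g x. f x - g x" by simp
lift_definition uminus_endo :: "'a endo \<Rightarrow> 'a endo" is "\<lambda>f x. - f x" by simp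
lift_definition times_endo :: "'a endo \<Rightarrow> 'a endo \<Rightarrow> 'a endo" is "\<lambda>f g x. f (g x)" by simp
instance
proof
  show "(0 :: 'a endo) \<noteq> 1"
    by transfer (metis zero_neq_one)
qed (transfer; simp add: algebra_simps)+
end

lemma app_Endo: "(\<And>x y. f (x + y) = f x + f y) \<Longrightarrow> app (Endo f) = f"
  by (rule Endo_inverse) simp

lemma app_zero_endo [simp]: "app 0 x = 0" by transfer simp
lemma app_one_endo [simp]: "app 1 x = x" by transfer simp
lemma app_plus: "app (f + g) x = app f x + app g x" by transfer simp
lemma app_minus: "app (f - g) x = app f x - app g x" by transfer simp
lemma app_neg: "app (- f) x = - app f x" by transfer simp
lemma app_times: "app (f * g) x = app f (app g x)" by transfer simp

lemma app_sum_endo: "app (sum f A) x = (\<Sum>a\<in>A. app (f a) x)"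
  by (induct A rule: infinite_finite_induct) (simp_all add: app_plus)

lemma endo_eqI: "(\<And>x. app f x = app g x) \<Longrightarrow> f = g"
  by transfer auto

text \<open>Square matrices carry no ring structure with product \<open>**\<close> in the library; their left
  action on vectors embeds them into the ring of endomorphisms.\<close>

definition matrix_endo :: "'a::ring_1^'m^'m \<Rightarrow> ('a^'m) endo" where
  "matrix_endo X = Endo (\<lambda>v. X *v v)"

lemma app_matrix_endo: "app (matrix_endo X) v = X *v v"
  unfolding matrix_endo_def
  by (subst app_Endo)
    (simp_all add: matrix_vector_mult_def vec_eq_iff distrib_left sum.distrib)

lemma matrix_endo_mult: "matrix_endo (A ** B) = matrix_endo A * matrix_endo B"
  by (rule endo_eqI) (simp add: app_matrix_endo app_times matrix_vector_mul_assoc)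

lemma matrix_endo_add: "matrix_endo (A + B) = matrix_endo A + matrix_endo B"
  by (rule endo_eqI)
    (simp add: app_matrix_endo app_plus matrix_vector_mult_def vec_eq_iff distrib_right sum.distrib)

lemma matrix_endo_diff: "matrix_endo (A - B) = matrix_endo A - matrix_endo B"
  by (rule endo_eqI)
    (simp add: app_matrix_endo app_minus matrix_vector_mult_def vec_eq_iff left_diff_distrib sum_subtractf)

lemma matrix_endo_uminus: "matrix_endo (- A) = - matrix_endo A"
  by (rule endo_eqI)
    (simp add: app_matrix_endo app_neg matrix_vector_mult_def vec_eq_iff sum_negf)

lemma matrix_endo_1: "matrix_endo (mat 1) = 1"
  by (rule endo_eqI) (simp add: app_matrix_endo)

lemma matrix_endo_0: "matrix_endo 0 = 0"
  by (rule endo_eqI) (simp add: app_matrix_endo matrix_vector_mult_def vec_eq_iff)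

text \<open>The unit vector \<open>axis j 1\<close> recovers column \<open>j\<close>. Hence matrix
  identities may be proved in the endomorphism ring, where ring simplification is at hand, and
  pulled back.\<close>

lemma matrix_endo_inject: "matrix_endo A = matrix_endo B \<longleftrightarrow> A = B"
proof
  assume eq: "matrix_endo A = matrix_endo B"
  show "A = B"
  proof (simp add: vec_eq_iff, intro allI)
    fix i j
    have "A *v axis j 1 = B *v axis j 1" using eq by (metis app_matrix_endo)
    then have "(A *v axis j 1) $ i = (B *v axis j 1) $ i" by simp
    then show "A $ i $ j = B $ i $ j"
      by (simp add: matrix_vector_mult_def axis_def if_distrib[of "(*) _"] cong: if_cong)
  qed
qed simp

lemmas matrix_endo_simps =
  matrix_endo_mult matrix_endo_add matrix_endo_diff matrix_endo_uminus matrix_endo_1 matrix_endo_0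

section \<open>Entrywise calculus for matrices and tensor legs\<close>

lemma sum_UNIV_prod: "(\<Sum>p\<in>UNIV. f p) = (\<Sum>i\<in>UNIV. \<Sum>j\<in>UNIV. f (i, j))"
  for f :: "'a::finite \<times> 'b::finite \<Rightarrow> 'c::comm_monoid_add"
  by (simp add: sum.cartesian_product UNIV_Times_UNIV[symmetric] del: UNIV_Times_UNIV)

lemma sum_if_UNIV:
  "(\<Sum>i\<in>UNIV. if i = a then f i else 0) = f a" "(\<Sum>i\<in>UNIV. if a = i then f i else 0) = f a"
  for f :: "'a::finite \<Rightarrow> 'c::comm_monoid_add"
  by simp_all

lemma matrix_mult_nth: "(A ** B) $ i $ j = (\<Sum>k\<in>UNIV. A $ i $ k * B $ k $ j)"
  by (simp add: matrix_matrix_mult_def)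

lemma on1_nth: "on1 A $ (i, j) $ (i', j') = (if j = j' then A $ i $ i' else 0)"
  by (simp add: on1_def)

lemma leg12_nth: "leg12 A $ (i, j, k) $ (i', j', k') = (if k = k' then A $ (i, j) $ (i', j') else 0)"
  by (simp add: leg12_def)

lemma leg23_nth: "leg23 A $ (i, j, k) $ (i', j', k') = (if i = i' then A $ (j, k) $ (j', k') else 0)"
  by (simp add: leg23_def)

lemma mat_nth: "mat c $ i $ j = (if i = j then c else 0)"
  by (simp add: mat_def)

lemma if_mult_zero:
  "(if P then a else 0) * (b :: 'a::mult_zero) = (if P then a * b else 0)"
  "b * (if P then a else 0) = (if P then b * a else 0)"
  by simp_all

lemma sum_if_const:
  "(\<Sum>i\<in>A. if P then f i else 0) = (if P then sum f A else (0 :: 'a::comm_monoid_add))"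
  by simp

lemma leg12_mult: "leg12 (A ** B) = leg12 A ** leg12 B" for A B :: "'a::ring_1^('n::finite \<times> 'n)^('n \<times> 'n)"
  by (simp add: vec_eq_iff split_paired_all leg12_nth matrix_mult_nth sum_UNIV_prod if_mult_zero
      sum_if_const sum_if_UNIV)

lemma leg23_mult: "leg23 (A ** B) = leg23 A ** leg23 B" for A B :: "'a::ring_1^('n::finite \<times> 'n)^('n \<times> 'n)"
  by (simp add: vec_eq_iff split_paired_all leg23_nth matrix_mult_nth sum_UNIV_prod if_mult_zero
      sum_if_const sum_if_UNIV)

lemma leg12_linear:
  fixes A B :: "'a::ring_1^('n::finite \<times> 'n)^('n \<times> 'n)"
  shows "leg12 (A + B) = leg12 A + leg12 B" "leg12 (A - B) = leg12 A - leg12 B"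
    "leg12 (mat c :: 'a^('n::finite \<times> 'n)^('n \<times> 'n)) = mat c"
    "leg12 (0 :: 'a^('n::finite \<times> 'n)^('n \<times> 'n)) = 0"
  by (simp_all add: vec_eq_iff split_paired_all leg12_nth mat_nth)

lemma leg23_linear:
  fixes A B :: "'a::ring_1^('n::finite \<times> 'n)^('n \<times> 'n)"
  shows "leg23 (A + B) = leg23 A + leg23 B" "leg23 (A - B) = leg23 A - leg23 B"
    "leg23 (mat c :: 'a^('n::finite \<times> 'n)^('n \<times> 'n)) = mat c"
    "leg23 (0 :: 'a^('n::finite \<times> 'n)^('n \<times> 'n)) = 0"
  by (simp_all add: vec_eq_iff split_paired_all leg23_nth mat_nth)

context ring_morphism
begin

lemma map_matrix_mult: "map_matrix f (A ** B) = map_matrix f A ** map_matrix f B"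
  by (simp add: vec_eq_iff matrix_mult_nth sum mult)

lemma map_matrix_add: "map_matrix f (A + B) = map_matrix f A + map_matrix f B"
  by (simp add: vec_eq_iff add)

lemma map_matrix_diff: "map_matrix f (A - B) = map_matrix f A - map_matrix f B"
  by (simp add: vec_eq_iff diff)

lemma map_matrix_uminus: "map_matrix f (- A) = - map_matrix f A"
  by (simp add: vec_eq_iff uminus)

lemma map_matrix_mat: "map_matrix f (mat c) = mat (f c)"
  by (simp add: vec_eq_iff mat_nth zero)

lemma map_matrix_on1: "map_matrix f (on1 X) = on1 (map_matrix f X)"
  by (simp add: vec_eq_iff split_paired_all on1_nth zero)

lemma map_matrix_leg12: "map_matrix f (leg12 X) = leg12 (map_matrix f X)"
  by (simp add: vec_eq_iff split_paired_all leg12_nth zero)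

lemma map_matrix_leg23: "map_matrix f (leg23 X) = leg23 (map_matrix f X)"
  by (simp add: vec_eq_iff split_paired_all leg23_nth zero)

lemmas map_matrix_simps = map_matrix_mult map_matrix_add map_matrix_diff map_matrix_uminus
  map_matrix_mat map_matrix_on1 map_matrix_leg12 map_matrix_leg23

end

lemma map_matrix_comp: "map_matrix f (map_matrix g A) = map_matrix (f \<circ> g) A"
  by (simp add: vec_eq_iff)

lemma matrix_inv_both:
  "invertible A \<Longrightarrow> A ** matrix_inv A = mat 1" "invertible A \<Longrightarrow> matrix_inv A ** A = mat 1"
  unfolding invertible_def matrix_inv_def by (rule someI2_ex; blast)+

lemma leg23_leg12_on1_commute:
  fixes A :: "'a::ring_1^('n::finite \<times> 'n)^('n \<times> 'n)" and X :: "'a^'n^'n"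
  assumes "\<And>p r i j. A $ p $ r * X $ i $ j = X $ i $ j * A $ p $ r"
  shows "leg12 (on1 X) ** leg23 A = leg23 A ** leg12 (on1 X)"
  by (simp add: vec_eq_iff split_paired_all leg12_nth leg23_nth on1_nth matrix_mult_nth
      sum_UNIV_prod if_mult_zero sum_if_const sum_if_UNIV assms)

lemma hecke_inverse:
  fixes R :: "complex^('n::finite \<times> 'n)^('n \<times> 'n)"
  assumes "hecke_symmetry q R"
  shows "R ** matrix_inv R = mat 1" "matrix_inv R ** R = mat 1"
    "matrix_inv R = R - mat (q - inverse q)"
    "R ** R = mat 1 + mat (q - inverse q) ** R"
proof -
  have q: "q \<noteq> 0" "invertible R" and H: "(R - mat q) ** (R + mat (inverse q)) = 0"
    using assms by (auto simp: hecke_symmetry_def)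
  show i: "R ** matrix_inv R = mat 1" "matrix_inv R ** R = mat 1"
    using matrix_inv_both q by auto
  have m: "mat c ** X = X ** mat c" for c and X :: "complex^('n \<times> 'n)^('n \<times> 'n)"
    by (simp add: vec_eq_iff matrix_mult_nth mat_nth if_mult_zero sum_if_UNIV mult.commute)
  have mm: "mat c ** mat d = (mat (c * d) :: complex^('n \<times> 'n)^('n \<times> 'n))" for c d
    by (simp add: vec_eq_iff matrix_mult_nth mat_nth if_mult_zero sum_if_UNIV)
  have md: "mat (c - d) = (mat c - mat d :: complex^('n \<times> 'n)^('n \<times> 'n))" for c d
    by (simp add: vec_eq_iff mat_nth)
  \<comment> \<open>Here \<open>a\<close> and \<open>b\<close> stand for the scalar matrices
    \<open>q\<close> and its inverse, \<open>x\<close> for \<open>R\<close> and \<open>y\<close> for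
    its inverse: expanding the Hecke condition gives \<open>x * (x - (a - b)) = 1\<close>.\<close>
  have ring: "y = x - (a - b)" "x * x = 1 + (a - b) * x"
    if "(x - a) * (x + b) = 0" "a * b = 1" "a * x = x * a" "b * x = x * b" "y * x = 1" "x * y = 1"
    for x y a b :: "(complex^('n \<times> 'n)) endo"
  proof -
    have "x * (x - (a - b)) = 1" using that(1-4) by (simp add: algebra_simps)
    then have "y * (x * (x - (a - b))) = y" by simp
    then show "y = x - (a - b)" by (simp add: mult.assoc[symmetric] that(5))
    show "x * x = 1 + (a - b) * x"
      using \<open>x * (x - (a - b)) = 1\<close> that(3,4) by (simp add: algebra_simps)
  qed
  have E: "(matrix_endo R - matrix_endo (mat q)) * (matrix_endo R + matrix_endo (mat (inverse q))) = 0"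
    "matrix_endo (mat q) * matrix_endo (mat (inverse q)) = (1 :: (complex^('n \<times> 'n)) endo)"
    "matrix_endo (mat q) * matrix_endo R = matrix_endo R * matrix_endo (mat q)"
    "matrix_endo (mat (inverse q)) * matrix_endo R = matrix_endo R * matrix_endo (mat (inverse q))"
    "matrix_endo (matrix_inv R) * matrix_endo R = 1" "matrix_endo R * matrix_endo (matrix_inv R) = 1"
    using H i m[of _ R] mm[of q "inverse q"] q(1)
    by (simp_all flip: matrix_endo_simps)
  show "matrix_inv R = R - mat (q - inverse q)" "R ** R = mat 1 + mat (q - inverse q) ** R"
    using ring[OF E] by (simp_all add: matrix_endo_inject md flip: matrix_endo_simps)
qed

section \<open>Identities for the braided matrices\<close>

lemma mixed_ring_identities:
  fixes r1 s1 r2 s2 M D h lam :: "'a::ring_1"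
  assumes inv: "r1 * s1 = 1" "r2 * s2 = 1"
   and s1: "s1 = r1 - lam" and s2: "s2 = r2 - lam"
   and lam: "r1 * lam = lam * r1" "r2 * lam = lam * r2" "M * lam = lam * M" "D * lam = lam * D"
   and h: "r1 * h = h * r1" "r2 * h = h * r2" "M * h = h * M" "D * h = h * D" "h * lam = lam * h"
   and br: "r1 * r2 * r1 = r2 * r1 * r2"
   and rM: "M * r2 = r2 * M" and rD: "D * r2 = r2 * D"
   and perm: "D * r1 * M * r1 - r1 * M * s1 * D = r1 + h * D * r1"
  shows "(s1 * D * s1 * D - D * s1 * D * s1) * (r2 * r1 * M) = r2 * r1 * M * s1 * s2 * (s1 * D * s1 * D - D * s1 * D * s1) * s2 * s1
     + h * (s1 * D * s1 * D - D * s1 * D * s1) * (s1 + r2)"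
    and "D * r1 * r2 * (r1 * M * r1 * M - M * r1 * M * r1 - h * (r1 * M - M * r1))
      = r1 * r2 * (r1 * M * r1 * M - M * r1 * M * r1 - h * (r1 * M - M * r1)) * s2 * s1 * D * s1 * s2"
proof -
  txt \<open>With \<open>s\<^sub>i = r\<^sub>i - lam\<close> both sides are polynomials in \<open>r\<^sub>1, r\<^sub>2, M, D\<close> over the central \<open>lam, h\<close>;
    moving \<open>r\<^sub>2\<close> to the left and reducing \<open>D r\<^sub>1 M\<close> and \<open>D r\<^sub>1 r\<^sub>2 M\<close> brings them to a common
    normal form.\<close>
  note as = mult.assoc
  \<comment> \<open>Products are normalised nested to the right, so each rule is also needed with an
    arbitrary tail \<open>w\<close>.\<close>
  have l: "x * y = z \<Longrightarrow> x * (y * w) = z * w" for x y z w :: 'a by (simp add: as[symmetric])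
  have l3: "x * y * v = z \<Longrightarrow> x * (y * (v * w)) = z * w" for x y z v w :: 'a by (simp add: as[symmetric])
  have q1: "r1 * r1 = 1 + lam * r1" using inv(1) by (simp add: s1 algebra_simps lam)
  have q2: "r2 * r2 = 1 + lam * r2" using inv(2) by (simp add: s2 algebra_simps lam)
  have "D * r1 * M * r1 = r1 * M * s1 * D + r1 + h * D * r1"
    using perm by (simp add: diff_eq_eq add.commute add.left_commute)
  then have "D * r1 * M * (r1 * s1) = (r1 * M * s1 * D + r1 + h * D * r1) * s1"
    by (simp add: as[symmetric])
  then have p1: "D * r1 * M = (r1 * M * s1 * D + r1 + h * D * r1) * s1" by (simp add: inv)
  note dist = distrib_left distrib_right left_diff_distrib right_diff_distrib
  note base = lam h l[OF lam(1)] l[OF lam(2)] l[OF lam(3)] l[OF lam(4)]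
    l[OF h(1)] l[OF h(2)] l[OF h(3)] l[OF h(4)] l[OF h(5)]
    br[unfolded as] l3[OF br] rM l[OF rM] rD l[OF rD]
   q1 q2 l[OF q1] l[OF q2]
  define p where "p = (r1 * M * s1 * D + r1 + h * D * r1) * s1"
  have p': "p = 1 + h * D - lam * (r1 * (M * (r1 * D))) + lam * (lam * (r1 * (M * D))) + r1 * (M * (r1 * (D * r1))) - lam * (r1 * (M * (D * r1)))"
    unfolding p_def s1 by (simp add: base as dist)
  have P1: "D * (r1 * M) = p" using p1 by (simp add: p_def as)
  \<comment> \<open>Moving \<open>r2\<close> to the left of \<open>M\<close> hides the reducible
    product \<open>D * r1 * M\<close>; this overlap of two rules needs a rule of its own.\<close>
  have P2: "D * (r1 * (r2 * M)) = p * r2"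
    unfolding P1[symmetric] by (simp add: as rM)
  have P1': "D * (r1 * (M * w)) = p * w" for w by (simp add: P1[symmetric] as)
  have P2': "D * (r1 * (r2 * (M * w))) = p * (r2 * w)" for w by (simp add: P1[symmetric] as rM l[OF rM])
  note rules = base P1[unfolded p'] P1'[unfolded p'] P2[unfolded p'] P2'[unfolded p'] as s1 s2 dist
  show "(s1 * D * s1 * D - D * s1 * D * s1) * (r2 * r1 * M) = r2 * r1 * M * s1 * s2 * (s1 * D * s1 * D - D * s1 * D * s1) * s2 * s1
     + h * (s1 * D * s1 * D - D * s1 * D * s1) * (s1 + r2)"
    by (simp add: rules)
  show "D * r1 * r2 * (r1 * M * r1 * M - M * r1 * M * r1 - h * (r1 * M - M * r1))
      = r1 * r2 * (r1 * M * r1 * M - M * r1 * M * r1 - h * (r1 * M - M * r1)) * s2 * s1 * D * s1 * s2"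
    by (simp add: rules)
qed

section \<open>Relators as matrix expressions over a ring with a scalar map\<close>

definition scalar_linear :: "(complex \<Rightarrow> 'a::ring_1) \<Rightarrow> 'a \<Rightarrow> bool" where
  "scalar_linear s x \<longleftrightarrow> (\<forall>c. s c * x = x * s c)"

definition entries_linear :: "(complex \<Rightarrow> 'a::ring_1) \<Rightarrow> 'a^'m^'n \<Rightarrow> bool" where
  "entries_linear s X \<longleftrightarrow> (\<forall>i j. scalar_linear s (X $ i $ j))"

text \<open>The scalar map \<open>s\<close> is a parameter so that one expression serves both for
  free algebras (\<open>scalar\<close>) and for operators (\<open>scalar_op\<close>), and ring
  morphisms carry one instance to another.\<close>

definition m_matrix :: "(complex \<Rightarrow> 'a::ring_1) \<Rightarrow> complex^('n::finite \<times> 'n)^('n \<times> 'n) \<Rightarrow> complex \<Rightarrow>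
    'a^'n^'n \<Rightarrow> 'a^('n \<times> 'n)^('n \<times> 'n)" where
  "m_matrix s R h M = (let A = map_matrix s R in
     (A ** on1 M ** A ** on1 M - on1 M ** A ** on1 M ** A) - mat (s h) ** (A ** on1 M - on1 M ** A))"

definition d_matrix :: "(complex \<Rightarrow> 'a::ring_1) \<Rightarrow> complex^('n::finite \<times> 'n)^('n \<times> 'n) \<Rightarrow>
    'a^'n^'n \<Rightarrow> 'a^('n \<times> 'n)^('n \<times> 'n)" where
  "d_matrix s R D = (let B = map_matrix s (matrix_inv R) in
     B ** on1 D ** B ** on1 D - on1 D ** B ** on1 D ** B)"

definition perm_matrix :: "(complex \<Rightarrow> 'a::ring_1) \<Rightarrow> complex^('n::finite \<times> 'n)^('n \<times> 'n) \<Rightarrow> complex \<Rightarrow>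
    'a^'n^'n \<Rightarrow> 'a^'n^'n \<Rightarrow> 'a^('n \<times> 'n)^('n \<times> 'n)" where
  "perm_matrix s R h M D = (let A = map_matrix s R; B = map_matrix s (matrix_inv R) in
     (on1 D ** A ** on1 M ** A - A ** on1 M ** B ** on1 D) - (A + mat (s h) ** on1 D ** A))"

lemma relators_eq_entries:
  "m_relators R h M = entries (m_matrix scalar R h M)"
  "d_relators R D = entries (d_matrix scalar R D)"
  "perm_relators R h M D = entries (perm_matrix scalar R h M D)"
  by (simp_all add: m_relators_def d_relators_def perm_relators_def m_matrix_def d_matrix_def
      perm_matrix_def Let_def emb_def)

lemma (in ring_morphism) map_relator_matrix:
  assumes "\<And>c. f (s c) = s' c"
  shows "map_matrix f (m_matrix s R h M) = m_matrix s' R h (map_matrix f M)"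
    "map_matrix f (d_matrix s R D) = d_matrix s' R (map_matrix f D)"
    "map_matrix f (perm_matrix s R h M D) = perm_matrix s' R h (map_matrix f M) (map_matrix f D)"
proof -
  have "f \<circ> s = s'" using assms by auto
  then show "map_matrix f (m_matrix s R h M) = m_matrix s' R h (map_matrix f M)"
    "map_matrix f (d_matrix s R D) = d_matrix s' R (map_matrix f D)"
    "map_matrix f (perm_matrix s R h M D) = perm_matrix s' R h (map_matrix f M) (map_matrix f D)"
    by (simp_all add: m_matrix_def d_matrix_def perm_matrix_def Let_def map_matrix_simps
        map_matrix_comp assms)
qed

lemma entries_linear_mat_commute:
  "entries_linear s X \<Longrightarrow> X ** mat (s c) = mat (s c) ** X" for X :: "'a::ring_1^'m^'m"
  by (simp add: vec_eq_iff matrix_mult_nth mat_nth if_mult_zero sum_if_UNIV entries_linear_def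
      scalar_linear_def)

lemma scalar_linear_closed:
  "scalar_linear s 0" "scalar_linear s 1"
  "scalar_linear s x \<Longrightarrow> scalar_linear s y \<Longrightarrow> scalar_linear s (x + y)"
  "scalar_linear s x \<Longrightarrow> scalar_linear s y \<Longrightarrow> scalar_linear s (x - y)"
  "scalar_linear s x \<Longrightarrow> scalar_linear s y \<Longrightarrow> scalar_linear s (x * y)"
     apply (simp_all add: scalar_linear_def distrib_left distrib_right left_diff_distrib right_diff_distrib)
  by (metis mult.assoc)

lemma scalar_linear_sum:
  "(\<And>i. i \<in> A \<Longrightarrow> scalar_linear s (g i)) \<Longrightarrow> scalar_linear s (sum g A)"
  by (induct A rule: infinite_finite_induct) (simp_all add: scalar_linear_closed)

lemma scalar_linear_complex:
  fixes f :: "complex \<Rightarrow> 'a::ring_1"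
  assumes "ring_morphism f" shows "scalar_linear f (f c)"
proof -
  interpret ring_morphism f by (rule assms)
  show ?thesis by (simp add: scalar_linear_def mult.commute flip: mult)
qed

lemma entries_linear_closed:
  fixes s :: "complex \<Rightarrow> 'a::ring_1"
  assumes s: "ring_morphism s"
  shows "entries_linear s A \<Longrightarrow> entries_linear s B \<Longrightarrow> entries_linear s (A ** B)"
    "entries_linear s A' \<Longrightarrow> entries_linear s B' \<Longrightarrow> entries_linear s (A' + B')"
    "entries_linear s A' \<Longrightarrow> entries_linear s B' \<Longrightarrow> entries_linear s (A' - B')"
    "entries_linear s (map_matrix s C)" "entries_linear s (mat (s c))" "entries_linear s (mat 1)"
    "entries_linear s X \<Longrightarrow> entries_linear s (on1 X)"
    "entries_linear s Y \<Longrightarrow> entries_linear s (leg12 Y)"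
    "entries_linear s Y \<Longrightarrow> entries_linear s (leg23 Y)"
proof -
  interpret ring_morphism s by (rule s)
  show "entries_linear s A \<Longrightarrow> entries_linear s B \<Longrightarrow> entries_linear s (A ** B)"
    by (simp add: entries_linear_def matrix_mult_nth scalar_linear_sum scalar_linear_closed)
qed (simp_all add: entries_linear_def scalar_linear_closed
    scalar_linear_complex[OF s] split_paired_all on1_nth leg12_nth leg23_nth mat_nth)

text \<open>In the first identity \<open>R_23 R_12 M_1 R_12^-1 R_23^-1\<close> is \<open>M\<close>
  carried to the third leg. The derivative relators move through it and reappear on the right
  followed by complex matrices only, so vanishing at \<open>v\<close> propagates to the
  \<open>m_i^j v\<close>. In the second, \<open>D_1\<close> moves through the relators of
  \<open>\<M>(R)\<close>, which end up to its left, preceded by complex matrices only.\<close>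

lemma mixed_matrix_identities:
  fixes s :: "complex \<Rightarrow> 'a::ring_1" and R :: "complex^('n::finite \<times> 'n)^('n \<times> 'n)"
  assumes s: "ring_morphism s" and H: "hecke_symmetry q R"
    and M: "entries_linear s M" and D: "entries_linear s D"
    and perm: "perm_matrix s R h M D = 0"
  defines "A \<equiv> map_matrix s R" and "B \<equiv> map_matrix s (matrix_inv R)"
  shows "leg12 (d_matrix s R D) ** (leg23 A ** leg12 A ** leg12 (on1 M)) =
      leg23 A ** leg12 A ** leg12 (on1 M) ** leg12 B ** leg23 B ** leg12 (d_matrix s R D) ** leg23 B ** leg12 B
      + mat (s h) ** leg12 (d_matrix s R D) ** (leg12 B + leg23 A)" (is ?t1)
    and "leg12 (on1 D) ** leg12 A ** leg23 A ** leg12 (m_matrix s R h M) =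
      leg12 A ** leg23 A ** leg12 (m_matrix s R h M) ** leg23 B ** leg12 B ** leg12 (on1 D)
      ** leg12 B ** leg23 B" (is ?t2)
proof -
  interpret s: ring_morphism s by (rule s)
  let ?l = "q - inverse q"
  let ?e = "matrix_endo :: 'a^('n \<times> 'n \<times> 'n)^('n \<times> 'n \<times> 'n) \<Rightarrow> _"
  have AB: "A ** B = mat 1"
    using arg_cong[OF hecke_inverse(1)[OF H], of "map_matrix s"]
    by (simp add: A_def B_def s.map_matrix_simps s.one)
  have B: "B = A - mat (s ?l)"
    using arg_cong[OF hecke_inverse(3)[OF H], of "map_matrix s"]
    by (simp add: A_def B_def s.map_matrix_simps)
  have lA: "entries_linear s A" by (simp add: A_def entries_linear_closed[OF s])
  have br: "leg12 A ** leg23 A ** leg12 A = leg23 A ** leg12 A ** leg23 A"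
    using H arg_cong[of _ _ "map_matrix s"]
    by (simp add: A_def hecke_symmetry_def flip: s.map_matrix_simps)
  have comm: "entries_linear s X \<Longrightarrow> leg12 (on1 X) ** leg23 A = leg23 A ** leg12 (on1 X)" for X
    by (rule leg23_leg12_on1_commute) (simp add: A_def entries_linear_def scalar_linear_def)
  have scal: "s c * s d = s d * s c" for c d by (simp add: mult.commute flip: s.mult)
  have p: "on1 D ** A ** on1 M ** A - A ** on1 M ** B ** on1 D = A + mat (s h) ** on1 D ** A"
    using perm by (simp add: perm_matrix_def A_def B_def Let_def)
  note c = entries_linear_mat_commute[OF entries_linear_closed(8)[OF s lA]]
    entries_linear_mat_commute[OF entries_linear_closed(9)[OF s lA]]
    entries_linear_mat_commute[OF entries_linear_closed(8)[OF s entries_linear_closed(7)[OF s M]]]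
    entries_linear_mat_commute[OF entries_linear_closed(8)[OF s entries_linear_closed(7)[OF s D]]]
    entries_linear_mat_commute[OF entries_linear_closed(5)[OF s]]
  have hyps: "?e (leg12 A) * ?e (leg12 B) = 1" "?e (leg23 A) * ?e (leg23 B) = 1"
    "?e (leg12 B) = ?e (leg12 A) - ?e (mat (s ?l))" "?e (leg23 B) = ?e (leg23 A) - ?e (mat (s ?l))"
    "?e (leg12 A) * ?e (mat (s ?l)) = ?e (mat (s ?l)) * ?e (leg12 A)"
    "?e (leg23 A) * ?e (mat (s ?l)) = ?e (mat (s ?l)) * ?e (leg23 A)"
    "?e (leg12 (on1 M)) * ?e (mat (s ?l)) = ?e (mat (s ?l)) * ?e (leg12 (on1 M))"
    "?e (leg12 (on1 D)) * ?e (mat (s ?l)) = ?e (mat (s ?l)) * ?e (leg12 (on1 D))"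
    "?e (leg12 A) * ?e (mat (s h)) = ?e (mat (s h)) * ?e (leg12 A)"
    "?e (leg23 A) * ?e (mat (s h)) = ?e (mat (s h)) * ?e (leg23 A)"
    "?e (leg12 (on1 M)) * ?e (mat (s h)) = ?e (mat (s h)) * ?e (leg12 (on1 M))"
    "?e (leg12 (on1 D)) * ?e (mat (s h)) = ?e (mat (s h)) * ?e (leg12 (on1 D))"
    "?e (mat (s h)) * ?e (mat (s ?l)) = ?e (mat (s ?l)) * ?e (mat (s h))"
    "?e (leg12 A) * ?e (leg23 A) * ?e (leg12 A) = ?e (leg23 A) * ?e (leg12 A) * ?e (leg23 A)"
    "?e (leg12 (on1 M)) * ?e (leg23 A) = ?e (leg23 A) * ?e (leg12 (on1 M))"
    "?e (leg12 (on1 D)) * ?e (leg23 A) = ?e (leg23 A) * ?e (leg12 (on1 D))"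
    "?e (leg12 (on1 D)) * ?e (leg12 A) * ?e (leg12 (on1 M)) * ?e (leg12 A)
      - ?e (leg12 A) * ?e (leg12 (on1 M)) * ?e (leg12 B) * ?e (leg12 (on1 D))
     = ?e (leg12 A) + ?e (mat (s h)) * ?e (leg12 (on1 D)) * ?e (leg12 A)"
    using arg_cong[OF AB, of leg12] arg_cong[OF AB, of leg23] arg_cong[OF B, of leg12]
      arg_cong[OF B, of leg23] arg_cong[OF p, of leg12] br
    by (simp_all only: matrix_endo_inject leg12_mult leg12_linear leg23_mult leg23_linear c
        comm[OF M] comm[OF D] flip: matrix_endo_simps)
  note ids = mixed_ring_identities[OF hyps]
  note simps = d_matrix_def m_matrix_def Let_def A_def[symmetric] B_def[symmetric]
    leg12_mult leg12_linear
  show ?t1 unfolding simps using ids(1) unfolding matrix_endo_simps[symmetric] matrix_endo_inject .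
  show ?t2 unfolding simps using ids(2) unfolding matrix_endo_simps[symmetric] matrix_endo_inject .
qed

section \<open>Skew inverses and the quantum trace\<close>

text \<open>The combination of the memberships \<open>G\<close> with weights \<open>w\<close>
  isolates \<open>G m0\<close>. Membership in a subspace instead of an equation lets the same
  argument serve for \<open>{0}\<close> and for ideals.\<close>

lemma (in Modules.module) subspace_cancel:
  fixes r :: "'k::finite \<Rightarrow> 'm::finite \<Rightarrow> 'a"
  assumes J: "subspace J" and w: "\<And>m. (\<Sum>k\<in>UNIV. w k * r k m) = (if m = m0 then 1 else 0)"
    and G: "\<And>k. (\<Sum>m\<in>UNIV. scale (r k m) (G m)) \<in> J"
  shows "G m0 \<in> J"
proof -
  have "(\<Sum>k\<in>UNIV. scale (w k) (\<Sum>m\<in>UNIV. scale (r k m) (G m))) \<in> J"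
    by (intro subspace_sum[OF J] subspace_scale[OF J] G)
  also have "(\<Sum>k\<in>UNIV. scale (w k) (\<Sum>m\<in>UNIV. scale (r k m) (G m)))
    = (\<Sum>m\<in>UNIV. \<Sum>k\<in>UNIV. scale (w k * r k m) (G m))"
    by (subst sum.swap) (simp add: scale_sum_right)
  also have "\<dots> = (\<Sum>m\<in>UNIV. if m = m0 then G m else 0)"
    by (intro sum.cong refl) (simp flip: scale_sum_left add: w)
  finally show ?thesis by simp
qed

lemma sum_swap22:
  "(\<Sum>a\<in>A. \<Sum>b\<in>B. \<Sum>x\<in>X. \<Sum>y\<in>Y. g a b x y) = (\<Sum>x\<in>X. \<Sum>y\<in>Y. \<Sum>a\<in>A. \<Sum>b\<in>B. g a b x y)"
proof -
  have "(\<Sum>a\<in>A. \<Sum>b\<in>B. \<Sum>x\<in>X. \<Sum>y\<in>Y. g a b x y)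
    = (\<Sum>a\<in>A. \<Sum>x\<in>X. \<Sum>y\<in>Y. \<Sum>b\<in>B. g a b x y)"
    by (intro sum.cong refl, subst sum.swap, intro sum.cong refl, rule sum.swap)
  also have "\<dots> = (\<Sum>x\<in>X. \<Sum>y\<in>Y. \<Sum>a\<in>A. \<Sum>b\<in>B. g a b x y)"
    by (subst sum.swap, intro sum.cong refl, rule sum.swap)
  finally show ?thesis .
qed

lemma sum_rotate3:
  "(\<Sum>a\<in>A. \<Sum>b\<in>B. \<Sum>c\<in>C. g a b c) = (\<Sum>b\<in>B. \<Sum>c\<in>C. \<Sum>a\<in>A. g a b c)"
  by (subst sum.swap, intro sum.cong refl, rule sum.swap)

lemma skew_inverse_nth:
  assumes "is_skew_inverse R \<Psi>"
  shows "(\<Sum>j\<in>UNIV. \<Sum>x\<in>UNIV. R $ (i, j) $ (i', x) * \<Psi> $ (x, k) $ (j, k')) = (if i = k' \<and> k = i' then 1 else 0)"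
    and "(\<Sum>j\<in>UNIV. \<Sum>x\<in>UNIV. \<Psi> $ (i, j) $ (i', x) * R $ (x, k) $ (j, k')) = (if i = k' \<and> k = i' then 1 else 0)"
proof -
  have flip: "flip_matrix $ (i, k) $ (i', k') = (if i = k' \<and> k = i' then 1 else 0)"
    by (simp add: flip_matrix_def)
  have "ptrace2_3 (leg12 A ** leg23 B) $ (i, k) $ (i', k')
      = (\<Sum>j\<in>UNIV. \<Sum>x\<in>UNIV. A $ (i, j) $ (i', x) * B $ (x, k) $ (j, k'))"
    for A B :: "complex^('a \<times> 'a)^('a \<times> 'a)"
    by (simp add: ptrace2_3_def matrix_mult_nth sum_UNIV_prod leg12_nth leg23_nth if_mult_zero
      sum_if_const sum_if_UNIV)
  with flip assms show "(\<Sum>j\<in>UNIV. \<Sum>x\<in>UNIV. R $ (i, j) $ (i', x) * \<Psi> $ (x, k) $ (j, k')) = (if i = k' \<and> k = i' then 1 else 0)"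
    "(\<Sum>j\<in>UNIV. \<Sum>x\<in>UNIV. \<Psi> $ (i, j) $ (i', x) * R $ (x, k) $ (j, k')) = (if i = k' \<and> k = i' then 1 else 0)"
    unfolding is_skew_inverse_def by metis+
qed

text \<open>After reshuffling indices, the first half of the definition of \<Psi> makes it a left
  inverse for the contraction over the first leg of \<open>R\<close>; the second half plays this
  part for the second leg.\<close>

lemma skew_cancel_first:
  fixes R :: "complex^('n::finite \<times> 'n)^('n \<times> 'n)" and act :: "complex \<Rightarrow> 'b::ab_group_add \<Rightarrow> 'b"
  assumes "is_skew_inverse R \<Psi>" and "Modules.module act" and "Modules.module.subspace act J"
    and G: "\<And>k e. (\<Sum>b\<in>UNIV. \<Sum>x\<in>UNIV. act (R $ (b, k) $ (x, e)) (G b x)) \<in> J"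
  shows "G b x \<in> J"
proof -
  interpret Modules.module act by (rule assms(2))
  have "case_prod G (b, x) \<in> J"
  proof (rule subspace_cancel[OF assms(3)])
    show "(\<Sum>m\<in>UNIV. act (R $ (fst m, snd k) $ (snd m, fst k)) (case m of (b, x) \<Rightarrow> G b x)) \<in> J" for k
      using G[of "snd k" "fst k"] by (simp add: sum_UNIV_prod)
    show "(\<Sum>k\<in>UNIV. \<Psi> $ (fst k, x) $ (snd k, b) * R $ (fst m, snd k) $ (snd m, fst k))
        = (if m = (b, x) then 1 else 0)" for m
      using skew_inverse_nth(1)[OF assms(1), of "fst m" "snd m" x b]
      by (subst sum_UNIV_prod, subst sum.swap) (auto simp: mult.commute)
  qed
  then show ?thesis by simp
qed

lemma skew_cancel_second:
  fixes R :: "complex^('n::finite \<times> 'n)^('n \<times> 'n)" and act :: "complex \<Rightarrow> 'b::ab_group_add \<Rightarrow> 'b"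
  assumes "is_skew_inverse R \<Psi>" and "Modules.module act" and "Modules.module.subspace act J"
    and G: "\<And>k e. (\<Sum>b\<in>UNIV. \<Sum>x\<in>UNIV. act (R $ (k, b) $ (e, x)) (G b x)) \<in> J"
  shows "G b x \<in> J"
proof -
  interpret Modules.module act by (rule assms(2))
  have "case_prod G (b, x) \<in> J"
  proof (rule subspace_cancel[OF assms(3)])
    show "(\<Sum>m\<in>UNIV. act (R $ (fst k, fst m) $ (snd k, snd m)) (case m of (b, x) \<Rightarrow> G b x)) \<in> J" for k
      using G[of "fst k" "snd k"] by (simp add: sum_UNIV_prod)
    show "(\<Sum>k\<in>UNIV. \<Psi> $ (x, snd k) $ (b, fst k) * R $ (fst k, fst m) $ (snd k, snd m))
        = (if m = (b, x) then 1 else 0)" for m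
      using skew_inverse_nth(2)[OF assms(1), of x b "fst m" "snd m"]
      by (subst sum_UNIV_prod, subst sum.swap) auto
  qed
  then show ?thesis by simp
qed

lemma module_complex: "Modules.module ((*) :: complex \<Rightarrow> complex \<Rightarrow> complex)"
  by unfold_locales (simp_all add: algebra_simps)

lemma skew_cancel_second_eq:
  fixes R :: "complex^('n::finite \<times> 'n)^('n \<times> 'n)"
  assumes "is_skew_inverse R \<Psi>"
    and "\<And>k e. (\<Sum>b\<in>UNIV. \<Sum>x\<in>UNIV. R $ (k, b) $ (e, x) * G b x)
      = (\<Sum>b\<in>UNIV. \<Sum>x\<in>UNIV. R $ (k, b) $ (e, x) * H b x)"
  shows "G b x = H b x"
proof -
  have "(\<lambda>b x. G b x - H b x) b x \<in> {0}"
    by (rule skew_cancel_second[OF assms(1) module_complex Modules.module.subspace_single_0[OF module_complex]])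
      (simp add: right_diff_distrib sum_subtractf assms(2))
  then show ?thesis by simp
qed

lemma is_skew_inverse_unique:
  fixes R :: "complex^('n::finite \<times> 'n)^('n \<times> 'n)"
  assumes "is_skew_inverse R \<Psi>" "is_skew_inverse R \<Phi>"
  shows "\<Psi> = \<Phi>"
proof -
  have "(\<lambda>j x. \<Psi> $ (x, k) $ (j, k')) j x = (\<lambda>j x. \<Phi> $ (x, k) $ (j, k')) j x" for j x k k'
    by (rule skew_cancel_second_eq[OF assms(1)])
     (simp add: skew_inverse_nth(1)[OF assms(1)] skew_inverse_nth(1)[OF assms(2)])
  then show ?thesis by (simp add: vec_eq_iff split_paired_all)
qed

lemma is_skew_inverse_skew_inverse: "skew_invertible R \<Longrightarrow> is_skew_inverse R (skew_inverse R)"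
  unfolding skew_invertible_def skew_inverse_def
  by (rule theI') (metis is_skew_inverse_unique)

lemma C_matrix_nth: "C_matrix R $ i $ i' = (\<Sum>j\<in>UNIV. skew_inverse R $ (i, j) $ (i', j))"
  by (simp add: C_matrix_def ptrace2_2_def)

text \<open>Tracing the flip over its second factor leaves the identity, so the first identity for
  \<Psi> becomes \<open>Tr_(2)(R_12 C_2) = I\<close>.\<close>

lemma trace_R_C:
  assumes "skew_invertible R"
  shows "(\<Sum>j\<in>UNIV. \<Sum>x\<in>UNIV. R $ (i, j) $ (i', x) * C_matrix R $ x $ j) = (if i = i' then 1 else 0)"
proof -
  have "(\<Sum>j\<in>UNIV. \<Sum>x\<in>UNIV. R $ (i, j) $ (i', x) * C_matrix R $ x $ j)
    = (\<Sum>j\<in>UNIV. \<Sum>x\<in>UNIV. \<Sum>k\<in>UNIV. R $ (i, j) $ (i', x) * skew_inverse R $ (x, k) $ (j, k))"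
    by (simp add: C_matrix_nth sum_distrib_left)
  also have "\<dots> = (\<Sum>k\<in>UNIV. \<Sum>j\<in>UNIV. \<Sum>x\<in>UNIV. R $ (i, j) $ (i', x) * skew_inverse R $ (x, k) $ (j, k))"
    by (subst (2) sum.swap, subst sum.swap) (rule refl)
  also have "\<dots> = (\<Sum>k\<in>UNIV. if k = i then (if i = i' then 1 else 0) else 0)"
    by (intro sum.cong refl)
      (auto simp: skew_inverse_nth(1)[OF is_skew_inverse_skew_inverse[OF assms]])
  finally show ?thesis by simp
qed

text \<open>The identity \<open>Tr\<^sub>(\<^sub>2\<^sub>)(A\<^sub>1\<^sub>2 X\<^sub>1 A'\<^sub>1\<^sub>2 C\<^sub>2) = Tr(CX)\<close>, applied below to \<open>(A, A')\<close> equal to \<open>(R, R\<^sup>-\<^sup>1)\<close> and to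
  \<open>(R\<^sup>-\<^sup>1, R)\<close>. Every \<open>X\<^sub>2\<close> is of the form \<open>Tr\<^sub>(\<^sub>1\<^sub>)(Z\<^sub>1 R\<^sub>1\<^sub>2)\<close>, and the braid relation carries the
  conjugation by \<open>A\<^sub>2\<^sub>3\<close> over to the inner legs.\<close>

lemma partial_trace_conjugation:
  fixes R :: "complex^('n::finite \<times> 'n)^('n \<times> 'n)"
  assumes R: "skew_invertible R" and inv: "A' ** A = mat 1"
    and braid: "leg23 A ** leg12 R ** leg23 A' = leg12 A' ** leg23 R ** leg12 A"
  shows "(\<Sum>x\<in>UNIV. \<Sum>y\<in>UNIV. \<Sum>b\<in>UNIV. A $ (i, x) $ (a, b) * A' $ (c, b) $ (i', y) * C_matrix R $ y $ x)
    = (if i = i' then C_matrix R $ c $ a else 0)"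
proof -
  let ?C = "C_matrix R"
  define G where "G a c = (\<Sum>x\<in>UNIV. \<Sum>y\<in>UNIV. \<Sum>b\<in>UNIV. A $ (i, x) $ (a, b) * A' $ (c, b) $ (i', y) * ?C $ y $ x)" for a c
  define H where "H a c = (if i = i' then ?C $ c $ a else 0)" for a c
  have "G a c = H a c"
  proof (rule skew_cancel_second_eq[OF is_skew_inverse_skew_inverse[OF R]])
    fix p p'
    have br: "(\<Sum>c\<in>UNIV. \<Sum>b\<in>UNIV. (\<Sum>a\<in>UNIV. A $ (i, x) $ (a, b) * R $ (p, a) $ (p', c)) * A' $ (c, b) $ (i', y))
      = (\<Sum>u\<in>UNIV. \<Sum>f\<in>UNIV. (\<Sum>e\<in>UNIV. A' $ (p, i) $ (u, e) * R $ (e, x) $ (f, y)) * A $ (u, f) $ (p', i'))" for x y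
      using arg_cong[OF braid, of "\<lambda>X. X $ (p, i, x) $ (p', i', y)"]
      by (simp add: matrix_mult_nth sum_UNIV_prod leg12_nth leg23_nth if_mult_zero sum_if_const sum_if_UNIV)
    have "(\<Sum>a\<in>UNIV. \<Sum>c\<in>UNIV. R $ (p, a) $ (p', c) * G a c)
      = (\<Sum>x\<in>UNIV. \<Sum>y\<in>UNIV. \<Sum>a\<in>UNIV. \<Sum>c\<in>UNIV. \<Sum>b\<in>UNIV.
          A $ (i, x) $ (a, b) * R $ (p, a) $ (p', c) * A' $ (c, b) $ (i', y) * ?C $ y $ x)"
      by (subst sum_swap22[symmetric]) (simp add: G_def sum_distrib_left mult_ac)
    also have "\<dots> = (\<Sum>x\<in>UNIV. \<Sum>y\<in>UNIV. (\<Sum>c\<in>UNIV. \<Sum>b\<in>UNIV.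
        (\<Sum>a\<in>UNIV. A $ (i, x) $ (a, b) * R $ (p, a) $ (p', c)) * A' $ (c, b) $ (i', y)) * ?C $ y $ x)"
      by (simp add: sum_distrib_left sum_distrib_right, rule sum.cong[OF refl], rule sum.cong[OF refl], rule sum_rotate3)
    also have "\<dots> = (\<Sum>x\<in>UNIV. \<Sum>y\<in>UNIV. \<Sum>u\<in>UNIV. \<Sum>f\<in>UNIV. \<Sum>e\<in>UNIV.
        A' $ (p, i) $ (u, e) * A $ (u, f) $ (p', i') * (R $ (e, x) $ (f, y) * ?C $ y $ x))"
      unfolding br by (simp add: sum_distrib_left sum_distrib_right mult_ac)
    also have "\<dots> = (\<Sum>u\<in>UNIV. \<Sum>f\<in>UNIV. \<Sum>e\<in>UNIV. A' $ (p, i) $ (u, e) * A $ (u, f) $ (p', i') *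
        (\<Sum>x\<in>UNIV. \<Sum>y\<in>UNIV. R $ (e, x) $ (f, y) * ?C $ y $ x))"
      by (subst sum_swap22, simp add: sum_distrib_left, rule sum.cong[OF refl], rule sum.cong[OF refl],
          subst sum_rotate3, rule sum_rotate3)
    \<comment> \<open>The inner contraction is \<open>Tr_(2)(R C_2) = I\<close>, which forces
      \<open>e = f\<close>; what remains is an entry of \<open>A' ** A\<close>.\<close>
    also have "\<dots> = (\<Sum>u\<in>UNIV. \<Sum>f\<in>UNIV. A' $ (p, i) $ (u, f) * A $ (u, f) $ (p', i'))"
      by (simp add: trace_R_C[OF R] if_mult_zero sum_if_UNIV if_distrib[of "(*) _"] cong: if_cong)
    also have "\<dots> = (A' ** A) $ (p, i) $ (p', i')"
      by (simp add: matrix_mult_nth sum_UNIV_prod)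
    also have "\<dots> = (\<Sum>a\<in>UNIV. \<Sum>c\<in>UNIV. R $ (p, a) $ (p', c) * H a c)"
      by (cases "i = i'") (simp_all add: H_def inv mat_nth trace_R_C[OF R])
    finally show "(\<Sum>b\<in>UNIV. \<Sum>x\<in>UNIV. R $ (p, b) $ (p', x) * G b x) = (\<Sum>b\<in>UNIV. \<Sum>x\<in>UNIV. R $ (p, b) $ (p', x) * H b x)" .
  qed
  then show ?thesis by (simp add: G_def H_def)
qed

text \<open>The braid relation, multiplied by one inverse on each side, in the two forms that the
  partial trace identity demands.\<close>

lemma braid_conjugations:
  fixes R :: "complex^('n::finite \<times> 'n)^('n \<times> 'n)"
  assumes H: "hecke_symmetry q R"
  shows "leg23 R ** leg12 R ** leg23 (matrix_inv R) = leg12 (matrix_inv R) ** leg23 R ** leg12 R"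
    and "leg23 (matrix_inv R) ** leg12 R ** leg23 R = leg12 R ** leg23 R ** leg12 (matrix_inv R)"
proof -
  let ?e = "matrix_endo :: complex^('n \<times> 'n \<times> 'n)^('n \<times> 'n \<times> 'n) \<Rightarrow> _"
  have 1: "b * a * t = s * b * a" "t * a * b = a * b * s"
    if "a * b * a = b * a * b" "a * s = 1" "s * a = 1" "b * t = 1" "t * b = 1"
    for a b s t :: "(complex^('n \<times> 'n \<times> 'n)) endo"
  proof -
    have "s * (a * b * a) * t = s * (b * a * b) * t" by (simp add: that)
    then have "(s * a) * b * a * t = s * b * a * (b * t)" by (simp add: mult.assoc)
    then show "b * a * t = s * b * a" by (simp add: that)
    have "t * (a * b * a) * s = t * (b * a * b) * s" by (simp add: that)
    then have "t * a * b * (a * s) = (t * b) * a * b * s" by (simp add: mult.assoc)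
    then show "t * a * b = a * b * s" by (simp add: that)
  qed
  have h: "?e (leg12 R) * ?e (leg23 R) * ?e (leg12 R) = ?e (leg23 R) * ?e (leg12 R) * ?e (leg23 R)"
    "?e (leg12 R) * ?e (leg12 (matrix_inv R)) = 1" "?e (leg12 (matrix_inv R)) * ?e (leg12 R) = 1"
    "?e (leg23 R) * ?e (leg23 (matrix_inv R)) = 1" "?e (leg23 (matrix_inv R)) * ?e (leg23 R) = 1"
    using H hecke_inverse(1,2)[OF H]
    by (simp_all add: hecke_symmetry_def leg12_linear leg23_linear flip: matrix_endo_simps leg12_mult leg23_mult)
  show "leg23 R ** leg12 R ** leg23 (matrix_inv R) = leg12 (matrix_inv R) ** leg23 R ** leg12 R"
    "leg23 (matrix_inv R) ** leg12 R ** leg23 R = leg12 R ** leg23 R ** leg12 (matrix_inv R)"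
    using 1[OF h] by (simp_all add: matrix_endo_inject flip: matrix_endo_simps)
qed

definition CC_matrix :: "complex^('n::finite \<times> 'n)^('n \<times> 'n) \<Rightarrow> complex^('n \<times> 'n)^('n \<times> 'n)" where
  "CC_matrix R = (\<chi> r c. case (r, c) of ((i, j), (i', j')) \<Rightarrow> C_matrix R $ i $ i' * C_matrix R $ j $ j')"

lemma CC_matrix_nth: "CC_matrix R $ (i, j) $ (i', j') = C_matrix R $ i $ i' * C_matrix R $ j $ j'"
  by (simp add: CC_matrix_def)

text \<open>Both partial trace identities express \<open>R\<^sub>2\<^sub>1\<^sup>-\<^sup>1\<close> through \<open>\<Psi>\<close>:
  \<open>R\<^sub>2\<^sub>1\<^sup>-\<^sup>1 C\<^sub>1 = C\<^sub>2 \<Psi>\<^sub>1\<^sub>2\<close> and \<open>C\<^sub>1 R\<^sub>2\<^sub>1\<^sup>-\<^sup>1 = \<Psi>\<^sub>1\<^sub>2 C\<^sub>2\<close>.\<close>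

lemma CC_matrix_commute:
  fixes R :: "complex^('n::finite \<times> 'n)^('n \<times> 'n)"
  assumes H: "hecke_symmetry q R" and R: "skew_invertible R"
  shows "R ** CC_matrix R = CC_matrix R ** R"
proof -
  let ?C = "C_matrix R" and ?S = "matrix_inv R" and ?P = "skew_inverse R"
  note sk = is_skew_inverse_skew_inverse[OF R]
  have pt1: "(\<Sum>x\<in>UNIV. \<Sum>y\<in>UNIV. \<Sum>b\<in>UNIV. R $ (i, x) $ (a, b) * ?S $ (c, b) $ (i', y) * ?C $ y $ x)
      = (if i = i' then ?C $ c $ a else 0)" for i i' a c
    by (rule partial_trace_conjugation[OF R hecke_inverse(2)[OF H] braid_conjugations(1)[OF H]])
  have pt2: "(\<Sum>x\<in>UNIV. \<Sum>y\<in>UNIV. \<Sum>b\<in>UNIV. ?S $ (i, x) $ (a, b) * R $ (c, b) $ (i', y) * ?C $ y $ x)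
      = (if i = i' then ?C $ c $ a else 0)" for i i' a c
    by (rule partial_trace_conjugation[OF R hecke_inverse(1)[OF H] braid_conjugations(2)[OF H]])
  have e1: "(\<Sum>y\<in>UNIV. ?S $ (c, b) $ (i', y) * ?C $ y $ x) = (\<Sum>k\<in>UNIV. ?C $ c $ k * ?P $ (b, k) $ (x, i'))"
    for b c x i'
  proof (rule skew_cancel_second_eq[OF sk, where b = x and x = b
      and G = "\<lambda>x b. \<Sum>y\<in>UNIV. ?S $ (c, b) $ (i', y) * ?C $ y $ x"
      and H = "\<lambda>x b. \<Sum>k\<in>UNIV. ?C $ c $ k * ?P $ (b, k) $ (x, i')"])
    fix i a
    have "(\<Sum>x\<in>UNIV. \<Sum>b\<in>UNIV. R $ (i, x) $ (a, b) * (\<Sum>y\<in>UNIV. ?S $ (c, b) $ (i', y) * ?C $ y $ x))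
        = (if i = i' then ?C $ c $ a else 0)"
      unfolding pt1[symmetric]
      by (simp add: sum_distrib_left mult_ac, rule sum.cong[OF refl], rule sum.swap)
    also have "\<dots> = (\<Sum>k\<in>UNIV. ?C $ c $ k * (if i = i' \<and> k = a then 1 else 0))"
      by (auto simp: if_mult_zero sum_if_UNIV if_distrib[of "(*) _"] cong: if_cong)
    also have "\<dots> = (\<Sum>k\<in>UNIV. ?C $ c $ k * (\<Sum>x\<in>UNIV. \<Sum>b\<in>UNIV. R $ (i, x) $ (a, b) * ?P $ (b, k) $ (x, i')))"
      by (simp add: skew_inverse_nth(1)[OF sk])
    also have "\<dots> = (\<Sum>x\<in>UNIV. \<Sum>b\<in>UNIV. R $ (i, x) $ (a, b) * (\<Sum>k\<in>UNIV. ?C $ c $ k * ?P $ (b, k) $ (x, i')))"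
      by (simp add: sum_distrib_left mult_ac, rule sum_rotate3)
    finally show "(\<Sum>x\<in>UNIV. \<Sum>b\<in>UNIV. R $ (i, x) $ (a, b) * (\<Sum>y\<in>UNIV. ?S $ (c, b) $ (i', y) * ?C $ y $ x))
      = (\<Sum>x\<in>UNIV. \<Sum>b\<in>UNIV. R $ (i, x) $ (a, b) * (\<Sum>k\<in>UNIV. ?C $ c $ k * ?P $ (b, k) $ (x, i')))" .
  qed
  have e2: "(\<Sum>x\<in>UNIV. ?C $ y $ x * ?S $ (i, x) $ (a, b)) = (\<Sum>k\<in>UNIV. ?P $ (y, i) $ (b, k) * ?C $ k $ a)"
    for y b i a
  proof (rule skew_cancel_second_eq[OF sk, where b = b and x = y
      and G = "\<lambda>b y. \<Sum>x\<in>UNIV. ?C $ y $ x * ?S $ (i, x) $ (a, b)"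
      and H = "\<lambda>b y. \<Sum>k\<in>UNIV. ?P $ (y, i) $ (b, k) * ?C $ k $ a"])
    fix c i'
    have "(\<Sum>b\<in>UNIV. \<Sum>y\<in>UNIV. R $ (c, b) $ (i', y) * (\<Sum>x\<in>UNIV. ?C $ y $ x * ?S $ (i, x) $ (a, b)))
        = (if i = i' then ?C $ c $ a else 0)"
      unfolding pt2[symmetric]
      by (simp add: sum_distrib_left mult_ac, subst sum_rotate3, subst sum_rotate3, rule sum.cong[OF refl], rule sum.swap)
    also have "\<dots> = (\<Sum>k\<in>UNIV. (if c = k \<and> i = i' then 1 else 0) * ?C $ k $ a)"
      by (auto simp: if_mult_zero sum_if_UNIV if_distrib[of "(*) _"] cong: if_cong)
    also have "\<dots> = (\<Sum>k\<in>UNIV. (\<Sum>b\<in>UNIV. \<Sum>y\<in>UNIV. R $ (c, b) $ (i', y) * ?P $ (y, i) $ (b, k)) * ?C $ k $ a)"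
      by (simp add: skew_inverse_nth(1)[OF sk])
    also have "\<dots> = (\<Sum>b\<in>UNIV. \<Sum>y\<in>UNIV. R $ (c, b) $ (i', y) * (\<Sum>k\<in>UNIV. ?P $ (y, i) $ (b, k) * ?C $ k $ a))"
      by (simp add: sum_distrib_left sum_distrib_right mult_ac, rule sum_rotate3)
    finally show "(\<Sum>b\<in>UNIV. \<Sum>y\<in>UNIV. R $ (c, b) $ (i', y) * (\<Sum>x\<in>UNIV. ?C $ y $ x * ?S $ (i, x) $ (a, b)))
      = (\<Sum>b\<in>UNIV. \<Sum>y\<in>UNIV. R $ (c, b) $ (i', y) * (\<Sum>k\<in>UNIV. ?P $ (y, i) $ (b, k) * ?C $ k $ a))" .
  qed
  \<comment> \<open>Both products reduce to the same sum of terms \<open>C * \<Psi> * C\<close>, by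
    \<open>e2\<close> from the left-hand side and by \<open>e1\<close> from the right-hand
    side.\<close>
  have "(CC_matrix R ** ?S) $ (i, y) $ (a, b) = (?S ** CC_matrix R) $ (i, y) $ (a, b)" for i y a b
  proof -
    have "(CC_matrix R ** ?S) $ (i, y) $ (a, b)
        = (\<Sum>p\<in>UNIV. ?C $ i $ p * (\<Sum>x\<in>UNIV. ?C $ y $ x * ?S $ (p, x) $ (a, b)))"
      by (simp add: matrix_mult_nth sum_UNIV_prod CC_matrix_nth sum_distrib_left mult_ac)
    also have "\<dots> = (\<Sum>k\<in>UNIV. (\<Sum>p\<in>UNIV. ?C $ i $ p * ?P $ (y, p) $ (b, k)) * ?C $ k $ a)"
      unfolding e2 by (simp add: sum_distrib_left sum_distrib_right mult_ac, rule sum.swap)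
    also have "\<dots> = (\<Sum>k\<in>UNIV. (\<Sum>z\<in>UNIV. ?S $ (i, y) $ (k, z) * ?C $ z $ b) * ?C $ k $ a)"
      unfolding e1 ..
    also have "\<dots> = (?S ** CC_matrix R) $ (i, y) $ (a, b)"
      by (simp add: matrix_mult_nth sum_UNIV_prod CC_matrix_nth sum_distrib_left mult_ac)
    finally show ?thesis .
  qed
  then have S: "CC_matrix R ** ?S = ?S ** CC_matrix R" by (simp add: vec_eq_iff split_paired_all)
  have "R ** CC_matrix R = R ** (CC_matrix R ** ?S) ** R"
    by (simp add: hecke_inverse(2)[OF H] flip: matrix_mul_assoc)
  also have "\<dots> = (R ** ?S) ** CC_matrix R ** R"
    by (simp add: S matrix_mul_assoc)
  finally show ?thesis by (simp add: hecke_inverse(1)[OF H])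
qed

section \<open>The derivatives on the free algebra\<close>

definition left_mult :: "'a::ring_1 \<Rightarrow> 'a endo" where
  "left_mult a = Endo ((*) a)"

lemma app_left_mult: "app (left_mult a) x = a * x"
  by (simp add: left_mult_def app_Endo distrib_left)

lemma ring_morphism_left_mult: "ring_morphism left_mult"
  by unfold_locales (auto intro!: endo_eqI simp: app_left_mult app_plus app_times distrib_right mult.assoc)

definition scalar_op :: "complex \<Rightarrow> 'x free_alg endo" where
  "scalar_op c = left_mult (scalar c)"

lemma app_scalar_op: "app (scalar_op c) p = scalar c * p"
  by (simp add: scalar_op_def app_left_mult)

lemma ring_morphism_scalar_op: "ring_morphism (scalar_op :: complex \<Rightarrow> 'x free_alg endo)"
  unfolding ring_morphism_def scalar_op_def
  using ring_morphism_scalar[where 'x = 'x] ring_morphism_left_mult[where 'a = "'x free_alg"]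
  by (simp only: ring_morphism_def simp_thms)

lemma scalar_linear_scalar_op:
  "scalar_linear scalar_op f \<longleftrightarrow> (\<forall>c p. app f (scalar c * p) = scalar c * app f p)"
proof -
  have "g = k \<longleftrightarrow> (\<forall>p. app g p = app k p)" for g k :: "'a free_alg endo"
    by (auto intro: endo_eqI)
  then show ?thesis by (simp only: scalar_linear_def app_times app_scalar_op eq_commute)
qed

lemma scalar_linear_left_mult: "scalar_linear scalar_op (left_mult a)"
  by (simp add: scalar_linear_scalar_op app_left_mult) (metis mult.assoc scalar_commute)

lemma endo_eq_on_words:
  assumes "scalar_linear scalar_op f" "scalar_linear scalar_op g"
    and "\<And>w. app f (Poly_Mapping.single w 1) = app g (Poly_Mapping.single w 1)"
  shows "f = g"
proof (rule endo_eqI)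
  fix p
  show "app f p = app g p"
  proof (induct p rule: poly_mapping_additive_induct)
    case (1 w c)
    have "Poly_Mapping.single w c = scalar c * Poly_Mapping.single w 1"
      by (simp add: scalar_single)
    then show ?case using assms by (simp add: scalar_linear_scalar_op)
  qed (simp add: app_add)
qed

definition matrix_app :: "'b::{ab_group_add,zero_neq_one} endo^'n^'m \<Rightarrow> 'b \<Rightarrow> 'b^'n^'m" where
  "matrix_app X v = (\<chi> r c. app (X $ r $ c) v)"

lemma matrix_app_nth: "matrix_app X v $ r $ c = app (X $ r $ c) v"
  by (simp add: matrix_app_def)

lemma matrix_app_add: "matrix_app (A + B) v = matrix_app A v + matrix_app B v"
  by (simp add: vec_eq_iff matrix_app_nth app_plus)

lemma matrix_app_diff: "matrix_app (A - B) v = matrix_app A v - matrix_app B v"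
  by (simp add: vec_eq_iff matrix_app_nth app_minus)

lemma matrix_app_1: "matrix_app (mat 1) v = mat v"
  by (simp add: vec_eq_iff matrix_app_nth mat_nth)

lemma matrix_app_on1: "matrix_app (on1 X) v = on1 (matrix_app X v)"
  by (simp add: vec_eq_iff split_paired_all matrix_app_nth on1_nth)

lemma matrix_app_left: "matrix_app (map_matrix left_mult X ** A) v = X ** matrix_app A v"
  by (simp add: vec_eq_iff matrix_app_nth matrix_mult_nth app_sum_endo app_times app_left_mult)

lemma map_matrix_scalar_op: "map_matrix scalar_op X = map_matrix left_mult (emb X)"
  by (simp add: vec_eq_iff scalar_op_def emb_def)

lemma mat_scalar_op: "mat (scalar_op c) = map_matrix left_mult (mat (scalar c))"
  by (simp add: ring_morphism.map_matrix_mat[OF ring_morphism_left_mult] scalar_op_def)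

text \<open>The complex entries act first; linearity of the operators lets them pass, and as central
  elements of the free algebra they may be written on the right of the values.\<close>

lemma matrix_app_right:
  assumes "entries_linear scalar_op A"
  shows "matrix_app (A ** map_matrix scalar_op X) v = matrix_app A v ** emb X"
proof -
  have "app (A $ r $ k) (scalar c * p) = app (A $ r $ k) p * scalar c" for r k c p
    using assms unfolding entries_linear_def scalar_linear_scalar_op by (metis scalar_commute)
  then show ?thesis
    by (simp add: vec_eq_iff matrix_app_nth matrix_mult_nth app_sum_endo app_times app_scalar_op emb_def)
qed

definition gen_matrix :: "('n::finite \<times> 'n) free_alg^'n^'n" where
  "gen_matrix = (\<chi> i j. gen (i, j))"

definition m_ops :: "('n::finite \<times> 'n) free_alg endo^'n^'n" where
  "m_ops = map_matrix left_mult gen_matrix"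

lemma m_ops_nth: "m_ops $ i $ j = left_mult (gen (i, j))"
  by (simp add: m_ops_def gen_matrix_def)

lemma entries_linear_m_ops: "entries_linear scalar_op m_ops"
  by (simp add: entries_linear_def m_ops_nth scalar_linear_left_mult)

section \<open>Construction of the derivatives by recursion on words\<close>

locale skew_hecke =
  fixes R :: "complex^('n::finite \<times> 'n)^('n \<times> 'n)" and q h :: complex
  assumes hecke: "hecke_symmetry q R" and skew: "skew_invertible R"
begin

text \<open>The permutation relations, multiplied by \<open>R\<^sup>-\<^sup>1\<close> on the right, read
  \<open>D\<^sub>1 R M\<^sub>1 = R M\<^sub>1 R\<^sup>-\<^sup>1 D\<^sub>1 R\<^sup>-\<^sup>1 + 1 + h D\<^sub>1\<close>. This is their right-hand side, applied to \<open>v\<close>,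
  where \<open>E\<close> is the matrix of the values of the derivatives at \<open>v\<close>.\<close>

definition perm_rhs :: "'x free_alg^'n^'n \<Rightarrow> 'x free_alg^'n^'n \<Rightarrow> 'x free_alg \<Rightarrow> 'x free_alg^('n \<times> 'n)^('n \<times> 'n)" where
  "perm_rhs M E v = emb R ** on1 M ** emb (matrix_inv R) ** on1 E ** emb (matrix_inv R)
     + mat v + mat (scalar h) ** on1 E"

text \<open>For the unknowns \<open>X(i, a, b, k)\<close>, the values of the derivative
  \<open>(i, a)\<close> at \<open>m_b^k v\<close>, the permutation relations read
  \<open>\<Sum> R(a,j)(b,l) X(i,a,b,k) = S(i,j)(k,l)\<close>, summed over \<open>a\<close> and
  \<open>b\<close>. Contraction with \<Psi> over \<open>j\<close> and \<open>l\<close> isolates one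
  unknown.\<close>

definition skew_solve :: "'x free_alg^('n \<times> 'n)^('n \<times> 'n) \<Rightarrow> 'n \<Rightarrow> 'n \<Rightarrow> 'x free_alg^'n^'n" where
  "skew_solve S b k = (\<chi> i a. \<Sum>j\<in>UNIV. \<Sum>l\<in>UNIV. scalar (skew_inverse R $ (l, b) $ (j, a)) * S $ (i, j) $ (k, l))"

text \<open>The empty word stands for 1, which every derivative kills because the counit does; a
  word \<open>x # w\<close> takes the value that the permutation relation forces on the product of
  \<open>x\<close> with \<open>w\<close>.\<close>

primrec deriv_word :: "('n \<times> 'n) list \<Rightarrow> ('n \<times> 'n) free_alg^'n^'n" where
  "deriv_word [] = 0"
| "deriv_word (x # w) =
     skew_solve (perm_rhs gen_matrix (deriv_word w) (Poly_Mapping.single w 1)) (fst x) (snd x)"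

definition deriv :: "'n \<Rightarrow> 'n \<Rightarrow> ('n \<times> 'n) free_alg endo" where
  "deriv i a = Endo (extend (\<lambda>w c. scalar c * deriv_word w $ i $ a))"

definition deriv_ops :: "('n \<times> 'n) free_alg endo^'n^'n" where
  "deriv_ops = (\<chi> i a. deriv i a)"

lemma app_deriv_single: "app (deriv i a) (Poly_Mapping.single w c) = scalar c * deriv_word w $ i $ a"
  and app_deriv_scalar: "app (deriv i a) (scalar c * p) = scalar c * app (deriv i a) p"
proof -
  interpret s: ring_morphism "scalar :: complex \<Rightarrow> ('n \<times> 'n) free_alg" by (rule ring_morphism_scalar)
  have *: "app (deriv i a) = extend (\<lambda>w c. scalar c * deriv_word w $ i $ a)"
    unfolding deriv_def
    by (rule app_Endo, rule extend_add) (simp_all add: s.zero s.add distrib_right)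
  show 1: "app (deriv i a) (Poly_Mapping.single w c) = scalar c * deriv_word w $ i $ a" for w c
    by (simp add: * extend_single s.zero)
  show "app (deriv i a) (scalar c * p) = scalar c * app (deriv i a) p"
    by (induct p rule: poly_mapping_additive_induct)
      (simp_all add: scalar_single 1 s.mult mult.assoc distrib_left app_add)
qed

lemma entries_linear_deriv_ops: "entries_linear scalar_op deriv_ops"
  by (simp add: entries_linear_def deriv_ops_def scalar_linear_scalar_op app_deriv_scalar)

lemma matrix_app_deriv_ops: "matrix_app deriv_ops (Poly_Mapping.single w 1) = deriv_word w"
  by (simp add: vec_eq_iff matrix_app_nth deriv_ops_def app_deriv_single
      ring_morphism.one[OF ring_morphism_scalar])

text \<open>Existence of the solution, by the second identity for \<Psi>. Uniqueness is
  \<open>skew_cancel\<close>, which rests on the first.\<close>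

lemma skew_solve_inverse:
  fixes S :: "'x free_alg^('n \<times> 'n)^('n \<times> 'n)"
  shows "(\<Sum>a\<in>UNIV. \<Sum>b\<in>UNIV. scalar (R $ (a, j) $ (b, l)) * skew_solve S b k $ i $ a) = S $ (i, j) $ (k, l)"
proof -
  interpret s: ring_morphism "scalar :: complex \<Rightarrow> 'x free_alg" by (rule ring_morphism_scalar)
  have "(\<Sum>a\<in>UNIV. \<Sum>b\<in>UNIV. scalar (R $ (a, j) $ (b, l)) * skew_solve S b k $ i $ a)
    = (\<Sum>j'\<in>UNIV. \<Sum>l'\<in>UNIV. \<Sum>b\<in>UNIV. \<Sum>a\<in>UNIV.
         scalar (skew_inverse R $ (l', b) $ (j', a) * R $ (a, j) $ (b, l)) * S $ (i, j') $ (k, l'))"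
    by (subst sum_swap22[symmetric], subst sum.swap)
      (simp add: skew_solve_def sum_distrib_left mult.assoc[symmetric] s.mult[symmetric] mult.commute)
  also have "\<dots> = (\<Sum>j'\<in>UNIV. \<Sum>l'\<in>UNIV.
         scalar (\<Sum>b\<in>UNIV. \<Sum>a\<in>UNIV. skew_inverse R $ (l', b) $ (j', a) * R $ (a, j) $ (b, l)) * S $ (i, j') $ (k, l'))"
    by (simp add: s.sum sum_distrib_right)
  also have "\<dots> = (\<Sum>j'\<in>UNIV. \<Sum>l'\<in>UNIV. if l' = l then if j' = j then S $ (i, j') $ (k, l') else 0 else 0)"
    unfolding skew_inverse_nth(2)[OF is_skew_inverse_skew_inverse[OF skew]]
    by (intro sum.cong refl) (auto simp: s.zero s.one)
  also have "\<dots> = S $ (i, j) $ (k, l)"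
    by (simp add: sum_if_UNIV)
  finally show ?thesis .
qed

lemma perm_lhs_app:
  "matrix_app (on1 deriv_ops ** map_matrix scalar_op R ** on1 m_ops) v $ (i, j) $ (k, l)
      = (\<Sum>a\<in>UNIV. \<Sum>b\<in>UNIV. scalar (R $ (a, j) $ (b, l)) * app (deriv i a) (gen (b, k) * v))"
  by (subst sum.swap) (simp add: matrix_app_nth matrix_mult_nth sum_UNIV_prod on1_nth if_mult_zero sum_if_const sum_if_UNIV
        app_sum_endo app_times app_scalar_op deriv_ops_def m_ops_nth app_left_mult app_deriv_scalar
        sum_distrib_right)

lemma perm_rhs_app:
  defines "A \<equiv> map_matrix scalar_op R" and "B \<equiv> map_matrix scalar_op (matrix_inv R)"
  shows "matrix_app (A ** on1 m_ops ** B ** on1 deriv_ops ** B + mat 1 + mat (scalar_op h) ** on1 deriv_ops) v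
    = perm_rhs gen_matrix (matrix_app deriv_ops v) v"
proof -
  note el = entries_linear_closed[OF ring_morphism_scalar_op]
  have "matrix_app (A ** on1 m_ops ** B ** on1 deriv_ops ** B) v
    = matrix_app (map_matrix left_mult (emb R ** on1 gen_matrix ** emb (matrix_inv R)) ** on1 deriv_ops) v ** emb (matrix_inv R)"
    unfolding B_def
    by (subst matrix_app_right)
      (simp_all add: A_def el entries_linear_deriv_ops entries_linear_m_ops,
        simp add: m_ops_def map_matrix_scalar_op ring_morphism.map_matrix_simps[OF ring_morphism_left_mult])
  then show ?thesis
    by (simp add: matrix_app_add perm_rhs_def matrix_app_left mat_scalar_op matrix_app_1 matrix_app_on1)
qed

text \<open>Both sides are linear, hence determined on words \<open>w\<close>; there the left-hand
  side involves the values at the words \<open>x # w\<close>, and the equation is the one solved in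
  the recursion.\<close>

lemma deriv_ops_perm:
  defines "A \<equiv> map_matrix scalar_op R" and "B \<equiv> map_matrix scalar_op (matrix_inv R)"
  shows "on1 deriv_ops ** A ** on1 m_ops = A ** on1 m_ops ** B ** on1 deriv_ops ** B
     + mat 1 + mat (scalar_op h) ** on1 deriv_ops" (is "?L = ?R")
proof -
  note el = entries_linear_closed[OF ring_morphism_scalar_op]
  have lin: "entries_linear scalar_op ?L" "entries_linear scalar_op ?R"
    by (simp_all add: A_def B_def el entries_linear_deriv_ops entries_linear_m_ops)
  have "?L $ r $ c = ?R $ r $ c" for r c
  proof (rule endo_eq_on_words)
    fix w :: "('n \<times> 'n) list"
    obtain i j k l where rc: "r = (i, j)" "c = (k, l)" by (metis surj_pair)
    have "matrix_app ?L (Poly_Mapping.single w 1) $ (i, j) $ (k, l)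
      = perm_rhs gen_matrix (deriv_word w) (Poly_Mapping.single w 1) $ (i, j) $ (k, l)"
      unfolding A_def perm_lhs_app gen_single app_deriv_single
      by (simp add: ring_morphism.one[OF ring_morphism_scalar] skew_solve_inverse)
    also have "\<dots> = matrix_app ?R (Poly_Mapping.single w 1) $ (i, j) $ (k, l)"
      unfolding A_def B_def perm_rhs_app matrix_app_deriv_ops ..
    finally show "app (?L $ r $ c) (Poly_Mapping.single w 1) = app (?R $ r $ c) (Poly_Mapping.single w 1)"
      by (simp add: matrix_app_nth rc)
  qed (use lin in \<open>simp_all only: entries_linear_def\<close>)
  then show ?thesis by (simp add: vec_eq_iff)
qed

lemma deriv_ops_perm_app:
  "(\<Sum>a\<in>UNIV. \<Sum>b\<in>UNIV. scalar (R $ (a, j) $ (b, l)) * app (deriv i a) (gen (b, k) * v))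
     = perm_rhs gen_matrix (matrix_app deriv_ops v) v $ (i, j) $ (k, l)"
  using perm_lhs_app[of v i j k l] unfolding deriv_ops_perm perm_rhs_app by simp

lemma perm_matrix_deriv_ops: "perm_matrix scalar_op R h m_ops deriv_ops = 0"
proof -
  interpret s: ring_morphism "scalar_op :: complex \<Rightarrow> ('n \<times> 'n) free_alg endo" by (rule ring_morphism_scalar_op)
  let ?A = "map_matrix scalar_op R :: ('n \<times> 'n) free_alg endo^('n \<times> 'n)^('n \<times> 'n)"
    and ?B = "map_matrix scalar_op (matrix_inv R) :: ('n \<times> 'n) free_alg endo^('n \<times> 'n)^('n \<times> 'n)"
  let ?e = "matrix_endo :: ('n \<times> 'n) free_alg endo^('n \<times> 'n)^('n \<times> 'n) \<Rightarrow> _"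
  have "?B ** ?A = map_matrix scalar_op (matrix_inv R ** R)" by (simp only: s.map_matrix_mult)
  also have "\<dots> = mat 1" by (simp only: hecke_inverse(2)[OF hecke] s.map_matrix_mat s.one)
  finally have BA: "?e ?B * ?e ?A = 1" by (simp flip: matrix_endo_simps)
  have "?e (on1 deriv_ops) * ?e ?A * ?e (on1 m_ops) = ?e ?A * ?e (on1 m_ops) * ?e ?B * ?e (on1 deriv_ops) * ?e ?B
     + 1 + ?e (mat (scalar_op h)) * ?e (on1 deriv_ops)"
    using arg_cong[OF deriv_ops_perm, of ?e] by (simp only: matrix_endo_simps)
  then have "?e (on1 deriv_ops) * ?e ?A * ?e (on1 m_ops) * ?e ?A
    = ?e ?A * ?e (on1 m_ops) * ?e ?B * ?e (on1 deriv_ops) * (?e ?B * ?e ?A)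
     + ?e ?A + ?e (mat (scalar_op h)) * ?e (on1 deriv_ops) * ?e ?A"
    by (simp only: distrib_right mult.assoc mult_1_left)
  then have "?e (perm_matrix scalar_op R h m_ops deriv_ops) = 0"
    unfolding perm_matrix_def Let_def matrix_endo_simps BA by simp
  then show ?thesis by (simp only: matrix_endo_inject flip: matrix_endo_0)
qed

end

section \<open>Presented algebras\<close>

lemma free_ring_simps [simp]:
  "carrier free_ring = UNIV" "monoid.mult free_ring = (*)" "one free_ring = 1"
  "zero free_ring = 0" "add free_ring = (+)"
  by (simp_all add: free_ring_def)

lemma ring_free_ring: "Ring.ring (free_ring :: 'x free_alg ring)"
proof (rule ringI)
  show "abelian_group (free_ring :: 'x free_alg ring)"
    by (rule abelian_groupI) (auto simp: add.assoc add.commute add.left_commute intro: exI[of _ "- x" for x] add.left_inverse)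
  show "Group.monoid (free_ring :: 'x free_alg ring)"
    by (rule monoidI) (auto simp: mult.assoc)
qed (auto simp: distrib_left distrib_right)

text \<open>The two-sided ideal as finite sums of terms \<open>x * s * y\<close>; signs and complex
  coefficients are absorbed into \<open>x\<close>. It supplies the induction principle for
  \<open>rel_ideal\<close>.\<close>

inductive_set relator_span :: "'x free_alg set \<Rightarrow> 'x free_alg set" for S where
  zero: "0 \<in> relator_span S"
| step: "p \<in> relator_span S \<Longrightarrow> s \<in> S \<Longrightarrow> p + x * s * y \<in> relator_span S"

lemma relator_span_add: "p \<in> relator_span S \<Longrightarrow> r \<in> relator_span S \<Longrightarrow> r + p \<in> relator_span S"
  by (induct p rule: relator_span.induct) (auto simp: add.assoc[symmetric] intro: relator_span.intros)

lemma relator_span_mult: "p \<in> relator_span S \<Longrightarrow> x * p * y \<in> relator_span S"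
proof (induct p rule: relator_span.induct)
  case (step p s u v)
  have "x * (p + u * s * v) * y = x * p * y + (x * u) * s * (v * y)"
    by (simp add: distrib_left distrib_right mult.assoc)
  with step show ?case by (simp add: relator_span.step)
qed (simp add: relator_span.zero)

lemma ideal_relator_span: "ideal (relator_span S) free_ring"
proof (rule idealI[OF ring_free_ring])
  have m: "- p \<in> relator_span S" if "p \<in> relator_span S" for p
    using relator_span_mult[OF that, of "- 1" 1] by simp
  show "subgroup (relator_span S) (add_monoid free_ring)"
  proof (rule group.subgroupI)
    show "group (add_monoid (free_ring :: 'a free_alg ring))"
      using ring_free_ring Ring.ring.is_abelian_group abelian_group.a_group by blast
    show "inv\<^bsub>add_monoid free_ring\<^esub> a \<in> relator_span S" if "a \<in> relator_span S" for a
    proof -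
      have "inv\<^bsub>add_monoid free_ring\<^esub> a = - a"
        using \<open>group (add_monoid (free_ring :: 'a free_alg ring))\<close>
        by (intro group.inv_equality) auto
      then show ?thesis using m[OF that] by simp
    qed
  qed (auto intro: relator_span.zero relator_span_add)
  show "x \<otimes>\<^bsub>free_ring\<^esub> a \<in> relator_span S" if "a \<in> relator_span S" for a x
    using relator_span_mult[OF that, of x 1] by simp
  show "a \<otimes>\<^bsub>free_ring\<^esub> x \<in> relator_span S" if "a \<in> relator_span S" for a x
    using relator_span_mult[OF that, of 1 x] by simp
qed

lemma rel_ideal_eq: "rel_ideal S = relator_span S"
proof
  have "S \<subseteq> relator_span S"
    using relator_span.step[OF relator_span.zero, of _ S 1 1] by auto
  then show "rel_ideal S \<subseteq> relator_span S"
    unfolding rel_ideal_def genideal_def using ideal_relator_span by blast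
  have "p \<in> I" if "p \<in> relator_span S" "ideal I free_ring" "S \<subseteq> I" for p I
  proof -
    interpret I: ideal I "free_ring :: 'a free_alg ring" by (rule that(2))
    have I: "0 \<in> I" "\<And>a b. a \<in> I \<Longrightarrow> b \<in> I \<Longrightarrow> a + b \<in> I"
      using additive_subgroup.zero_closed[OF I.is_additive_subgroup]
        additive_subgroup.a_closed[OF I.is_additive_subgroup] by auto
    from that(1) show ?thesis
      by induct (use I I.I_l_closed I.I_r_closed that(3) in auto)
  qed
  then show "relator_span S \<subseteq> rel_ideal S"
    unfolding rel_ideal_def genideal_def by blast
qed

lemma ideal_rel_ideal: "ideal (rel_ideal S) free_ring"
  by (simp add: rel_ideal_eq ideal_relator_span)

lemma rel_ideal_closed:
  shows rel_ideal_0: "0 \<in> rel_ideal S"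
    and rel_ideal_add: "p \<in> rel_ideal S \<Longrightarrow> r \<in> rel_ideal S \<Longrightarrow> p + r \<in> rel_ideal S"
    and rel_ideal_left: "p \<in> rel_ideal S \<Longrightarrow> x * p \<in> rel_ideal S"
    and rel_ideal_right: "p \<in> rel_ideal S \<Longrightarrow> p * x \<in> rel_ideal S"
    and rel_ideal_relator: "s \<in> S \<Longrightarrow> s \<in> rel_ideal S"
  unfolding rel_ideal_eq
  using relator_span_mult[of p S x 1] relator_span_mult[of p S 1 x]
    relator_span.step[OF relator_span.zero, of s S 1 1]
  by (simp_all add: relator_span.zero relator_span_add)

lemma rel_ideal_uminus: "p \<in> rel_ideal S \<Longrightarrow> - p \<in> rel_ideal S"
  using rel_ideal_left[of p S "- 1"] by simp

lemma rel_ideal_diff: "p \<in> rel_ideal S \<Longrightarrow> r \<in> rel_ideal S \<Longrightarrow> p - r \<in> rel_ideal S"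
  using rel_ideal_add[of p S "- r"] by (simp add: rel_ideal_uminus)

lemma cls_eq: "cls S p = {x. x - p \<in> rel_ideal S}"
proof -
  have "cls S p = (\<Union>h\<in>rel_ideal S. {h + p})"
    by (simp add: cls_def a_r_coset_def r_coset_def)
  also have "\<dots> = {x. x - p \<in> rel_ideal S}"
    by (auto intro: bexI[of _ "x - p" for x])
  finally show ?thesis .
qed

lemma cls_eq_iff: "cls S p = cls S r \<longleftrightarrow> p - r \<in> rel_ideal S"
proof
  assume "cls S p = cls S r"
  moreover have "p \<in> cls S p" by (simp add: cls_eq rel_ideal_0)
  ultimately show "p - r \<in> rel_ideal S" by (simp add: cls_eq)
next
  assume a: "p - r \<in> rel_ideal S"
  have "x - p \<in> rel_ideal S \<longleftrightarrow> x - r \<in> rel_ideal S" for x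
    using rel_ideal_add[OF _ a, of "x - p"] rel_ideal_diff[OF _ a, of "x - r"] by auto
  then show "cls S p = cls S r" by (simp add: cls_eq)
qed

lemma presented_algebra_simps:
  "carrier (presented_algebra S) = range (cls S)"
  "cls S p \<otimes>\<^bsub>presented_algebra S\<^esub> cls S r = cls S (p * r)"
  "cls S p \<oplus>\<^bsub>presented_algebra S\<^esub> cls S r = cls S (p + r)"
  "c \<odot>\<^bsub>presented_algebra S\<^esub> cls S p = cls S (scalar c * p)"
proof -
  interpret I: ideal "rel_ideal S" "free_ring :: 'a free_alg ring" by (rule ideal_rel_ideal)
  have mult: "rcoset_mult free_ring (rel_ideal S) (cls S p) (cls S r) = cls S (p * r)" for p r
    unfolding cls_def by (subst I.rcoset_mult_add) simp_all
  show "carrier (presented_algebra S) = range (cls S)"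
    by (auto simp: presented_algebra_def FactRing_def Let_def A_RCOSETS_def' cls_def)
  show "cls S p \<otimes>\<^bsub>presented_algebra S\<^esub> cls S r = cls S (p * r)"
    by (simp add: presented_algebra_def FactRing_def Let_def mult)
  show "c \<odot>\<^bsub>presented_algebra S\<^esub> cls S p = cls S (scalar c * p)"
    by (simp add: presented_algebra_def FactRing_def Let_def mult)
  show "cls S p \<oplus>\<^bsub>presented_algebra S\<^esub> cls S r = cls S (p + r)"
    unfolding cls_def using I.a_rcos_sum[of p r]
    by (simp add: presented_algebra_def FactRing_def Let_def)
qed

lemma module_scalar: "Modules.module (\<lambda>c p :: 'x free_alg. scalar c * p)"
proof -
  interpret s: ring_morphism "scalar :: complex \<Rightarrow> 'x free_alg" by (rule ring_morphism_scalar)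
  show ?thesis
    by unfold_locales (simp_all add: s.add s.mult s.one distrib_left distrib_right mult.assoc)
qed

abbreviation linear_subspace :: "'x free_alg set \<Rightarrow> bool" where
  "linear_subspace J \<equiv> Modules.module.subspace (\<lambda>c p. scalar c * p) J"

lemma linear_subspace_iff:
  "linear_subspace J \<longleftrightarrow> 0 \<in> J \<and> (\<forall>p\<in>J. \<forall>r\<in>J. p + r \<in> J) \<and> (\<forall>c. \<forall>p\<in>J. scalar c * p \<in> J)"
  by (simp add: Modules.module.subspace_def[OF module_scalar])

lemma linear_subspace_sum: "linear_subspace J \<Longrightarrow> (\<And>i. i \<in> A \<Longrightarrow> f i \<in> J) \<Longrightarrow> sum f A \<in> J"
  by (rule Modules.module.subspace_sum[OF module_scalar])

lemma linear_subspace_rel_ideal: "linear_subspace (rel_ideal S)"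
  by (simp add: linear_subspace_iff rel_ideal_0 rel_ideal_add rel_ideal_left)

lemma linear_subspace_zero: "linear_subspace {0}"
  by (simp add: linear_subspace_iff)

section \<open>Compatibility with the relations\<close>

text \<open>Used for ideals as well as for the set of normally ordered elements, which is only a
  linear subspace.\<close>

definition entries_in :: "'a set \<Rightarrow> 'a^'n^'m \<Rightarrow> bool" where
  "entries_in J X \<longleftrightarrow> (\<forall>r c. X $ r $ c \<in> J)"

lemma entries_in_left:
  assumes "linear_subspace J" "entries_in J X" "\<And>r k x. x \<in> J \<Longrightarrow> A $ r $ k * x \<in> J"
  shows "entries_in J (A ** X)"
  using assms by (simp add: entries_in_def matrix_mult_nth linear_subspace_sum)

lemma entries_in_emb_left: "linear_subspace J \<Longrightarrow> entries_in J X \<Longrightarrow> entries_in J (emb A ** X)"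
  by (rule entries_in_left) (simp_all add: linear_subspace_iff emb_def)

lemma entries_in_emb_right: "linear_subspace J \<Longrightarrow> entries_in J X \<Longrightarrow> entries_in J (X ** emb A)"
  by (simp add: entries_in_def matrix_mult_nth linear_subspace_sum emb_def scalar_commute[symmetric])
    (simp add: linear_subspace_sum linear_subspace_iff)

lemma entries_in_on1: "0 \<in> J \<Longrightarrow> entries_in J X \<Longrightarrow> entries_in J (on1 X)"
  by (simp add: entries_in_def split_paired_all on1_nth)

lemma entries_in_mat: "0 \<in> J \<Longrightarrow> v \<in> J \<Longrightarrow> entries_in J (mat v)"
  by (simp add: entries_in_def mat_nth)

lemma entries_in_add: "linear_subspace J \<Longrightarrow> entries_in J X \<Longrightarrow> entries_in J Y \<Longrightarrow> entries_in J (X + Y)"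
  by (simp add: entries_in_def linear_subspace_iff)

lemma linear_subspace_0: "linear_subspace J \<Longrightarrow> 0 \<in> J"
  by (simp add: linear_subspace_iff)

lemma mat_scalar_emb: "mat (scalar c) = emb (mat c)"
  by (simp add: emb_def ring_morphism.map_matrix_mat[OF ring_morphism_scalar])

lemma matrix_app_mult_zero: "matrix_app Y v = 0 \<Longrightarrow> matrix_app (X ** Y) v = 0"
  by (simp add: vec_eq_iff matrix_app_nth matrix_mult_nth app_sum_endo app_times)

lemma matrix_app_leg12: "matrix_app (leg12 X) v = leg12 (matrix_app X v)"
  by (simp add: vec_eq_iff split_paired_all matrix_app_nth leg12_nth)

lemma leg_map_scalar_op:
  "leg12 (map_matrix scalar_op A) = map_matrix scalar_op (leg12 A)"
  "leg23 (map_matrix scalar_op A) = map_matrix scalar_op (leg23 A)"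
  by (simp_all add: ring_morphism.map_matrix_simps[OF ring_morphism_scalar_op])

lemma map_matrix_scalar_op_add:
  "map_matrix scalar_op A + map_matrix scalar_op B = map_matrix scalar_op (A + B)"
  by (simp add: ring_morphism.map_matrix_add[OF ring_morphism_scalar_op])

context skew_hecke
begin

text \<open>In \<open>perm_rhs\<close> the entries of \<open>M\<close> stand to the left of those of
  \<open>E\<close>, and all other factors are complex. So closure of \<open>J\<close> under left
  multiplication by the \<open>M\<close> entries suffices, and normally ordered elements are
  covered.\<close>

lemma perm_rhs_in:
  assumes J: "linear_subspace J" and M: "\<And>i j x. x \<in> J \<Longrightarrow> M $ i $ j * x \<in> J"
    and v: "v \<in> J" and E: "entries_in J E"
  shows "entries_in J (perm_rhs M E v)"
proof -
  have "on1 M $ r $ k * x \<in> J" if "x \<in> J" for r k x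
    using M[OF that] linear_subspace_0[OF J] by (cases r; cases k) (simp add: on1_nth)
  then show ?thesis
    unfolding perm_rhs_def mat_scalar_emb
    by (auto simp: matrix_mul_assoc[symmetric] linear_subspace_0[OF J] v E J
        intro!: entries_in_add[OF J] entries_in_emb_left[OF J] entries_in_emb_right[OF J]
          entries_in_on1 entries_in_mat entries_in_left[OF J])
qed

lemma skew_solve_in:
  "linear_subspace J \<Longrightarrow> entries_in J S \<Longrightarrow> entries_in J (skew_solve S b k)"
  unfolding entries_in_def skew_solve_def
  by (simp add: linear_subspace_sum linear_subspace_iff)

lemma skew_cancel:
  fixes G :: "'n \<Rightarrow> 'n \<Rightarrow> 'x free_alg"
  assumes "linear_subspace J"
    and "\<And>k e. (\<Sum>b\<in>UNIV. \<Sum>x\<in>UNIV. scalar (R $ (b, k) $ (x, e)) * G b x) \<in> J"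
  shows "G b x \<in> J"
  by (rule skew_cancel_first[OF is_skew_inverse_skew_inverse[OF skew] module_scalar assms])

text \<open>The values at \<open>gen (b, k) * v\<close> solve a linear system with complex
  coefficients whose right-hand side lies in \<open>J\<close>.\<close>

lemma deriv_gen_in:
  assumes J: "linear_subspace J" and M: "\<And>i j x. x \<in> J \<Longrightarrow> gen (i, j) * x \<in> J"
    and v: "v \<in> J" and E: "\<And>i a. app (deriv i a) v \<in> J"
  shows "app (deriv i a) (gen (b, k) * v) \<in> J"
proof (rule skew_cancel[OF J, where b = a and x = b and G = "\<lambda>a b. app (deriv i a) (gen (b, k) * v)"])
  fix j l
  have "entries_in J (matrix_app deriv_ops v)"
    by (simp add: entries_in_def matrix_app_nth deriv_ops_def E)
  then have "entries_in J (perm_rhs gen_matrix (matrix_app deriv_ops v) v)"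
    by (intro perm_rhs_in J v) (simp_all add: gen_matrix_def M)
  then show "(\<Sum>a\<in>UNIV. \<Sum>b\<in>UNIV. scalar (R $ (a, j) $ (b, l)) * app (deriv i a) (gen (b, k) * v)) \<in> J"
    unfolding deriv_ops_perm_app by (simp add: entries_in_def)
qed

text \<open>Induction on the word acted on. At the empty word each product ends, up to a complex
  matrix, in \<open>D_1\<close>, which vanishes there. The step passes one generator by means of the
  first mixed identity.\<close>

lemma d_matrix_deriv_ops: "d_matrix scalar_op R deriv_ops = 0"
proof -
  let ?Z = "d_matrix scalar_op R deriv_ops"
  note rm = ring_morphism_scalar_op
  note el = entries_linear_closed[OF rm]
  have lin: "entries_linear scalar_op ?Z"
    by (simp add: d_matrix_def Let_def el entries_linear_deriv_ops)
  have Z: "matrix_app ?Z (Poly_Mapping.single w 1) = 0" for w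
  proof (induct w)
    case Nil
    have D: "matrix_app (on1 deriv_ops) (Poly_Mapping.single [] 1) = 0"
      by (simp add: matrix_app_on1 matrix_app_deriv_ops vec_eq_iff split_paired_all on1_nth)
    have "matrix_app (X ** on1 deriv_ops ** map_matrix scalar_op B) (Poly_Mapping.single [] 1) = 0"
      if "entries_linear scalar_op X" for X :: "('n \<times> 'n) free_alg endo^('n \<times> 'n)^('n \<times> 'n)"
        and B :: "complex^('n \<times> 'n)^('n \<times> 'n)"
      using that by (simp add: matrix_app_right el entries_linear_deriv_ops matrix_app_mult_zero[OF D])
    then show ?case
      unfolding d_matrix_def Let_def matrix_app_diff
      by (simp add: matrix_app_mult_zero[OF D] el entries_linear_deriv_ops)
  next
    case (Cons y w)
    obtain c f where y: "y = (c, f)" by (cases y)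
    let ?v = "Poly_Mapping.single w 1 :: ('n \<times> 'n) free_alg"
    let ?A = "map_matrix scalar_op R :: ('n \<times> 'n) free_alg endo^('n \<times> 'n)^('n \<times> 'n)"
      and ?B = "map_matrix scalar_op (matrix_inv R) :: ('n \<times> 'n) free_alg endo^('n \<times> 'n)^('n \<times> 'n)"
    let ?L = "leg12 ?Z ** (leg23 ?A ** leg12 ?A ** leg12 (on1 m_ops))"
    have Z0: "matrix_app (leg12 ?Z) ?v = 0"
      using Cons by (simp add: matrix_app_leg12 leg12_linear)
    \<comment> \<open>In each summand on the right of the mixed identity the relator matrix acts on
      \<open>?v\<close> after complex matrices only, so the induction hypothesis kills it.\<close>
    have "matrix_app ?L ?v = 0"
      unfolding mixed_matrix_identities(1)[OF rm hecke entries_linear_m_ops entries_linear_deriv_ops perm_matrix_deriv_ops]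
      unfolding matrix_app_add leg_map_scalar_op map_matrix_scalar_op_add
      by (simp add: matrix_app_right el lin entries_linear_m_ops matrix_app_mult_zero[OF Z0])
    then have z: "matrix_app ?L ?v $ (i, j, k) $ (f, d, e) = 0" for i j k d e by simp
    have L: "matrix_app ?L ?v $ (i, j, k) $ (f, d, e)
      = (\<Sum>b\<in>UNIV. \<Sum>x\<in>UNIV. scalar (R $ (b, k) $ (x, e)) *
          (\<Sum>a\<in>UNIV. \<Sum>c\<in>UNIV. scalar (R $ (a, x) $ (c, d)) * app (?Z $ (i, j) $ (a, b)) (gen (c, f) * ?v)))"
      for i j k d e
    proof -
      have S: "(leg23 R ** leg12 R) $ (a, b, k) $ (c, d, e)
        = (\<Sum>x\<in>UNIV. R $ (b, k) $ (x, e) * R $ (a, x) $ (c, d))" for a b c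
        by (simp add: matrix_mult_nth sum_UNIV_prod leg12_nth leg23_nth if_mult_zero sum_if_const sum_if_UNIV)
      have "?L = leg12 ?Z ** map_matrix scalar_op (leg23 R ** leg12 R) ** leg12 (on1 m_ops)"
        by (simp only: ring_morphism.map_matrix_simps[OF rm] matrix_mul_assoc)
      then have "matrix_app ?L ?v $ (i, j, k) $ (f, d, e) = (\<Sum>c\<in>UNIV. \<Sum>a\<in>UNIV. \<Sum>b\<in>UNIV.
          scalar ((leg23 R ** leg12 R) $ (a, b, k) $ (c, d, e)) * app (?Z $ (i, j) $ (a, b)) (gen (c, f) * ?v))"
        using lin unfolding entries_linear_def scalar_linear_scalar_op
        by (simp add: matrix_app_nth matrix_mult_nth[of "_ ** _"] matrix_mult_nth[of "leg12 _"]
            sum_UNIV_prod on1_nth leg12_nth if_mult_zero sum_if_const sum_if_UNIV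
            app_sum_endo app_times app_scalar_op m_ops_nth app_left_mult sum_distrib_right)
      also have "\<dots> = (\<Sum>c\<in>UNIV. \<Sum>a\<in>UNIV. \<Sum>b\<in>UNIV. \<Sum>x\<in>UNIV.
          scalar (R $ (b, k) $ (x, e)) * (scalar (R $ (a, x) $ (c, d)) * app (?Z $ (i, j) $ (a, b)) (gen (c, f) * ?v)))"
        by (simp add: S ring_morphism.sum[OF ring_morphism_scalar] ring_morphism.mult[OF ring_morphism_scalar]
            sum_distrib_right mult.assoc)
      also have "\<dots> = (\<Sum>b\<in>UNIV. \<Sum>x\<in>UNIV. \<Sum>a\<in>UNIV. \<Sum>c\<in>UNIV.
          scalar (R $ (b, k) $ (x, e)) * (scalar (R $ (a, x) $ (c, d)) * app (?Z $ (i, j) $ (a, b)) (gen (c, f) * ?v)))"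
        by (subst sum_swap22, rule sum.cong[OF refl], rule sum.cong[OF refl], rule sum.swap)
      finally show ?thesis by (simp add: sum_distrib_left)
    qed
    \<comment> \<open>The factor \<open>R_23 R_12\<close> between the relators and
      \<open>M_1\<close> is removed by two cancellations: one for the contraction with
      \<open>R_23\<close> over \<open>(b, x)\<close>, one for that with \<open>R_12\<close> over
      \<open>(a, c)\<close>.\<close>
    have "app (?Z $ (i, j) $ (a, b)) (gen (c, f) * ?v) \<in> {0}" for i j a b
    proof (rule skew_cancel[OF linear_subspace_zero, where b = a and x = c
          and G = "\<lambda>a c. app (?Z $ (i, j) $ (a, b)) (gen (c, f) * ?v)"])
      fix x d
      show "(\<Sum>a\<in>UNIV. \<Sum>c\<in>UNIV. scalar (R $ (a, x) $ (c, d)) * app (?Z $ (i, j) $ (a, b)) (gen (c, f) * ?v)) \<in> {0}"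
        by (rule skew_cancel[OF linear_subspace_zero, where b = b and x = x
          and G = "\<lambda>b x. \<Sum>a\<in>UNIV. \<Sum>c\<in>UNIV. scalar (R $ (a, x) $ (c, d)) * app (?Z $ (i, j) $ (a, b)) (gen (c, f) * ?v)"])
          (simp only: L[symmetric] z insertI1)
    qed
    then show ?case by (simp add: vec_eq_iff split_paired_all matrix_app_nth y gen_single)
  qed
  have "app (?Z $ r $ c) (Poly_Mapping.single w 1) = 0" for r c w
    using arg_cong[OF Z, of "\<lambda>X. X $ r $ c"] by (simp only: matrix_app_nth zero_index)
  note 0 = this
  have "?Z $ r $ c = 0" for r c
  proof (rule endo_eq_on_words)
    show "scalar_linear scalar_op (?Z $ r $ c)" using lin unfolding entries_linear_def by blast
    show "scalar_linear scalar_op (0 :: ('n \<times> 'n) free_alg endo)" by (rule scalar_linear_closed)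
    show "app (?Z $ r $ c) (Poly_Mapping.single w 1) = app 0 (Poly_Mapping.single w 1)" for w
      by (simp only: 0 app_zero_endo)
  qed
  then show ?thesis by (simp add: vec_eq_iff)
qed

lemma m_matrix_m_ops: "m_matrix scalar_op R h m_ops = map_matrix left_mult (m_matrix scalar R h gen_matrix)"
  unfolding m_ops_def
  by (rule ring_morphism.map_relator_matrix(1)[OF ring_morphism_left_mult, symmetric])
    (simp add: scalar_op_def)

lemma M_rels_eq: "M_rels R h = entries (m_matrix scalar R h gen_matrix)"
  by (simp add: M_rels_def relators_eq_entries gen_matrix_def)

abbreviation J where "J \<equiv> rel_ideal (M_rels R h)"

text \<open>By the second mixed identity \<open>D_1 R_12 R_23\<close> times the relators has values
  that are complex combinations of relators times something, hence in \<open>J\<close>. Two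
  cancellations with \<Psi> remove \<open>R_12 R_23\<close>.\<close>

lemma deriv_relator_in:
  assumes y: "y \<in> M_rels R h"
  shows "app (deriv i a) (y * v) \<in> J"
proof -
  let ?Y = "m_matrix scalar R h gen_matrix :: ('n \<times> 'n) free_alg^('n \<times> 'n)^('n \<times> 'n)"
  note rm = ring_morphism_scalar_op
  note el = entries_linear_closed[OF rm]
  let ?A = "map_matrix scalar_op R :: ('n \<times> 'n) free_alg endo^('n \<times> 'n)^('n \<times> 'n)"
    and ?B = "map_matrix scalar_op (matrix_inv R) :: ('n \<times> 'n) free_alg endo^('n \<times> 'n)^('n \<times> 'n)"
  let ?L = "leg12 (on1 deriv_ops) ** leg12 ?A ** leg23 ?A ** leg12 (m_matrix scalar_op R h m_ops)"
  obtain b c e f where bc: "y = ?Y $ (b, c) $ (e, f)"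
    using y by (auto simp: M_rels_eq entries_def)
  note J = linear_subspace_rel_ideal[of "M_rels R h"]
  have "entries_in J (matrix_app ?L v)"
  proof -
    have 1: "entries_in J (matrix_app (leg12 (m_matrix scalar_op R h m_ops) ** X) u)" for X u
    proof -
      have "leg12 (m_matrix scalar_op R h m_ops) = map_matrix left_mult (leg12 ?Y)"
        by (simp add: m_matrix_m_ops ring_morphism.map_matrix_simps[OF ring_morphism_left_mult])
      then have "matrix_app (leg12 (m_matrix scalar_op R h m_ops) ** X) u = leg12 ?Y ** matrix_app X u"
        by (simp add: matrix_app_left)
      moreover have "leg12 ?Y $ r $ c \<in> J" for r c
        by (cases r; cases c)
          (auto simp: leg12_nth rel_ideal_0 M_rels_eq entries_def intro!: rel_ideal_relator)
      ultimately show ?thesis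
        by (auto simp: entries_in_def matrix_mult_nth intro!: linear_subspace_sum[OF J] rel_ideal_right)
    qed
    show ?thesis
      unfolding mixed_matrix_identities(2)[OF rm hecke entries_linear_m_ops entries_linear_deriv_ops perm_matrix_deriv_ops]
      unfolding matrix_mul_assoc[symmetric] leg_map_scalar_op
      by (simp only: map_matrix_scalar_op matrix_app_left)
        (intro entries_in_emb_left[OF J] 1)
  qed
  then have z: "matrix_app ?L v $ (i, j, k) $ (e, f, d) \<in> J" for i j k d by (simp add: entries_in_def)
  have L: "matrix_app ?L v $ (i, j, k) $ (e, f, d)
      = (\<Sum>x\<in>UNIV. \<Sum>c\<in>UNIV. scalar (R $ (x, k) $ (c, d)) *
          (\<Sum>a\<in>UNIV. \<Sum>b\<in>UNIV. scalar (R $ (a, j) $ (b, x)) * app (deriv i a) (?Y $ (b, c) $ (e, f) * v)))"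
    for i j k d
  proof -
    have S: "(leg12 R ** leg23 R) $ (a, j, k) $ (b, c, d)
      = (\<Sum>x\<in>UNIV. R $ (x, k) $ (c, d) * R $ (a, j) $ (b, x))" for a b c
      by (simp add: matrix_mult_nth sum_UNIV_prod leg12_nth leg23_nth if_mult_zero sum_if_const sum_if_UNIV mult.commute)
    have "?L = leg12 (on1 deriv_ops) ** map_matrix scalar_op (leg12 R ** leg23 R) ** leg12 (map_matrix left_mult ?Y)"
      by (simp only: ring_morphism.map_matrix_simps[OF rm] matrix_mul_assoc m_matrix_m_ops)
    then have "matrix_app ?L v $ (i, j, k) $ (e, f, d) = (\<Sum>b\<in>UNIV. \<Sum>c\<in>UNIV. \<Sum>a\<in>UNIV.
        scalar ((leg12 R ** leg23 R) $ (a, j, k) $ (b, c, d)) * app (deriv i a) (?Y $ (b, c) $ (e, f) * v))"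
      by (simp add: matrix_app_nth matrix_mult_nth[of "_ ** _"] matrix_mult_nth[of "leg12 (on1 _)"]
          sum_UNIV_prod on1_nth leg12_nth if_mult_zero sum_if_const sum_if_UNIV deriv_ops_def
          app_sum_endo app_times app_scalar_op app_left_mult sum_distrib_right app_deriv_scalar)
    also have "\<dots> = (\<Sum>b\<in>UNIV. \<Sum>c\<in>UNIV. \<Sum>a\<in>UNIV. \<Sum>x\<in>UNIV.
        scalar (R $ (x, k) $ (c, d)) * (scalar (R $ (a, j) $ (b, x)) * app (deriv i a) (?Y $ (b, c) $ (e, f) * v)))"
      by (simp add: S ring_morphism.sum[OF ring_morphism_scalar] ring_morphism.mult[OF ring_morphism_scalar]
          sum_distrib_right mult.assoc)
    also have "\<dots> = (\<Sum>x\<in>UNIV. \<Sum>c\<in>UNIV. \<Sum>a\<in>UNIV. \<Sum>b\<in>UNIV.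
        scalar (R $ (x, k) $ (c, d)) * (scalar (R $ (a, j) $ (b, x)) * app (deriv i a) (?Y $ (b, c) $ (e, f) * v)))"
      by (subst sum.swap, subst (2) sum_rotate3, subst (2) sum.swap) (subst sum.swap, rule refl)
    finally show ?thesis by (simp add: sum_distrib_left)
  qed
  have "app (deriv i a) (?Y $ (b, c) $ (e, f) * v) \<in> J"
  proof (rule skew_cancel[OF J, where b = a and x = b
        and G = "\<lambda>a b. app (deriv i a) (?Y $ (b, c) $ (e, f) * v)"])
    fix j x
    show "(\<Sum>a\<in>UNIV. \<Sum>b\<in>UNIV. scalar (R $ (a, j) $ (b, x)) * app (deriv i a) (?Y $ (b, c) $ (e, f) * v)) \<in> J"
      by (rule skew_cancel[OF J, where b = x and x = c
        and G = "\<lambda>x c. \<Sum>a\<in>UNIV. \<Sum>b\<in>UNIV. scalar (R $ (a, j) $ (b, x)) * app (deriv i a) (?Y $ (b, c) $ (e, f) * v)"])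
        (simp only: L[symmetric] z)
  qed
  then show ?thesis by (simp add: bc)
qed

text \<open>On a term \<open>x * s * y\<close> the right factor is handled by
  \<open>deriv_relator_in\<close>. For the left factor, \<open>K\<close> demands that all
  derivatives be in the ideal at once: passing a generator mixes them.\<close>

lemma deriv_in: "p \<in> J \<Longrightarrow> app (deriv i a) p \<in> J"
proof -
  define K where "K = {v \<in> J. \<forall>i a. app (deriv i a) v \<in> J}"
  have K: "linear_subspace K"
    by (auto simp: K_def linear_subspace_iff app_add app_deriv_scalar rel_ideal_0 rel_ideal_add rel_ideal_left)
  have gen: "gen x * v \<in> K" if "v \<in> K" for x v
  proof -
    obtain b k where x: "x = (b, k)" by (cases x)
    have "app (deriv i a) (gen (b, k) * v) \<in> J" for i a
      by (rule deriv_gen_in[OF linear_subspace_rel_ideal rel_ideal_left])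
        (use that in \<open>auto simp: K_def\<close>)
    then show ?thesis using that by (simp add: K_def rel_ideal_left x)
  qed
  have word: "Poly_Mapping.single w 1 * v \<in> K" if "v \<in> K" for w v
  proof (induct w)
    case Nil
    then show ?case using that by (simp flip: zero_list_def)
  next
    case (Cons x w)
    have "Poly_Mapping.single (x # w) 1 * v = gen x * (Poly_Mapping.single w 1 * v)"
      by (simp add: gen_single flip: mult.assoc)
    then show ?case using gen[OF Cons] by simp
  qed
  have left: "u * v \<in> K" if "v \<in> K" for u v
  proof (induct u rule: poly_mapping_additive_induct)
    case (1 w c)
    have "Poly_Mapping.single w c * v = scalar c * (Poly_Mapping.single w 1 * v)"
      by (simp add: scalar_single flip: mult.assoc)
    then show ?case using word[OF that] K by (simp add: linear_subspace_iff)
  qed (use K in \<open>auto simp: linear_subspace_iff distrib_right\<close>)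
  have "p \<in> K" if "p \<in> J"
    using that unfolding rel_ideal_eq[of "M_rels R h"]
  proof (induct p rule: relator_span.induct)
    case (step p s x y)
    have "s * y \<in> K"
      using step deriv_relator_in by (simp add: K_def rel_ideal_right rel_ideal_relator)
    then show ?case using left[of "s * y" x] step K by (simp add: linear_subspace_iff mult.assoc)
  qed (use K in \<open>simp add: linear_subspace_iff\<close>)
  then show "p \<in> J \<Longrightarrow> app (deriv i a) p \<in> J" by (simp add: K_def)
qed

end

section \<open>Normal ordering\<close>

lemma poly_mapping_sum_single:
  "p = (\<Sum>k\<in>Poly_Mapping.keys p. Poly_Mapping.single k (Poly_Mapping.lookup p k))"
  by (rule poly_mapping_eqI) (simp add: lookup_sum lookup_single when_def in_keys_iff)

lemma scalar_left_commute: "p * (scalar c * r) = scalar c * (p * r)" for p :: "'x free_alg"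
proof -
  have "p * (scalar c * r) = p * scalar c * r" by (simp only: mult.assoc)
  also have "\<dots> = scalar c * p * r" by (simp only: scalar_commute[of c p])
  finally show ?thesis by (simp only: mult.assoc)
qed

lemma keys_scalar_mult: "Poly_Mapping.keys (scalar c * p) \<subseteq> Poly_Mapping.keys p"
  using keys_mult[of "scalar c" p] by (auto simp: scalar_def plus_list_def split: if_splits)

lemma keys_gen_mult: "Poly_Mapping.keys (gen x * p) \<subseteq> (#) x ` Poly_Mapping.keys p"
  using keys_mult[of "gen x" p] by (auto simp: gen_def plus_list_def split: if_splits)

lemma linear_subspace_normal_ordered: "linear_subspace {p :: 'n::finite mixed_gen free_alg. normal_ordered p}"
proof -
  have "normal_ordered 0" by (simp add: normal_ordered_def)
  moreover have "normal_ordered (p + r)" if "normal_ordered p" "normal_ordered r" for p r :: "'n mixed_gen free_alg"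
    using that keys_add[of p r] unfolding normal_ordered_def by (meson Un_least order_trans)
  moreover have "normal_ordered (scalar c * p)" if "normal_ordered p" for c and p :: "'n mixed_gen free_alg"
    using that keys_scalar_mult[of c p] unfolding normal_ordered_def by (meson order_trans)
  ultimately show ?thesis by (simp add: linear_subspace_iff)
qed

lemma normal_ordered_gen_mult:
  assumes p: "normal_ordered p" shows "normal_ordered (gen (Inl x) * p)"
  unfolding normal_ordered_def
proof (rule subsetI)
  fix w assume "w \<in> Poly_Mapping.keys (gen (Inl x) * p)"
  then have "w \<in> (#) (Inl x) ` Poly_Mapping.keys p" by (rule subsetD[OF keys_gen_mult])
  then obtain w' where w': "w = Inl x # w'" "w' \<in> Poly_Mapping.keys p" by (rule imageE)
  from w'(2) have "w' \<in> {map Inl u @ map Inr v | u v. True}"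
    by (rule subsetD[OF p[unfolded normal_ordered_def]])
  then obtain u v where "w' = map Inl u @ map Inr v" by blast
  then have "w = map Inl (x # u) @ map Inr v" using w' by simp
  then show "w \<in> {map Inl u @ map Inr v | u v. True}" by blast
qed

lemma inj_map_Inl: "inj (map Inl)"
  by (simp add: inj_map)

lemma counit_right_add: "counit_right (p + r) = counit_right p + counit_right r"
  by (simp add: counit_right_def map_key_plus[OF inj_map_Inl])

lemma counit_right_single:
  "counit_right (Poly_Mapping.single (map Inl u @ map Inr v) c) = (if v = [] then Poly_Mapping.single u c else 0)"
proof (cases v)
  case Nil
  then show ?thesis by (simp add: counit_right_def map_key_single[OF inj_map_Inl])
next
  case (Cons y v')
  have "map Inl u @ map Inr v \<noteq> map Inl u'" for u'
  proof
    assume "map Inl u @ map Inr v = map Inl u'"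
    then have "Inr y \<in> set (map Inl u')" by (metis Cons in_set_conv_decomp list.simps(9) Un_iff set_append list.set_intros(1))
    then show False by auto
  qed
  then show ?thesis using Cons
    by (intro poly_mapping_eqI) (simp add: counit_right_def map_key.rep_eq[OF inj_map_Inl] lookup_single when_def)
qed

lemma incl_M_add:
  fixes p r :: "('n \<times> 'n) free_alg"
  shows "incl_M (p + r) = incl_M p + incl_M r"
proof -
  have "incl_M a = extend (\<lambda>w c. Poly_Mapping.single (map Inl w) c) a" for a :: "('n \<times> 'n) free_alg"
    by (simp add: incl_M_def extend_def)
  then show ?thesis by (simp add: extend_add single_add)
qed

lemma single_Nil: "Poly_Mapping.single [] 1 = (1 :: 'x free_alg)"
  by (simp flip: zero_list_def)

lemma incl_M_single: "incl_M (Poly_Mapping.single w c) = Poly_Mapping.single (map Inl w) c"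
  by (simp add: incl_M_def)

section \<open>The mixed algebra and its action on the free algebra\<close>

definition mixed_m :: "'n::finite mixed_gen free_alg^'n^'n" where
  "mixed_m = (\<chi> i j. gen (Inl (i, j)))"

definition mixed_d :: "'n::finite mixed_gen free_alg^'n^'n" where
  "mixed_d = (\<chi> i j. gen (Inr (i, j)))"

lemma mixed_rels_eq:
  "mixed_rels R h = entries (m_matrix scalar R h mixed_m) \<union> entries (d_matrix scalar R mixed_d)
     \<union> entries (perm_matrix scalar R h mixed_m mixed_d)"
  by (simp add: mixed_rels_def Let_def relators_eq_entries mixed_m_def mixed_d_def)

lemma map_matrix_right_mult:
  fixes v :: "'x free_alg"
  shows "map_matrix (\<lambda>x. x * v) (A ** B) = A ** map_matrix (\<lambda>x. x * v) B"
    and "map_matrix (\<lambda>x. x * v) (A ** emb C) = map_matrix (\<lambda>x. x * v) A ** emb C"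
    and "map_matrix (\<lambda>x. x * v) (on1 X) = on1 (map_matrix (\<lambda>x. x * v) X)"
    and "map_matrix (\<lambda>x. x * v) (Y + Z) = map_matrix (\<lambda>x. x * v) Y + map_matrix (\<lambda>x. x * v) Z"
    and "map_matrix (\<lambda>x. x * v) (mat 1) = mat v"
proof -
  have "y * scalar c * v = y * v * scalar c" for y :: "'x free_alg" and c
    by (simp only: mult.assoc scalar_commute)
  then show "map_matrix (\<lambda>x. x * v) (A ** emb C) = map_matrix (\<lambda>x. x * v) A ** emb C"
    by (simp add: vec_eq_iff matrix_mult_nth emb_def sum_distrib_right)
qed (simp_all add: vec_eq_iff matrix_mult_nth sum_distrib_right mult.assoc split_paired_all on1_nth
      distrib_right mat_nth)

context skew_hecke
begin

definition mixed_op :: "'n mixed_gen \<Rightarrow> ('n \<times> 'n) free_alg endo" where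
  "mixed_op x = (case x of Inl g \<Rightarrow> left_mult (gen g) | Inr (i, j) \<Rightarrow> deriv i j)"

text \<open>The free mixed algebra acts here on the free algebra in the \<open>m_i^j\<close>, not on
  its quotient; its relators therefore map into \<open>J\<close> instead of acting by zero.\<close>

definition rep :: "'n mixed_gen free_alg \<Rightarrow> ('n \<times> 'n) free_alg endo" where
  "rep = word_eval scalar_op mixed_op"

lemma scalar_linear_mixed_op: "scalar_linear scalar_op (mixed_op x)"
proof (cases x)
  case (Inl g)
  then show ?thesis by (simp add: mixed_op_def scalar_linear_left_mult)
next
  case (Inr y)
  then show ?thesis
    by (cases y) (simp add: mixed_op_def scalar_linear_scalar_op app_deriv_scalar)
qed

lemma ring_morphism_rep: "ring_morphism rep"
  unfolding rep_def
  by (rule ring_morphism_word_eval[OF ring_morphism_scalar_op])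
    (use scalar_linear_mixed_op in \<open>simp add: scalar_linear_def\<close>)

lemma rep_gen: "rep (gen x) = mixed_op x"
  by (simp add: rep_def word_eval_gen[OF ring_morphism_scalar_op])

lemma rep_single: "rep (Poly_Mapping.single w c) = scalar_op c * prod_list (map mixed_op w)"
  by (simp add: rep_def word_eval_single[OF ring_morphism_scalar_op])

lemma rep_scalar: "rep (scalar c) = scalar_op c"
  by (simp add: rep_def word_eval_scalar[OF ring_morphism_scalar_op])

lemma rep_matrices: "map_matrix rep mixed_m = m_ops" "map_matrix rep mixed_d = deriv_ops"
  by (simp_all add: vec_eq_iff mixed_m_def mixed_d_def rep_gen mixed_op_def m_ops_nth deriv_ops_def)

lemma rep_relator_in:
  assumes "s \<in> mixed_rels R h"
  shows "app (rep s) v \<in> J"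
proof -
  note rel = ring_morphism.map_relator_matrix[OF ring_morphism_rep, where s = scalar and s' = scalar_op, OF rep_scalar]
  from assms consider r c where "s = m_matrix scalar R h mixed_m $ r $ c"
    | r c where "s = d_matrix scalar R mixed_d $ r $ c"
    | r c where "s = perm_matrix scalar R h mixed_m mixed_d $ r $ c"
    unfolding mixed_rels_eq entries_def by blast
  then show ?thesis
  proof cases
    case 1
    have "rep s = left_mult (m_matrix scalar R h gen_matrix $ r $ c)"
      using rel(1)[of R h mixed_m] unfolding 1 rep_matrices m_matrix_m_ops
      by (metis nth_map_matrix)
    moreover have "m_matrix scalar R h gen_matrix $ r $ c \<in> J"
      unfolding M_rels_eq entries_def by (rule rel_ideal_relator) blast
    ultimately show ?thesis by (simp add: app_left_mult rel_ideal_right)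
  next
    case 2
    have "rep s = 0"
      using rel(2)[of R mixed_d] unfolding 2 rep_matrices d_matrix_deriv_ops
      by (metis nth_map_matrix zero_index)
    then show ?thesis by (simp add: rel_ideal_0)
  next
    case 3
    have "rep s = 0"
      using rel(3)[of R h mixed_m mixed_d] unfolding 3 rep_matrices perm_matrix_deriv_ops
      by (metis nth_map_matrix zero_index)
    then show ?thesis by (simp add: rel_ideal_0)
  qed
qed

lemma rep_preserves: "v \<in> J \<Longrightarrow> app (rep p) v \<in> J"
proof (induct p rule: poly_mapping_additive_induct)
  case (1 w c)
  have op: "app (mixed_op x) u \<in> J" if "u \<in> J" for x u
    using that by (auto simp: mixed_op_def app_left_mult rel_ideal_left deriv_in split: sum.split prod.split)
  have "app (prod_list (map mixed_op w)) v \<in> J"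
    by (induct w) (simp_all add: 1 app_times op)
  then show ?case by (simp add: rep_single app_times app_scalar_op rel_ideal_left)
qed (simp add: ring_morphism.add[OF ring_morphism_rep] app_plus rel_ideal_add)

text \<open>In \<open>x * s * y\<close> the factor \<open>y\<close> acts first and is arbitrary, the
  relator \<open>s\<close> sends any vector into \<open>J\<close>, and \<open>x\<close> preserves
  \<open>J\<close>.\<close>

lemma rep_ideal_in: "p \<in> rel_ideal (mixed_rels R h) \<Longrightarrow> app (rep p) v \<in> J"
  unfolding rel_ideal_eq[of "mixed_rels R h"]
proof (induct p rule: relator_span.induct)
  case (step p s x y)
  then show ?case
    by (simp add: ring_morphism.add[OF ring_morphism_rep] ring_morphism.mult[OF ring_morphism_rep]
        app_plus app_times rel_ideal_add rep_preserves rep_relator_in)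
qed (simp add: ring_morphism.zero[OF ring_morphism_rep] rel_ideal_0)

text \<open>In a nonempty word of derivatives the last letter acts first and sends 1 to 0, just as
  the counit does; words in the \<open>m_i^j\<close> act by left multiplication.\<close>

lemma rep_normal_ordered:
  assumes "normal_ordered p"
  shows "app (rep p) 1 = counit_right p"
proof -
  interpret r: ring_morphism rep by (rule ring_morphism_rep)
  have D1: "app (deriv i j) 1 = 0" for i j
    using app_deriv_single[of i j "[]" 1] by (simp add: single_Nil)
  have Inl: "app (prod_list (map mixed_op (map Inl u @ ws))) a
      = Poly_Mapping.single u 1 * app (prod_list (map mixed_op ws)) a" for u ws a
    by (induct u) (simp_all add: app_times mixed_op_def app_left_mult single_Nil gen_single flip: mult.assoc)
  have Inr: "app (prod_list (map mixed_op (map Inr v))) 1 = (if v = [] then 1 else 0)" for v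
    by (induct v) (auto simp: app_times mixed_op_def D1 split: prod.split)
  have single: "app (rep (Poly_Mapping.single w c)) 1 = counit_right (Poly_Mapping.single w c)"
    if wN: "w \<in> {map Inl u @ map Inr v | u v. True}" for w :: "(('n \<times> 'n) + ('n \<times> 'n)) list" and c
  proof -
    obtain u v where w: "w = map Inl u @ map Inr v" using wN by blast
    show ?thesis
      unfolding w rep_single counit_right_single app_times Inl app_scalar_op Inr by (simp add: scalar_single)
  qed
  have sum: "counit_right (\<Sum>k\<in>A. f k) = (\<Sum>k\<in>A. counit_right (f k))" if "finite A" for A and f :: "_ \<Rightarrow> 'n mixed_gen free_alg"
    using that by induct (simp_all add: counit_right_add, simp add: counit_right_def map_key_zero[OF inj_map_Inl])
  have "app (rep (\<Sum>k\<in>Poly_Mapping.keys p. Poly_Mapping.single k (Poly_Mapping.lookup p k))) 1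
    = counit_right (\<Sum>k\<in>Poly_Mapping.keys p. Poly_Mapping.single k (Poly_Mapping.lookup p k))"
    unfolding sum[OF finite_keys] r.sum app_sum_endo
    by (rule sum.cong[OF refl], rule single) (use assms in \<open>auto simp: normal_ordered_def\<close>)
  then show ?thesis by (simp only: poly_mapping_sum_single[symmetric])
qed

lemma rep_incl_M: "rep (incl_M a) = left_mult a"
proof (induct a rule: poly_mapping_additive_induct)
  case (1 w c)
  have "prod_list (map mixed_op (map Inl w)) = left_mult (Poly_Mapping.single w 1)"
    by (induct w) (auto intro!: endo_eqI simp: mixed_op_def app_times app_left_mult gen_single single_Nil mult.assoc[symmetric])
  then show ?case
    unfolding incl_M_single rep_single by (auto intro!: endo_eqI simp: app_times app_left_mult app_scalar_op scalar_single mult.assoc[symmetric])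
qed (simp add: incl_M_add ring_morphism.add[OF ring_morphism_rep] ring_morphism.add[OF ring_morphism_left_mult])

section \<open>Existence of normal forms and identification of the derivatives\<close>

lemma perm_rhs_diff: "perm_rhs M E v - perm_rhs M E' v = perm_rhs M (E - E') 0"
proof -
  have "on1 (E - E') = on1 E - on1 E'" by (simp add: vec_eq_iff split_paired_all on1_nth)
  moreover have "matrix_endo (perm_rhs M E v - perm_rhs M E' v) = matrix_endo (perm_rhs M (E - E') 0)"
    unfolding perm_rhs_def calculation mat_0
    by (simp add: matrix_endo_simps algebra_simps)
  ultimately show ?thesis by (simp add: matrix_endo_inject)
qed

text \<open>The permutation relators, multiplied by \<open>R^-1\<close> and then by \<open>v\<close>
  on the right. This is the analogue of \<open>deriv_ops_perm_app\<close> in the mixed algebra,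
  where it holds modulo the ideal.\<close>

lemma mixed_perm:
  fixes v :: "'n mixed_gen free_alg"
  shows "(\<Sum>a\<in>UNIV. \<Sum>b\<in>UNIV. scalar (R $ (a, j) $ (b, l)) * (gen (Inr (i, a)) * (gen (Inl (b, k)) * v)))
     - perm_rhs mixed_m (map_matrix (\<lambda>x. x * v) mixed_d) v $ (i, j) $ (k, l) \<in> rel_ideal (mixed_rels R h)"
proof -
  interpret s: ring_morphism "scalar :: complex \<Rightarrow> 'n mixed_gen free_alg" by (rule ring_morphism_scalar)
  let ?A = "emb R :: 'n mixed_gen free_alg^('n \<times> 'n)^('n \<times> 'n)"
    and ?B = "emb (matrix_inv R) :: 'n mixed_gen free_alg^('n \<times> 'n)^('n \<times> 'n)"
  let ?e = "matrix_endo :: 'n mixed_gen free_alg^('n \<times> 'n)^('n \<times> 'n) \<Rightarrow> _"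
  let ?I = "rel_ideal (mixed_rels R h)"
  let ?P = "perm_matrix scalar R h mixed_m mixed_d :: 'n mixed_gen free_alg^('n \<times> 'n)^('n \<times> 'n)"
  let ?T = "?A ** on1 mixed_m ** ?B ** on1 mixed_d ** ?B + mat 1 + mat (scalar h) ** on1 mixed_d"
  have "?A ** ?B = map_matrix scalar (R ** matrix_inv R)" by (simp only: s.map_matrix_mult emb_def)
  also have "\<dots> = mat 1" by (simp only: hecke_inverse(1)[OF hecke] s.map_matrix_mat s.one)
  finally have "?e (?A ** ?B) = ?e (mat 1)" by simp
  then have AB: "?e ?A * ?e ?B = 1" "x * ?e ?A * ?e ?B = x" for x
    by (simp_all add: matrix_endo_simps mult.assoc)
  have "?e (?P ** ?B) = ?e (on1 mixed_d ** ?A ** on1 mixed_m - ?T)"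
    unfolding perm_matrix_def Let_def matrix_endo_simps emb_def[symmetric] left_diff_distrib distrib_right AB
    by (simp add: add.assoc)
  then have T: "on1 mixed_d ** ?A ** on1 mixed_m - ?T = ?P ** ?B" by (simp add: matrix_endo_inject)
  have "?P $ r $ c \<in> mixed_rels R h" for r c
    unfolding mixed_rels_eq entries_def by blast
  then have "entries_in ?I ?P" by (simp add: entries_in_def rel_ideal_relator)
  then have "entries_in ?I (?P ** ?B)"
    by (rule entries_in_emb_right[OF linear_subspace_rel_ideal])
  then have "(on1 mixed_d ** ?A ** on1 mixed_m - ?T) $ (i, j) $ (k, l) * v \<in> ?I"
    unfolding T entries_in_def by (simp add: rel_ideal_right)
  moreover have "(on1 mixed_d ** ?A ** on1 mixed_m) $ (i, j) $ (k, l) * v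
    = (\<Sum>a\<in>UNIV. \<Sum>b\<in>UNIV. scalar (R $ (a, j) $ (b, l)) * (gen (Inr (i, a)) * (gen (Inl (b, k)) * v)))"
  proof -
    have "gen x * scalar c * gen y * v = scalar c * (gen x * (gen y * v))" for c x y
      by (simp only: scalar_commute[symmetric] mult.assoc)
    then show ?thesis
      by (subst sum.swap) (simp add: matrix_mult_nth sum_UNIV_prod on1_nth if_mult_zero sum_if_const sum_if_UNIV
        mixed_m_def mixed_d_def emb_def sum_distrib_right)
  qed
  moreover have "?T $ (i, j) $ (k, l) * v = perm_rhs mixed_m (map_matrix (\<lambda>x. x * v) mixed_d) v $ (i, j) $ (k, l)"
  proof -
    have "map_matrix (\<lambda>x. x * v) ?T = perm_rhs mixed_m (map_matrix (\<lambda>x. x * v) mixed_d) v"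
      unfolding perm_rhs_def map_matrix_right_mult(2-5)
      by (simp only: map_matrix_right_mult(1,3))
    from arg_cong[OF this, of "\<lambda>X. X $ (i, j) $ (k, l)"] show ?thesis
      by (simp only: nth_map_matrix)
  qed
  ultimately show ?thesis by (simp only: vector_minus_component left_diff_distrib)
qed

text \<open>The recursion of \<open>deriv_word\<close>, now in the mixed algebra and started at the
  derivatives themselves instead of 0. A whole matrix \<open>E\<close> is carried along because
  passing one generator combines all derivatives.\<close>

lemma normal_ordering_word:
  "\<exists>E. entries_in {p. normal_ordered p} E \<and>
     (\<forall>i a. gen (Inr (i, a)) * incl_M (Poly_Mapping.single w 1) - E $ i $ a \<in> rel_ideal (mixed_rels R h))"
proof (induct w)
  case Nil
  have "normal_ordered (gen (Inr (i, j)) :: 'n mixed_gen free_alg)" for i j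
  proof -
    have "[Inr (i, j)] = map Inl [] @ map Inr [(i, j)]" by simp
    then have "[Inr (i, j)] \<in> {map Inl u @ map Inr v | u v. True}" by blast
    then show ?thesis by (simp add: normal_ordered_def gen_def)
  qed
  then have "entries_in {p. normal_ordered p} (mixed_d :: 'n mixed_gen free_alg^'n^'n)" by (simp add: entries_in_def mixed_d_def)
  then show ?case
    unfolding incl_M_single unfolding list.map single_Nil
    by (intro exI[of _ mixed_d]) (simp add: mixed_d_def rel_ideal_0)
next
  case (Cons x w)
  then obtain E where E: "entries_in {p. normal_ordered p} E"
    "\<And>i a. gen (Inr (i, a)) * incl_M (Poly_Mapping.single w 1) - E $ i $ a \<in> rel_ideal (mixed_rels R h)"
    by blast
  let ?I = "rel_ideal (mixed_rels R h)" and ?v = "incl_M (Poly_Mapping.single w 1) :: 'n mixed_gen free_alg"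
  obtain c k where x: "x = (c, k)" by (cases x)
  let ?S = "perm_rhs mixed_m E ?v"
  have v: "incl_M (Poly_Mapping.single (x # w) 1) = gen (Inl (c, k)) * ?v"
    by (simp add: incl_M_single gen_single x)
  have vN: "normal_ordered ?v"
  proof -
    have "map Inl w \<in> {map Inl u @ map Inr v | u v. True}"
      by (rule CollectI, rule exI[of _ w], rule exI[of _ "[]"]) simp
    then show ?thesis
      unfolding incl_M_single normal_ordered_def by simp
  qed
  have N: "entries_in {p. normal_ordered p} (skew_solve ?S c k)"
    by (intro skew_solve_in perm_rhs_in linear_subspace_normal_ordered E)
      (simp_all add: vN mixed_m_def normal_ordered_gen_mult)
  have "gen (Inr (i, a)) * (gen (Inl (c, k)) * ?v) - skew_solve ?S c k $ i $ a \<in> ?I" for i a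
  proof (rule skew_cancel[OF linear_subspace_rel_ideal, where b = a and x = c
      and G = "\<lambda>a c. gen (Inr (i, a)) * (gen (Inl (c, k)) * ?v) - skew_solve ?S c k $ i $ a"])
    fix j l
    let ?E = "map_matrix (\<lambda>x. x * ?v) mixed_d"
    \<comment> \<open>As \<open>perm_rhs\<close> is affine in its second argument, replacing the
      products with derivatives by their normal forms changes it by ideal elements only.\<close>
    have "entries_in ?I (perm_rhs mixed_m (?E - E) 0)"
      by (rule perm_rhs_in[OF linear_subspace_rel_ideal])
        (simp_all add: rel_ideal_left rel_ideal_0 entries_in_def mixed_d_def E)
    then have "perm_rhs mixed_m ?E ?v $ (i, j) $ (k, l) - ?S $ (i, j) $ (k, l) \<in> ?I"
      unfolding entries_in_def perm_rhs_diff[where v = ?v, symmetric] vector_minus_component by blast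
    from rel_ideal_add[OF mixed_perm[of j l i k ?v] this]
    show "(\<Sum>a\<in>UNIV. \<Sum>c\<in>UNIV. scalar (R $ (a, j) $ (c, l)) *
        (gen (Inr (i, a)) * (gen (Inl (c, k)) * ?v) - skew_solve ?S c k $ i $ a)) \<in> ?I"
      by (simp add: right_diff_distrib sum_subtractf skew_solve_inverse)
  qed
  then show ?case
    by (intro exI[of _ "skew_solve ?S c k"]) (simp add: N v)
qed

lemma normal_ordering:
  "\<exists>p. normal_ordered p \<and> gen (Inr (i, j)) * incl_M a - p \<in> rel_ideal (mixed_rels R h)"
proof (induct a rule: poly_mapping_additive_induct)
  case (1 w c)
  obtain p where p: "normal_ordered p" "gen (Inr (i, j)) * incl_M (Poly_Mapping.single w 1) - p \<in> rel_ideal (mixed_rels R h)"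
    using normal_ordering_word[of w] unfolding entries_in_def by blast
  have "incl_M (Poly_Mapping.single w c) = scalar c * incl_M (Poly_Mapping.single w 1)"
    by (simp add: incl_M_single scalar_single)
  then have "gen (Inr (i, j)) * incl_M (Poly_Mapping.single w c) = scalar c * (gen (Inr (i, j)) * incl_M (Poly_Mapping.single w 1))"
    by (simp only: scalar_left_commute)
  then have "gen (Inr (i, j)) * incl_M (Poly_Mapping.single w c) - scalar c * p \<in> rel_ideal (mixed_rels R h)"
    using rel_ideal_left[OF p(2), of "scalar c"] by (simp add: right_diff_distrib)
  moreover have "normal_ordered (scalar c * p)"
    using p(1) linear_subspace_normal_ordered unfolding linear_subspace_iff by blast
  ultimately show ?case by blast
next
  case (2 a b)
  then obtain p r where p: "normal_ordered p" "gen (Inr (i, j)) * incl_M a - p \<in> rel_ideal (mixed_rels R h)"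
    and r: "normal_ordered r" "gen (Inr (i, j)) * incl_M b - r \<in> rel_ideal (mixed_rels R h)" by blast
  have "normal_ordered (p + r)"
    using p(1) r(1) linear_subspace_normal_ordered unfolding linear_subspace_iff by blast
  then show ?case using rel_ideal_add[OF p(2) r(2)]
    by (intro exI[of _ "p + r"]) (simp add: incl_M_add distrib_left add_diff_add)
qed

text \<open>For any representative \<open>a'\<close> and any normal form \<open>p\<close>, the
  element \<open>gen (Inr (i, j)) * incl_M a' - p\<close> sends 1 into \<open>J\<close>, so
  \<open>counit_right p\<close> agrees with the constructed derivative of \<open>a'\<close> modulo
  \<open>J\<close>. Independence of \<open>a'\<close> is \<open>deriv_in\<close>.\<close>

lemma qderiv_cls: "qderiv R h i j (cls (M_rels R h) a) = cls (M_rels R h) (app (deriv i j) a)"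
proof -
  have key: "cls (M_rels R h) (counit_right p) = cls (M_rels R h) (app (deriv i j) a)"
    if "a' \<in> cls (M_rels R h) a" "normal_ordered p"
      "gen (Inr (i, j)) * incl_M a' - p \<in> rel_ideal (mixed_rels R h)" for a' p
  proof -
    have "app (rep (gen (Inr (i, j)) * incl_M a' - p)) 1 \<in> J" by (rule rep_ideal_in[OF that(3)])
    then have "app (deriv i j) a' - counit_right p \<in> J"
      by (simp add: ring_morphism.diff[OF ring_morphism_rep] ring_morphism.mult[OF ring_morphism_rep]
        app_minus app_times rep_incl_M app_left_mult rep_gen mixed_op_def rep_normal_ordered that(2))
    moreover have "app (deriv i j) (a' - a) \<in> J" using that(1) by (simp add: cls_eq deriv_in)
    ultimately have "app (deriv i j) (a' - a) - (app (deriv i j) a' - counit_right p) \<in> J"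
      by (rule rel_ideal_diff[rotated])
    then show ?thesis by (simp add: cls_eq_iff app_diff)
  qed
  show ?thesis
    unfolding qderiv_def
  proof (rule the_equality)
    obtain p where "normal_ordered p" "gen (Inr (i, j)) * incl_M a - p \<in> rel_ideal (mixed_rels R h)"
      using normal_ordering by blast
    moreover have "a \<in> cls (M_rels R h) a" by (simp add: cls_eq rel_ideal_0)
    ultimately show "\<exists>a'\<in>cls (M_rels R h) a. \<exists>p. normal_ordered p \<and>
        gen (Inr (i, j)) * incl_M a' - p \<in> rel_ideal (mixed_rels R h) \<and>
        cls (M_rels R h) (app (deriv i j) a) = cls (M_rels R h) (counit_right p)"
      using key by metis
  qed (use key in auto)
qed

end

section \<open>The square of the de Rham operator\<close>

lemma Dif_rels_eq: "Dif_rels R = entries (emb R ** on1 gen_matrix ** emb R ** on1 gen_matrix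
      + on1 gen_matrix ** emb R ** on1 gen_matrix ** emb (matrix_inv R))"
  by (simp add: Dif_rels_def dif_relators_def gen_matrix_def)

text \<open>\<open>B p f\<close> models a linear functional at the tensor of a differential form
  with the result of the operator \<open>f\<close>. The second argument is an operator so that
  matrices of derivatives can be multiplied before they are applied.\<close>

locale scalar_bilinear =
  fixes B :: "('n::finite \<times> 'n) free_alg \<Rightarrow> ('n \<times> 'n) free_alg endo \<Rightarrow> complex"
  assumes add_left: "B (p + r) f = B p f + B r f" and add_right: "B p (f + g) = B p f + B p g"
    and scale_left: "B (scalar c * p) f = c * B p f" and scale_right: "B p (scalar_op c * f) = c * B p f"
begin

lemma zero_left: "B 0 f = 0" and zero_right: "B p 0 = 0"
  using add_left[of 0 0] add_right[of _ 0 0] by simp_all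

lemma sum_left: "B (sum g A) f = (\<Sum>x\<in>A. B (g x) f)"
  by (induct A rule: infinite_finite_induct) (simp_all add: zero_left add_left)

lemma sum_right: "B p (sum g A) = (\<Sum>x\<in>A. B p (g x))"
  by (induct A rule: infinite_finite_induct) (simp_all add: zero_right add_right)

text \<open>This is \<open>Tr(X Y)\<close> with the entries of the two matrices joined by
  \<open>B\<close>. Complex matrices can cross from one argument to the other at both ends, which
  replaces cyclicity of the trace.\<close>

definition pairing :: "('n \<times> 'n) free_alg^'m::finite^'m \<Rightarrow> ('n \<times> 'n) free_alg endo^'m^'m \<Rightarrow> complex" where
  "pairing X Y = (\<Sum>s\<in>UNIV. \<Sum>u\<in>UNIV. B (X $ s $ u) (Y $ u $ s))"

lemma pairing_add: "pairing (X + X') Y = pairing X Y + pairing X' Y"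
  by (simp add: pairing_def add_left sum.distrib)

lemma pairing_emb_right: "pairing (X ** emb A) Y = pairing X (map_matrix scalar_op A ** Y)"
proof -
  have "B (X $ s $ k * scalar (A $ k $ u)) (Y $ u $ s) = B (X $ s $ k) (scalar_op (A $ k $ u) * Y $ u $ s)" for s k u
    by (simp only: scale_right scale_left scalar_commute[symmetric])
  then show ?thesis
    by (simp add: pairing_def matrix_mult_nth emb_def sum_left sum_right)
      (rule sum.cong[OF refl], rule sum.swap)
qed

lemma pairing_emb_left:
  assumes "entries_linear scalar_op Y"
  shows "pairing (emb A ** X) Y = pairing X (Y ** map_matrix scalar_op A)"
proof -
  have "B (scalar (A $ s $ k) * X $ k $ u) (Y $ u $ s) = B (X $ k $ u) (Y $ u $ s * scalar_op (A $ s $ k))" for s k u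
  proof -
    have "Y $ u $ s * scalar_op (A $ s $ k) = scalar_op (A $ s $ k) * Y $ u $ s"
      using assms unfolding entries_linear_def scalar_linear_def by metis
    then show ?thesis by (simp only: scale_right scale_left)
  qed
  then have "pairing (emb A ** X) Y = (\<Sum>s\<in>UNIV. \<Sum>u\<in>UNIV. \<Sum>k\<in>UNIV. B (X $ k $ u) (Y $ u $ s * scalar_op (A $ s $ k)))"
    by (simp add: pairing_def matrix_mult_nth emb_def sum_left)
  also have "\<dots> = pairing X (Y ** map_matrix scalar_op A)"
    unfolding pairing_def matrix_mult_nth sum_right nth_map_matrix
    by (subst sum_rotate3, subst sum_rotate3, rule sum.cong[OF refl], rule sum.swap)
  finally show ?thesis .
qed

end

lemma (in skew_hecke) pairing_de_Rham_zero:
  assumes B: "scalar_bilinear B" and ideal: "\<And>p f. p \<in> rel_ideal (Dif_rels R) \<Longrightarrow> B p f = 0"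
  shows "scalar_bilinear.pairing B
     (emb (CC_matrix R) ** on1 gen_matrix ** emb R ** on1 gen_matrix ** emb (matrix_inv R))
     (map_matrix scalar_op R ** on1 deriv_ops ** map_matrix scalar_op (matrix_inv R) ** on1 deriv_ops) = 0"
proof -
  interpret scalar_bilinear B by (rule B)
  interpret s: ring_morphism "scalar :: complex \<Rightarrow> ('n \<times> 'n) free_alg" by (rule ring_morphism_scalar)
  interpret o: ring_morphism "scalar_op :: complex \<Rightarrow> ('n \<times> 'n) free_alg endo" by (rule ring_morphism_scalar_op)
  let ?G = "on1 gen_matrix :: ('n \<times> 'n) free_alg^('n \<times> 'n)^('n \<times> 'n)"
  let ?A = "map_matrix scalar_op R :: ('n \<times> 'n) free_alg endo^('n \<times> 'n)^('n \<times> 'n)"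
    and ?B = "map_matrix scalar_op (matrix_inv R) :: ('n \<times> 'n) free_alg endo^('n \<times> 'n)^('n \<times> 'n)"
  let ?D = "on1 deriv_ops" and ?C = "CC_matrix R" and ?l = "q - inverse q"
  \<comment> \<open>With the index \<open>2bar\<close> denoting conjugation of the first leg by
    \<open>R\<close>, \<open>W\<close> is the product of differentials in legs \<open>1\<close>,
    \<open>2bar\<close>, and \<open>V\<close> that of derivatives in legs \<open>2bar\<close>,
    \<open>1\<close>.\<close>
  define W where "W = ?G ** emb R ** ?G ** emb (matrix_inv R)"
  define V where "V = ?A ** ?D ** ?B ** ?D"
  let ?e = "matrix_endo :: ('n \<times> 'n) free_alg endo^('n \<times> 'n)^('n \<times> 'n) \<Rightarrow> _"
  note el = entries_linear_closed[OF ring_morphism_scalar_op]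
  have Vlin: "entries_linear scalar_op V" by (simp add: V_def el entries_linear_deriv_ops)
  have "?A ** ?B = map_matrix scalar_op (R ** matrix_inv R)" by (simp only: o.map_matrix_mult)
  also have "\<dots> = mat 1" by (simp only: hecke_inverse(1)[OF hecke] o.map_matrix_mat o.one)
  finally have AB: "?e ?A * ?e ?B = 1" by (simp flip: matrix_endo_simps)
  have "?B ** ?A = map_matrix scalar_op (matrix_inv R ** R)" by (simp only: o.map_matrix_mult)
  also have "\<dots> = mat 1" by (simp only: hecke_inverse(2)[OF hecke] o.map_matrix_mat o.one)
  finally have BA: "?e ?B * ?e ?A = 1" by (simp flip: matrix_endo_simps)
  have Z: "?e ?B * ?e ?D * ?e ?B * ?e ?D = ?e ?D * ?e ?B * ?e ?D * ?e ?B"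
    using arg_cong[OF d_matrix_deriv_ops, of ?e] by (simp add: d_matrix_def Let_def matrix_endo_simps)
  \<comment> \<open>\<open>V = R^2 U\<close> with \<open>U = R^-1 D_1 R^-1 D_1\<close>, and the
    relations of \<open>\<D>(R)\<close> say that \<open>U\<close> commutes with
    \<open>R\<close>.\<close>
  have VA: "V ** ?A = ?A ** V"
  proof -
    have "?e V * ?e ?A = ?e ?A * (?e ?D * ?e ?B * ?e ?D * ?e ?B) * ?e ?A * ?e ?A"
    proof -
      have "?e ?A * (?e ?D * ?e ?B * ?e ?D * ?e ?B) * ?e ?A * ?e ?A
         = ?e ?A * ?e ?D * ?e ?B * ?e ?D * (?e ?B * ?e ?A) * ?e ?A" by (simp only: mult.assoc)
      then show ?thesis by (simp only: BA mult_1_right V_def matrix_endo_simps)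
    qed
    also have "\<dots> = (?e ?A * ?e ?B) * ?e ?D * ?e ?B * ?e ?D * ?e ?A * ?e ?A"
      unfolding Z[symmetric] by (simp only: mult.assoc)
    also have "\<dots> = ?e ?A * (?e ?B * ?e ?D * ?e ?B * ?e ?D) * ?e ?A * ?e ?A"
      by (simp only: mult.assoc)
    finally have 1: "?e V * ?e ?A = ?e ?A * (?e ?B * ?e ?D * ?e ?B * ?e ?D) * ?e ?A * ?e ?A" .
    have "?e V = ?e ?A * ?e ?A * (?e ?B * ?e ?D * ?e ?B * ?e ?D)"
    proof -
      have "?e ?A * ?e ?A * (?e ?B * ?e ?D * ?e ?B * ?e ?D) = ?e ?A * (?e ?A * ?e ?B) * ?e ?D * ?e ?B * ?e ?D"
        by (simp only: mult.assoc)
      then show ?thesis by (simp only: AB mult_1_right V_def matrix_endo_simps)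
    qed
    then have "?e V * ?e ?A = ?e ?A * ?e ?A * (?e ?D * ?e ?B * ?e ?D * (?e ?B * ?e ?A))"
      unfolding Z by (simp only: mult.assoc)
    also have "\<dots> = ?e ?A * ?e V" by (simp only: BA mult_1_right V_def matrix_endo_simps mult.assoc)
    finally show ?thesis by (simp only: matrix_endo_inject flip: matrix_endo_simps)
  qed
  define t where "t Y = pairing (emb ?C ** W ** emb Y) V" for Y
  have t_eq: "t Y = pairing (emb ?C ** W) (map_matrix scalar_op Y ** V)" for Y
    by (simp only: t_def pairing_emb_right)
  have t_add: "t (X + Y) = t X + t Y" for X Y
    by (simp add: t_eq o.map_matrix_add pairing_def matrix_mult_nth distrib_right sum.distrib add_right)
  have t_scale: "t (mat c ** Y) = c * t Y" for c Y
  proof -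
    have "map_matrix scalar_op (mat c ** Y) ** V = mat (scalar_op c) ** (map_matrix scalar_op Y ** V)"
      by (simp only: o.map_matrix_mult o.map_matrix_mat matrix_mul_assoc)
    moreover have "(mat (scalar_op c) ** Z) $ u $ s = scalar_op c * Z $ u $ s" for Z :: "('n \<times> 'n) free_alg endo^('n \<times> 'n)^('n \<times> 'n)" and u s
      by (simp add: matrix_mult_nth mat_nth if_mult_zero sum_if_UNIV)
    ultimately show ?thesis by (simp add: t_eq pairing_def scale_right sum_distrib_left)
  qed
  \<comment> \<open>The entries of \<open>R W R + W\<close> are relators. The left \<open>R\<close>
    passes \<open>C_1 C_2\<close>, goes round the trace and passes \<open>V\<close>, and so ends up
    between \<open>W\<close> and \<open>V\<close> to the right of \<open>X R\<close>; it is absorbed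
    as the left factor there through \<open>R X\<close> and \<open>X R\<close> being multiplied
    inside \<open>t\<close>.\<close>
  have rel: "t (R ** X ** R) = - t X" for X
  proof -
    have WR: "W ** emb R = ?G ** emb R ** ?G"
    proof -
      have "emb (matrix_inv R) ** emb R = (emb (matrix_inv R ** R) :: ('n \<times> 'n) free_alg^('n \<times> 'n)^('n \<times> 'n))"
        by (simp only: emb_def s.map_matrix_mult)
      then show ?thesis
        by (simp only: W_def matrix_mul_assoc[symmetric] hecke_inverse(2)[OF hecke] emb_def s.map_matrix_mat s.one matrix_mul_rid)
    qed
    have "pairing (emb ?C ** (emb R ** W ** emb R + W) ** emb X) V = 0"
    proof -
      have "emb R ** W ** emb R + W = emb R ** ?G ** emb R ** ?G + ?G ** emb R ** ?G ** emb (matrix_inv R)"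
        by (simp only: WR matrix_mul_assoc[symmetric]) (simp only: W_def matrix_mul_assoc)
      then have "entries_in (rel_ideal (Dif_rels R)) (emb R ** W ** emb R + W)"
        unfolding entries_in_def Dif_rels_eq entries_def by (auto intro!: rel_ideal_relator)
      then have "entries_in (rel_ideal (Dif_rels R)) (emb ?C ** (emb R ** W ** emb R + W) ** emb X)"
        by (intro entries_in_emb_left entries_in_emb_right linear_subspace_rel_ideal)
      then show ?thesis by (simp only: pairing_def ideal entries_in_def sum.neutral_const)
    qed
    moreover have "emb ?C ** (emb R ** W ** emb R + W) ** emb X
      = emb R ** (emb ?C ** W ** emb (R ** X)) + emb ?C ** W ** emb X"
    proof -
      have c: "emb ?C ** emb R = (emb R ** emb ?C :: ('n \<times> 'n) free_alg^('n \<times> 'n)^('n \<times> 'n))"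
        by (simp only: emb_def CC_matrix_commute[OF hecke skew] flip: s.map_matrix_mult)
      have "matrix_endo (emb ?C ** (emb R ** W ** emb R + W) ** emb X)
         = matrix_endo (emb ?C ** emb R ** W ** emb R ** emb X + emb ?C ** W ** emb X)"
        by (simp only: matrix_endo_simps distrib_left distrib_right mult.assoc)
      then show ?thesis
        by (simp only: matrix_endo_inject c) (simp only: emb_def s.map_matrix_mult matrix_mul_assoc)
    qed
    moreover have "pairing (emb R ** (emb ?C ** W ** emb (R ** X))) V = t (R ** X ** R)"
    proof -
      have "pairing (emb R ** (emb ?C ** W ** emb (R ** X))) V = pairing (emb ?C ** W ** emb (R ** X)) (?A ** V)"
        by (simp only: pairing_emb_left[OF Vlin] VA)
      also have "\<dots> = t (R ** X ** R)"
        by (simp only: t_eq pairing_emb_right o.map_matrix_mult matrix_mul_assoc)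
      finally show ?thesis .
    qed
    ultimately show ?thesis by (simp add: pairing_add t_def add_eq_0_iff)
  qed
  have RR: "R ** R = mat 1 + mat ?l ** R" by (rule hecke_inverse(4)[OF hecke])
  \<comment> \<open>The two equations \<open>e1\<close> and \<open>e2\<close> come from
    \<open>rel\<close> with \<open>X\<close> equal to the identity and to \<open>R\<close>, reduced
    by the quadratic relation for \<open>R\<close>.\<close>
  have "t (R ** mat 1 ** R) = t (mat 1) + ?l * t R"
    by (simp add: RR t_add t_scale)
  then have e1: "2 * t (mat 1) + ?l * t R = 0" by (simp only: rel) (simp add: algebra_simps)
  have m: "mat ?l ** mat 1 = (mat ?l :: complex^('n \<times> 'n)^('n \<times> 'n))" by simp
  have "R ** R ** R = R + mat ?l ** (R ** R)"
  proof -
    have "matrix_endo (R ** R ** R) = matrix_endo ((mat 1 + mat ?l ** R) ** R)" unfolding RR ..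
    then have "matrix_endo (R ** R ** R) = matrix_endo (R + mat ?l ** (R ** R))"
      by (simp only: matrix_endo_simps distrib_right mult_1_left mult.assoc)
    then show ?thesis by (simp only: matrix_endo_inject)
  qed
  then have "t (R ** R ** R) = t R + ?l * (t (mat 1) + ?l * t R)"
    by (simp only: t_add t_scale RR)
  then have e2: "?l * t (mat 1) + (2 + ?l * ?l) * t R = 0" by (simp only: rel) (simp add: algebra_simps)
  have "(q + inverse q) * (q + inverse q) = 4 + ?l * ?l"
    using hecke by (simp add: hecke_symmetry_def field_simps)
  then have d: "4 + ?l * ?l \<noteq> 0" using hecke by (metis hecke_symmetry_def mult_eq_0_iff)
  \<comment> \<open>Elimination of \<open>t (mat 1)\<close> from \<open>e1\<close> and
    \<open>e2\<close>.\<close>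
  have "(4 + ?l * ?l) * t R = 2 * (?l * t (mat 1) + (2 + ?l * ?l) * t R) - ?l * (2 * t (mat 1) + ?l * t R)"
    by (simp add: algebra_simps)
  then have "t R = 0" using d unfolding e1 e2 by simp
  then have "t (mat 1) = 0" using e1 by simp
  then show ?thesis
    by (simp add: t_def W_def V_def matrix_mul_assoc emb_def s.map_matrix_mat s.one)
qed

text \<open>Links the formula for the square by a double \<open>R\<close>-trace with the operator
  applied twice: between the two products the matrix \<open>R\<close> and its inverse conjugate one
  factor, and the partial trace identity removes them.\<close>

lemma (in skew_hecke) de_Rham_square_pairing:
  assumes B: "scalar_bilinear B"
  shows "scalar_bilinear.pairing B
     (emb (CC_matrix R) ** on1 gen_matrix ** emb R ** on1 gen_matrix ** emb (matrix_inv R))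
     (map_matrix scalar_op R ** on1 deriv_ops ** map_matrix scalar_op (matrix_inv R) ** on1 deriv_ops)
   = (\<Sum>i\<in>UNIV. \<Sum>j\<in>UNIV. \<Sum>k\<in>UNIV. \<Sum>c\<in>UNIV. \<Sum>a\<in>UNIV. \<Sum>e\<in>UNIV.
       C_matrix R $ i $ j * C_matrix R $ c $ a * B (gen (j, k) * gen (a, e)) (deriv e c * deriv k i))"
proof -
  interpret scalar_bilinear B by (rule B)
  interpret o: ring_morphism "scalar_op :: complex \<Rightarrow> ('n \<times> 'n) free_alg endo" by (rule ring_morphism_scalar_op)
  let ?G = "on1 gen_matrix :: ('n \<times> 'n) free_alg^('n \<times> 'n)^('n \<times> 'n)"
  let ?A = "map_matrix scalar_op R :: ('n \<times> 'n) free_alg endo^('n \<times> 'n)^('n \<times> 'n)"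
    and ?B = "map_matrix scalar_op (matrix_inv R) :: ('n \<times> 'n) free_alg endo^('n \<times> 'n)^('n \<times> 'n)"
  let ?C = "C_matrix R" and ?S = "matrix_inv R"
  define T where "T j k a e c l i = B (gen (j, k) * gen (a, e)) (deriv e c * deriv l i)" for j k a e c l i
  have "?B ** ?A = map_matrix scalar_op (?S ** R)" by (simp only: o.map_matrix_mult)
  also have "\<dots> = mat 1" by (simp only: hecke_inverse(2)[OF hecke] o.map_matrix_mat o.one)
  finally have BA: "?B ** ?A = mat 1" .
  \<comment> \<open>The last \<open>R^-1\<close> on the side of the differentials crosses to the
    operators and cancels their leading \<open>R\<close>.\<close>
  have cancel: "?B ** (?A ** on1 deriv_ops ** ?B ** on1 deriv_ops) = on1 deriv_ops ** ?B ** on1 deriv_ops"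
    by (simp only: matrix_mul_assoc BA matrix_mul_lid)
  have X: "(emb (CC_matrix R) ** ?G ** emb R ** ?G) $ (i, x) $ (e, b)
    = (\<Sum>a\<in>UNIV. \<Sum>k\<in>UNIV. \<Sum>y\<in>UNIV. \<Sum>j\<in>UNIV.
        scalar (?C $ i $ j * ?C $ x $ y * R $ (k, y) $ (a, b)) * (gen (j, k) * gen (a, e)))" for i x e b
  proof -
    have "scalar u * g * scalar v * g' = scalar (u * v) * (g * g')" for u v and g g' :: "('n \<times> 'n) free_alg"
      by (simp only: ring_morphism.mult[OF ring_morphism_scalar] mult.assoc scalar_left_commute[of g])
    then show ?thesis
      by (simp add: matrix_mult_nth sum_UNIV_prod on1_nth if_mult_zero sum_if_const sum_if_UNIV
          gen_matrix_def emb_def CC_matrix_nth sum_distrib_right)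
  qed
  have Y: "(on1 deriv_ops ** ?B ** on1 deriv_ops) $ (e, b) $ (i, x)
    = (\<Sum>l\<in>UNIV. \<Sum>c\<in>UNIV. scalar_op (?S $ (c, b) $ (l, x)) * (deriv e c * deriv l i))" for i x e b
  proof -
    have "deriv e c * scalar_op u * deriv l i = scalar_op u * (deriv e c * deriv l i)" for c l u
      by (rule endo_eqI) (simp add: app_times app_scalar_op app_deriv_scalar)
    then show ?thesis
      by (simp add: matrix_mult_nth sum_UNIV_prod on1_nth if_mult_zero sum_if_const sum_if_UNIV
          deriv_ops_def sum_distrib_right)
  qed
  have "pairing (emb (CC_matrix R) ** ?G ** emb R ** ?G ** emb ?S)
     (?A ** on1 deriv_ops ** ?B ** on1 deriv_ops)
    = pairing (emb (CC_matrix R) ** ?G ** emb R ** ?G) (on1 deriv_ops ** ?B ** on1 deriv_ops)"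
    by (simp only: pairing_emb_right cancel)
  also have "\<dots> = (\<Sum>i\<in>UNIV. \<Sum>x\<in>UNIV. \<Sum>e\<in>UNIV. \<Sum>b\<in>UNIV. \<Sum>l\<in>UNIV. \<Sum>c\<in>UNIV. \<Sum>a\<in>UNIV. \<Sum>k\<in>UNIV. \<Sum>y\<in>UNIV. \<Sum>j\<in>UNIV.
      ?C $ i $ j * ?C $ x $ y * R $ (k, y) $ (a, b) * ?S $ (c, b) $ (l, x) * T j k a e c l i)"
    unfolding pairing_def sum_UNIV_prod X Y
    by (simp add: sum_left sum_right scale_left scale_right sum_distrib_left T_def mult_ac)
  \<comment> \<open>The sum is written over tuples to permute all ten indices at once;
    \<open>y\<close>, \<open>x\<close>, \<open>b\<close> become innermost, where they form the
    partial trace, which forces \<open>k = l\<close>.\<close>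
  also have "\<dots> = (\<Sum>(i,x,e,b,l,c,a,k,y,j)\<in>UNIV.
      ?C $ i $ j * ?C $ x $ y * R $ (k, y) $ (a, b) * ?S $ (c, b) $ (l, x) * T j k a e c l i)"
    by (simp only: sum_UNIV_prod case_prod_conv)
  also have "\<dots> = (\<Sum>(i,j,k,c,a,e,l,y,x,b)\<in>UNIV.
      ?C $ i $ j * ?C $ x $ y * R $ (k, y) $ (a, b) * ?S $ (c, b) $ (l, x) * T j k a e c l i)"
    by (rule sum.reindex_bij_witness[of _ "\<lambda>(i,j,k,c,a,e,l,y,x,b). (i,x,e,b,l,c,a,k,y,j)"
          "\<lambda>(i,x,e,b,l,c,a,k,y,j). (i,j,k,c,a,e,l,y,x,b)"]) (simp_all add: split_beta)
  also have "\<dots> = (\<Sum>i\<in>UNIV. \<Sum>j\<in>UNIV. \<Sum>k\<in>UNIV. \<Sum>c\<in>UNIV. \<Sum>a\<in>UNIV. \<Sum>e\<in>UNIV. \<Sum>l\<in>UNIV.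
      ?C $ i $ j * (\<Sum>y\<in>UNIV. \<Sum>x\<in>UNIV. \<Sum>b\<in>UNIV. R $ (k, y) $ (a, b) * ?S $ (c, b) $ (l, x) * ?C $ x $ y) * T j k a e c l i)"
    by (simp only: sum_UNIV_prod case_prod_conv)
      (simp only: sum_distrib_left sum_distrib_right mult_ac)
  also have "\<dots> = (\<Sum>i\<in>UNIV. \<Sum>j\<in>UNIV. \<Sum>k\<in>UNIV. \<Sum>c\<in>UNIV. \<Sum>a\<in>UNIV. \<Sum>e\<in>UNIV. \<Sum>l\<in>UNIV.
      if k = l then ?C $ i $ j * ?C $ c $ a * T j k a e c l i else 0)"
    unfolding partial_trace_conjugation[OF skew hecke_inverse(2)[OF hecke] braid_conjugations(1)[OF hecke]]
    by (intro sum.cong refl) simp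
  also have "\<dots> = (\<Sum>i\<in>UNIV. \<Sum>j\<in>UNIV. \<Sum>k\<in>UNIV. \<Sum>c\<in>UNIV. \<Sum>a\<in>UNIV. \<Sum>e\<in>UNIV.
      ?C $ i $ j * ?C $ c $ a * T j k a e c k i)"
    by (simp only: sum_if_UNIV)
  finally show ?thesis by (simp only: T_def)
qed

lemma (in skew_hecke) de_Rham_square_zero:
  assumes "scalar_bilinear B" and "\<And>p f. p \<in> rel_ideal (Dif_rels R) \<Longrightarrow> B p f = 0"
  shows "(\<Sum>i\<in>UNIV. \<Sum>j\<in>UNIV. \<Sum>k\<in>UNIV. \<Sum>c\<in>UNIV. \<Sum>a\<in>UNIV. \<Sum>e\<in>UNIV.
       C_matrix R $ i $ j * C_matrix R $ c $ a * B (gen (j, k) * gen (a, e)) (deriv e c * deriv k i)) = 0"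
  using pairing_de_Rham_zero[OF assms] unfolding de_Rham_square_pairing[OF assms(1)] .

section \<open>Descent to the tensor product\<close>

abbreviation cscale :: "complex \<Rightarrow> ('k \<Rightarrow>\<^sub>0 complex) \<Rightarrow> 'k \<Rightarrow>\<^sub>0 complex" where
  "cscale c \<equiv> Poly_Mapping.map ((*) c)"

lemma lookup_cscale: "Poly_Mapping.lookup (cscale c p) k = c * Poly_Mapping.lookup p k"
  by (simp add: Poly_Mapping.map.rep_eq when_def)

lemma cscale_single: "cscale c (Poly_Mapping.single k d) = Poly_Mapping.single k (c * d)"
  by (simp add: map_single)

interpretation cscale: vector_space cscale
  by unfold_locales (auto intro!: poly_mapping_eqI simp: lookup_cscale lookup_add algebra_simps)

text \<open>If \<open>x\<close> is outside the span, a basis of the span stays independent after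
  adding \<open>x\<close>, and some functional is 1 at \<open>x\<close> and 0 on the span.\<close>

lemma mem_span_functional:
  assumes "\<And>\<phi> :: ('k \<Rightarrow>\<^sub>0 complex) \<Rightarrow> complex. Vector_Spaces.linear cscale (*) \<phi> \<Longrightarrow> (\<And>s. s \<in> S \<Longrightarrow> \<phi> s = 0) \<Longrightarrow> \<phi> x = 0"
  shows "x \<in> cscale.span S"
proof (rule ccontr)
  assume x: "x \<notin> cscale.span S"
  interpret pair: vector_space_pair "cscale :: complex \<Rightarrow> ('k \<Rightarrow>\<^sub>0 complex) \<Rightarrow> _" "(*) :: complex \<Rightarrow> _"
    by unfold_locales (simp_all add: algebra_simps)
  obtain B where B: "B \<subseteq> S" "cscale.independent B" "S \<subseteq> cscale.span B"
    using cscale.maximal_independent_subset[of S] by blast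
  have "x \<notin> cscale.span B" using x B(1) cscale.span_mono by blast
  then have "cscale.independent (insert x B)" using B(2) by (rule cscale.independent_insertI)
  from pair.linear_independent_extend[OF this, of "\<lambda>y. if y = x then 1 else 0"]
  obtain g where g: "Vector_Spaces.linear cscale (*) g" "\<forall>y\<in>insert x B. g y = (if y = x then 1 else 0)"
    by blast
  have "g b = 0" if "b \<in> B" for b
    using g(2) that x cscale.span_base[of b S] B(1) by auto
  then have "g s = 0" if "s \<in> S" for s
    using pair.linear_eq_0_on_span[OF g(1)] B(3) that by blast
  then have "g x = 0" by (rule assms[OF g(1)])
  then show False using g(2) by simp
qed


lemma deRham_formal_add: "deRham_formal R h (x + y) = deRham_formal R h x + deRham_formal R h y"
  and deRham_formal_single: "deRham_formal R h (Poly_Mapping.single (\<omega>, a) c) = (\<Sum>i\<in>UNIV. \<Sum>j\<in>UNIV. \<Sum>k\<in>UNIV.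
     Poly_Mapping.single (\<omega> \<otimes>\<^bsub>Dif_alg R\<^esub> cls (Dif_rels R) (gen (j, k)), qderiv R h k i a) (c * C_matrix R $ i $ j))"
proof -
  let ?g = "\<lambda>(\<omega>, a) c. \<Sum>i\<in>UNIV. \<Sum>j\<in>UNIV. \<Sum>k\<in>UNIV.
     Poly_Mapping.single (\<omega> \<otimes>\<^bsub>Dif_alg R\<^esub> cls (Dif_rels R) (gen (j, k)), qderiv R h k i a) (c * C_matrix R $ i $ j)"
  have *: "deRham_formal R h z = extend ?g z" for z
    unfolding deRham_formal_def extend_def by (rule sum.cong) (auto simp: split_beta)
  show "deRham_formal R h (x + y) = deRham_formal R h x + deRham_formal R h y"
    unfolding * by (rule extend_add) (auto simp: split_beta distrib_right single_add sum.distrib)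
  show "deRham_formal R h (Poly_Mapping.single (\<omega>, a) c) = (\<Sum>i\<in>UNIV. \<Sum>j\<in>UNIV. \<Sum>k\<in>UNIV.
     Poly_Mapping.single (\<omega> \<otimes>\<^bsub>Dif_alg R\<^esub> cls (Dif_rels R) (gen (j, k)), qderiv R h k i a) (c * C_matrix R $ i $ j))"
    unfolding * by (subst extend_single) simp_all
qed

lemma deRham_formal_0: "deRham_formal R h 0 = 0"
  by (simp add: deRham_formal_def)

lemma deRham_formal_diff: "deRham_formal R h (x - y) = deRham_formal R h x - deRham_formal R h y"
  using deRham_formal_add[of R h "x - y" y] by (simp add: eq_diff_eq)

lemma deRham_formal_sum: "deRham_formal R h (sum f A) = (\<Sum>x\<in>A. deRham_formal R h (f x))"
  by (induct A rule: infinite_finite_induct) (simp_all add: deRham_formal_0 deRham_formal_add)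

lemma deRham_formal_cscale: "deRham_formal R h (cscale c x) = cscale c (deRham_formal R h x)"
proof (induct x rule: poly_mapping_additive_induct)
  case (1 k d)
  show ?case
    by (cases k) (simp add: cscale_single deRham_formal_single cscale.scale_sum_right mult.assoc)
qed (simp add: cscale.scale_right_distrib deRham_formal_add)

lemma tensor_null_eq: "tensor_null A B = cscale.span (bilinear_relators A B)"
  by (simp add: tensor_null_def)

context skew_hecke
begin

abbreviation Null where "Null \<equiv> tensor_null (Dif_alg R) (M_alg R h)"

abbreviation wcls :: "('n \<times> 'n) free_alg \<Rightarrow> ('n \<times> 'n) free_alg set" where "wcls \<equiv> cls (Dif_rels R)"

abbreviation acls :: "('n \<times> 'n) free_alg \<Rightarrow> ('n \<times> 'n) free_alg set" where "acls \<equiv> cls (M_rels R h)"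

lemmas algebra_cls = presented_algebra_simps[of "Dif_rels R", folded Dif_alg_def]
  presented_algebra_simps[of "M_rels R h", folded M_alg_def]

lemma tensor_relations:
  "Poly_Mapping.single (wcls (p + r), acls a) 1 - Poly_Mapping.single (wcls p, acls a) 1
     - Poly_Mapping.single (wcls r, acls a) 1 \<in> bilinear_relators (Dif_alg R) (M_alg R h)"
  "Poly_Mapping.single (wcls p, acls (a + b)) 1 - Poly_Mapping.single (wcls p, acls a) 1
     - Poly_Mapping.single (wcls p, acls b) 1 \<in> bilinear_relators (Dif_alg R) (M_alg R h)"
  "Poly_Mapping.single (wcls (scalar c * p), acls a) 1 - Poly_Mapping.single (wcls p, acls a) c
     \<in> bilinear_relators (Dif_alg R) (M_alg R h)"
  "Poly_Mapping.single (wcls p, acls (scalar c * a)) 1 - Poly_Mapping.single (wcls p, acls a) c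
     \<in> bilinear_relators (Dif_alg R) (M_alg R h)"
proof -
  have carr: "wcls p \<in> carrier (Dif_alg R)" "acls a \<in> carrier (M_alg R h)" for p a
    by (simp_all add: algebra_cls)
  show "Poly_Mapping.single (wcls (p + r), acls a) 1 - Poly_Mapping.single (wcls p, acls a) 1
     - Poly_Mapping.single (wcls r, acls a) 1 \<in> bilinear_relators (Dif_alg R) (M_alg R h)"
    unfolding bilinear_relators_def algebra_cls(3)[symmetric]
    by (rule UnI1, rule UnI1, rule UnI1) (use carr in blast)
  show "Poly_Mapping.single (wcls p, acls (a + b)) 1 - Poly_Mapping.single (wcls p, acls a) 1
     - Poly_Mapping.single (wcls p, acls b) 1 \<in> bilinear_relators (Dif_alg R) (M_alg R h)"
    unfolding bilinear_relators_def algebra_cls(7)[symmetric]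
    by (rule UnI1, rule UnI1, rule UnI2) (use carr in blast)
  show "Poly_Mapping.single (wcls (scalar c * p), acls a) 1 - Poly_Mapping.single (wcls p, acls a) c
     \<in> bilinear_relators (Dif_alg R) (M_alg R h)"
    unfolding bilinear_relators_def algebra_cls(4)[symmetric]
    by (rule UnI1, rule UnI2) (use carr in blast)
  show "Poly_Mapping.single (wcls p, acls (scalar c * a)) 1 - Poly_Mapping.single (wcls p, acls a) c
     \<in> bilinear_relators (Dif_alg R) (M_alg R h)"
    unfolding bilinear_relators_def algebra_cls(8)[symmetric]
    by (rule UnI2) (use carr in blast)
qed

lemma bilinear_relators_cases:
  assumes "s \<in> bilinear_relators (Dif_alg R) (M_alg R h)"
  obtains p r a where "s = Poly_Mapping.single (wcls (p + r), acls a) 1 - Poly_Mapping.single (wcls p, acls a) 1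
     - Poly_Mapping.single (wcls r, acls a) 1"
  | p a b where "s = Poly_Mapping.single (wcls p, acls (a + b)) 1 - Poly_Mapping.single (wcls p, acls a) 1
     - Poly_Mapping.single (wcls p, acls b) 1"
  | c p a where "s = Poly_Mapping.single (wcls (scalar c * p), acls a) 1 - Poly_Mapping.single (wcls p, acls a) c"
  | c p a where "s = Poly_Mapping.single (wcls p, acls (scalar c * a)) 1 - Poly_Mapping.single (wcls p, acls a) c"
  using assms unfolding bilinear_relators_def algebra_cls(1,5)
  by (auto simp: algebra_cls(3,4,7,8))

lemma deRham_formal_cls:
  "deRham_formal R h (Poly_Mapping.single (wcls p, acls a) c) = (\<Sum>i\<in>UNIV. \<Sum>j\<in>UNIV. \<Sum>k\<in>UNIV.
     cscale (C_matrix R $ i $ j) (Poly_Mapping.single (wcls (p * gen (j, k)), acls (app (deriv k i) a)) c))"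
  by (simp add: deRham_formal_single algebra_cls(2) qderiv_cls cscale_single mult.commute)

text \<open>Right multiplication by a differential and the derivatives are linear, so each
  bilinearity relator goes to a combination of relators of its own kind.\<close>

lemma deRham_formal_null:
  assumes "x \<in> Null" shows "deRham_formal R h x \<in> Null"
proof -
  have base: "s \<in> bilinear_relators (Dif_alg R) (M_alg R h) \<Longrightarrow> s \<in> Null" for s
    unfolding tensor_null_eq by (rule cscale.span_base)
  have sums: "(\<Sum>i\<in>(UNIV::'n set). \<Sum>j\<in>(UNIV::'n set). \<Sum>k\<in>(UNIV::'n set). cscale (C_matrix R $ i $ j) (f i j k)) \<in> Null"
    if "\<And>i j k. f i j k \<in> bilinear_relators (Dif_alg R) (M_alg R h)" for f
    unfolding tensor_null_eq by (intro cscale.span_sum cscale.span_scale cscale.span_base that)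
  have rel: "deRham_formal R h s \<in> Null" if "s \<in> bilinear_relators (Dif_alg R) (M_alg R h)" for s
    using that
  proof (cases rule: bilinear_relators_cases)
    case (1 p r a)
    show ?thesis
      unfolding 1 deRham_formal_diff deRham_formal_cls sum_subtractf[symmetric] cscale.scale_right_diff_distrib[symmetric]
        distrib_right
      by (intro sums tensor_relations)
  next
    case (2 p a b)
    show ?thesis
      unfolding 2 deRham_formal_diff deRham_formal_cls sum_subtractf[symmetric] cscale.scale_right_diff_distrib[symmetric]
        app_add
      by (intro sums tensor_relations)
  next
    case (3 c p a)
    show ?thesis
      unfolding 3 deRham_formal_diff deRham_formal_cls sum_subtractf[symmetric] cscale.scale_right_diff_distrib[symmetric]
        mult.assoc
      by (intro sums tensor_relations)
  next
    case (4 c p a)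
    show ?thesis
      unfolding 4 deRham_formal_diff deRham_formal_cls sum_subtractf[symmetric] cscale.scale_right_diff_distrib[symmetric]
        app_deriv_scalar
      by (intro sums tensor_relations)
  qed
  have "x \<in> cscale.span (bilinear_relators (Dif_alg R) (M_alg R h))" using assms by (simp add: tensor_null_eq)
  then show ?thesis
  proof (induct rule: cscale.span_induct_alt)
    case base
    then show ?case by (simp add: deRham_formal_0 tensor_null_eq cscale.span_zero)
  next
    case (step c s y)
    then show ?case
      using rel[OF step(1)] unfolding tensor_null_eq deRham_formal_add deRham_formal_cscale
      by (intro cscale.span_add cscale.span_scale)
  qed
qed

lemma deRham_formal_square_cls:
  "deRham_formal R h (deRham_formal R h (Poly_Mapping.single (wcls p, acls x) d)) \<in> Null"
  unfolding tensor_null_eq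
proof (rule mem_span_functional)
  fix \<phi> assume lin: "Vector_Spaces.linear cscale (*) \<phi>"
    and rel: "\<And>s. s \<in> bilinear_relators (Dif_alg R) (M_alg R h) \<Longrightarrow> \<phi> s = 0"
  interpret \<phi>: Vector_Spaces.linear cscale "(*)" \<phi> by (rule lin)
  \<comment> \<open>The functional \<phi> at \<open>p * r\<close> tensored with \<open>f\<close>
    applied to \<open>x\<close>; the two rounds of the operator contribute only to \<open>r\<close>
    and \<open>f\<close>.\<close>
  define B where "B r f = \<phi> (Poly_Mapping.single (wcls (p * r), acls (app f x)) 1)" for r f
  have one: "\<phi> (Poly_Mapping.single u c) = c * \<phi> (Poly_Mapping.single u 1)" for u c
    using \<phi>.scale[of c "Poly_Mapping.single u 1"] by (simp add: cscale_single)
  have "scalar_bilinear B"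
  proof
    show "B (r + s) f = B r f + B s f" for r s f
      using rel[OF tensor_relations(1)[of "p * r" "p * s" "app f x"]]
      by (simp add: B_def \<phi>.diff distrib_left diff_eq_eq add.commute)
    show "B r (f + g) = B r f + B r g" for r f g
      using rel[OF tensor_relations(2)[of "p * r" "app f x" "app g x"]]
      by (simp add: B_def \<phi>.diff app_plus diff_eq_eq add.commute)
    show "B (scalar c * r) f = c * B r f" for c r f
      using rel[OF tensor_relations(3)[of c "p * r" "app f x"]]
      by (simp add: B_def \<phi>.diff scalar_left_commute one[of _ c])
    show "B r (scalar_op c * f) = c * B r f" for c r f
      using rel[OF tensor_relations(4)[of "p * r" c "app f x"]]
      by (simp add: B_def \<phi>.diff app_times app_scalar_op one[of _ c])
  qed
  moreover have "B r f = 0" if "r \<in> rel_ideal (Dif_rels R)" for r f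
  proof -
    \<comment> \<open>The zero class is written as a zero multiple so that the homogeneity relator
      with \<open>c = 0\<close> applies.\<close>
    have "wcls (p * r) = wcls (scalar 0 * p)"
      by (simp add: cls_eq_iff rel_ideal_left[OF that] ring_morphism.zero[OF ring_morphism_scalar])
    then show ?thesis
      using rel[OF tensor_relations(3)[of 0 p "app f x"]] by (simp add: B_def \<phi>.diff one[of _ 0])
  qed
  ultimately have zero: "(\<Sum>i\<in>UNIV. \<Sum>j\<in>UNIV. \<Sum>k\<in>UNIV. \<Sum>c\<in>UNIV. \<Sum>a\<in>UNIV. \<Sum>e\<in>UNIV.
       C_matrix R $ i $ j * C_matrix R $ c $ a * B (gen (j, k) * gen (a, e)) (deriv e c * deriv k i)) = 0"
    by (rule de_Rham_square_zero)
  have "\<phi> (deRham_formal R h (deRham_formal R h (Poly_Mapping.single (wcls p, acls x) d)))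
    = (\<Sum>i\<in>UNIV. \<Sum>j\<in>UNIV. \<Sum>k\<in>UNIV. \<Sum>c\<in>UNIV. \<Sum>a\<in>UNIV. \<Sum>e\<in>UNIV.
       C_matrix R $ i $ j * (C_matrix R $ c $ a * (d * B (gen (j, k) * gen (a, e)) (deriv e c * deriv k i))))"
    by (simp only: deRham_formal_cls deRham_formal_sum deRham_formal_cscale \<phi>.sum \<phi>.scale sum_distrib_left
        one[of _ d] B_def app_times mult.assoc)
  also have "\<dots> = d * (\<Sum>i\<in>UNIV. \<Sum>j\<in>UNIV. \<Sum>k\<in>UNIV. \<Sum>c\<in>UNIV. \<Sum>a\<in>UNIV. \<Sum>e\<in>UNIV.
       C_matrix R $ i $ j * C_matrix R $ c $ a * B (gen (j, k) * gen (a, e)) (deriv e c * deriv k i))"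
    by (simp only: sum_distrib_left mult_ac)
  finally show "\<phi> (deRham_formal R h (deRham_formal R h (Poly_Mapping.single (wcls p, acls x) d))) = 0"
    by (simp only: zero mult_zero_right)
qed

lemma deRham_formal_square:
  assumes "Poly_Mapping.keys x \<subseteq> carrier (Dif_alg R) \<times> carrier (M_alg R h)"
  shows "deRham_formal R h (deRham_formal R h x) \<in> Null"
proof -
  have "deRham_formal R h (deRham_formal R h (Poly_Mapping.single k c)) \<in> Null"
    if k: "k \<in> Poly_Mapping.keys x" for k c
  proof -
    obtain p a where "k = (wcls p, acls a)"
      using k assms unfolding algebra_cls(1,5) by blast
    then show ?thesis by (simp add: deRham_formal_square_cls)
  qed
  then have "deRham_formal R h (deRham_formal R h
      (\<Sum>k\<in>Poly_Mapping.keys x. Poly_Mapping.single k (Poly_Mapping.lookup x k))) \<in> Null"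
    unfolding deRham_formal_sum tensor_null_eq by (intro cscale.span_sum)
  then show ?thesis by (simp only: poly_mapping_sum_single[symmetric])
qed

lemma tensor_class_eqI: "x - y \<in> Null \<Longrightarrow> tensor_class (Dif_alg R) (M_alg R h) x = tensor_class (Dif_alg R) (M_alg R h) y"
proof -
  assume n: "x - y \<in> Null"
  have "z - x \<in> Null \<longleftrightarrow> z - y \<in> Null" for z
    using n cscale.span_add[of "z - x" _ "x - y"] cscale.span_diff[of "z - y" _ "x - y"]
    unfolding tensor_null_eq by auto
  then show ?thesis by (simp add: tensor_class_def)
qed

text \<open>Two representatives differ by a null element, which \<open>deRham_formal\<close> keeps
  null; hence the union in \<open>deRham\<close> runs over one and the same class.\<close>

lemma deRham_class:
  "deRham R h (tensor_class (Dif_alg R) (M_alg R h) x) = tensor_class (Dif_alg R) (M_alg R h) (deRham_formal R h x)"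
proof -
  have "tensor_class (Dif_alg R) (M_alg R h) (deRham_formal R h y) = tensor_class (Dif_alg R) (M_alg R h) (deRham_formal R h x)"
    if "y \<in> tensor_class (Dif_alg R) (M_alg R h) x" for y
    using that deRham_formal_null[of "y - x"]
    by (intro tensor_class_eqI) (simp add: tensor_class_def deRham_formal_diff)
  moreover have "x \<in> tensor_class (Dif_alg R) (M_alg R h) x"
    by (simp add: tensor_class_def tensor_null_eq cscale.span_zero)
  ultimately show ?thesis unfolding deRham_def by blast
qed

end

theorem proposition6p4:
  fixes R :: "complex^('n::finite \<times> 'n)^('n \<times> 'n)" and q h :: complex
  assumes "hecke_symmetry q R" and "skew_invertible R"
    and "X \<in> tensor_product (Dif_alg R) (M_alg R h)"
  shows "deRham R h (deRham R h X) = tensor_class (Dif_alg R) (M_alg R h) 0"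
proof -
  interpret skew_hecke R q h using assms(1,2) by unfold_locales
  obtain x where x: "X = tensor_class (Dif_alg R) (M_alg R h) x"
    "Poly_Mapping.keys x \<subseteq> carrier (Dif_alg R) \<times> carrier (M_alg R h)"
    using assms(3) unfolding tensor_product_def by blast
  show ?thesis
    unfolding x(1) deRham_class
    by (rule tensor_class_eqI) (simp add: deRham_formal_square[OF x(2)])
qed

end
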